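(* Let $d\ge 1$ be an integer. For each $\alpha \in [d-1,d)$ and each $C'>0$ there exists a constant $C=C(\alpha,d,C')>0$ such that $$\left\|\sup_{t>0} t^{\alpha/2} |e^{t\Delta} F| \right\|_{L^1(\nu)} \leq C \|F\|_{M_b(\mathbb{R}^d;\mathbb{R}^d)}$$ for all (nonnegative) Radon measures $\nu$ on $\mathbb{R}^d$ such that $\nu(B(x,r))\leq C'r^{d-\alpha}$ for every ball $B(x,r)\subset\mathbb{R}^d$, and all $F \in M_b(\mathbb{R}^d;\mathbb{R}^d)$ which satisfy $\operatorname{div}F=0$ in the sense of distributions.
   Context: $M_b(\mathbb{R}^d;\mathbb{R}^d)$ is the space of finite $\mathbb{R}^d$-valued Radon measures on $\mathbb{R}^d$, with the total variation norm. $e^{t\Delta}$, $t>0$, is the heat semigroup acting componentwise: $e^{t\Delta}F(x)=\int_{\mathbb{R}^d}(4\pi t)^{-d/2}e^{-|x-y|^2/4t}\,dF(y)$. *)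

theory Defs
  imports "HOL-Analysis.Analysis"
begin

section \<open>Vector measures on the Borel sets\<close>

text \<open>
  A vector measure is represented by a set function; its values outside the Borel sets are
  irrelevant for everything below.
\<close>

definition borel_vector_measure ::
    "('a::topological_space set \<Rightarrow> 'b::{t2_space, comm_monoid_add}) \<Rightarrow> bool" where
  "borel_vector_measure F \<longleftrightarrow>
     F {} = 0 \<and>
     (\<forall>A::nat \<Rightarrow> 'a set. range A \<subseteq> sets borel \<longrightarrow> disjoint_family A \<longrightarrow>
        (\<lambda>i. F (A i)) sums F (\<Union>i. A i))"

definition total_variation ::
    "('a::topological_space set \<Rightarrow> 'b::real_normed_vector) \<Rightarrow> 'a set \<Rightarrow> ennreal" where
  "total_variation F E =
     (SUP A\<in>{A :: nat \<Rightarrow> 'a set. range A \<subseteq> sets borel \<and> disjoint_family A \<and> (\<Union>i. A i) = E}.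
        \<Sum>i. ennreal (norm (F (A i))))"

definition compact_inner_regular :: "('a::topological_space set \<Rightarrow> ennreal) \<Rightarrow> bool" where
  "compact_inner_regular m \<longleftrightarrow>
     (\<forall>A\<in>sets borel. m A = (SUP K\<in>{K. compact K \<and> K \<subseteq> A}. m K))"

definition radon_measure :: "'a::t2_space measure \<Rightarrow> bool" where
  "radon_measure M \<longleftrightarrow>
     sets M = sets borel \<and>
     (\<forall>K. compact K \<longrightarrow> emeasure M K < \<infinity>) \<and>
     compact_inner_regular (emeasure M)"

definition finite_radon_vector_measures ::
    "('a::euclidean_space set \<Rightarrow> 'b::euclidean_space) set" where
  "finite_radon_vector_measures =
     {F. borel_vector_measure F \<and> total_variation F UNIV < \<infinity> \<and>
         compact_inner_regular (total_variation F)}"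


section \<open>Integration against signed and vector measures\<close>

text \<open>
  The Jordan decomposition of a signed measure: the positive part of \<open>\<mu>\<close> assigns to \<open>A\<close> the
  supremum of \<open>\<mu> B\<close> over all Borel sets \<open>B \<subseteq> A\<close>; the negative part is the positive part
  of \<open>- \<mu>\<close>. Truncation by \<open>ennreal\<close> is harmless, since \<open>B = {}\<close> contributes \<open>0\<close>.
\<close>

definition positive_part :: "('a::topological_space set \<Rightarrow> real) \<Rightarrow> 'a measure" where
  "positive_part \<mu> =
     measure_of UNIV (sets borel) (\<lambda>A. SUP B\<in>{B\<in>sets borel. B \<subseteq> A}. ennreal (\<mu> B))"

definition negative_part :: "('a::topological_space set \<Rightarrow> real) \<Rightarrow> 'a measure" where
  "negative_part \<mu> = positive_part (\<lambda>A. - \<mu> A)"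

definition signed_integral ::
    "('a::topological_space set \<Rightarrow> real) \<Rightarrow> ('a \<Rightarrow> real) \<Rightarrow> real" where
  "signed_integral \<mu> f = (LINT x|positive_part \<mu>. f x) - (LINT x|negative_part \<mu>. f x)"

definition vector_integral ::
    "('a::topological_space set \<Rightarrow> 'b::euclidean_space) \<Rightarrow> ('a \<Rightarrow> real) \<Rightarrow> 'b" where
  "vector_integral F f = (\<Sum>b\<in>Basis. signed_integral (\<lambda>A. F A \<bullet> b) f *\<^sub>R b)"


section \<open>The heat semigroup\<close>

definition heat_kernel :: "real \<Rightarrow> 'a::euclidean_space \<Rightarrow> real" where
  "heat_kernel t z =
     (4 * pi * t) powr (- real DIM('a) / 2) * exp (- (norm z)\<^sup>2 / (4 * t))"

definition heat_semigroup ::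
    "real \<Rightarrow> ('a::euclidean_space set \<Rightarrow> 'b::euclidean_space) \<Rightarrow> 'a \<Rightarrow> 'b" where
  "heat_semigroup t F x = vector_integral F (\<lambda>y. heat_kernel t (x - y))"


section \<open>Distributional divergence\<close>

primrec iterated_partial ::
    "'a::euclidean_space list \<Rightarrow> ('a \<Rightarrow> real) \<Rightarrow> 'a \<Rightarrow> real" where
  "iterated_partial [] \<phi> = \<phi>"
| "iterated_partial (b # bs) \<phi> = (\<lambda>x. frechet_derivative (iterated_partial bs \<phi>) (at x) b)"

text \<open>
  Total differentiability of all iterated partial derivatives makes each of them continuous,
  so this is the class of infinitely differentiable functions.
\<close>

definition smooth :: "('a::euclidean_space \<Rightarrow> real) \<Rightarrow> bool" where
  "smooth \<phi> \<longleftrightarrow> (\<forall>bs\<in>lists Basis. \<forall>x. iterated_partial bs \<phi> differentiable (at x))"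

definition test_functions :: "('a::euclidean_space \<Rightarrow> real) set" where
  "test_functions = {\<phi>. smooth \<phi> \<and> compact (closure {x. \<phi> x \<noteq> 0})}"

definition distributional_div ::
    "('a::euclidean_space set \<Rightarrow> 'a) \<Rightarrow> ('a \<Rightarrow> real) \<Rightarrow> real" where
  "distributional_div F \<phi> =
     - (\<Sum>b\<in>Basis. signed_integral (\<lambda>A. F A \<bullet> b) (\<lambda>x. frechet_derivative \<phi> (at x) b))"

definition divergence_free :: "('a::euclidean_space set \<Rightarrow> 'a) \<Rightarrow> bool" where
  "divergence_free F \<longleftrightarrow> (\<forall>\<phi>\<in>test_functions. distributional_div F \<phi> = 0)"


section \<open>The Jordan parts are measures with the intended values\<close>

lemma borel_vector_measure_Un:
  fixes \<mu> :: "'a::topological_space set \<Rightarrow> real"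
  assumes "borel_vector_measure \<mu>" "A \<in> sets borel" "B \<in> sets borel" "A \<inter> B = {}"
  shows "\<mu> (A \<union> B) = \<mu> A + \<mu> B"
proof -
  let ?A = "binaryset A B"
  have z: "\<mu> {} = 0" using assms(1) by (simp add: borel_vector_measure_def)
  have "range ?A \<subseteq> sets borel" "disjoint_family ?A"
    using assms by (auto simp: binaryset_def disjoint_family_on_def)
  then have "(\<lambda>i. \<mu> (?A i)) sums \<mu> (\<Union>i. ?A i)"
    using assms(1) unfolding borel_vector_measure_def by blast
  moreover have "(\<lambda>i. \<mu> (?A i)) sums (\<mu> A + \<mu> B)"
    by (rule binaryset_sums) (rule z)
  ultimately show ?thesis
    by (metis UN_binaryset_eq sums_unique2)
qed

lemma sets_positive_part [simp]: "sets (positive_part \<mu>) = sets borel"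
  and space_positive_part [simp]: "space (positive_part \<mu>) = UNIV"
  by (simp_all add: positive_part_def sets.sigma_sets_eq[of borel, simplified])

lemma emeasure_positive_part:
  fixes \<mu> :: "'a::topological_space set \<Rightarrow> real"
  assumes \<mu>: "borel_vector_measure \<mu>" and E: "E \<in> sets borel"
  shows "emeasure (positive_part \<mu>) E = (SUP B\<in>{B\<in>sets borel. B \<subseteq> E}. ennreal (\<mu> B))"
proof -
  define V where "V A = (SUP B\<in>{B\<in>sets borel. B \<subseteq> A}. ennreal (\<mu> B))" for A :: "'a set"
  have z: "\<mu> {} = 0" using \<mu> by (simp add: borel_vector_measure_def)
  have upper: "ennreal (\<mu> B) \<le> V A" if "B \<in> sets borel" "B \<subseteq> A" for A B
    unfolding V_def using that by (auto intro: SUP_upper)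
  have V0: "V {} = 0"
    unfolding V_def using z by (auto intro!: antisym SUP_least)
  have super: "V A + V B \<le> V (A \<union> B)" if "A \<inter> B = {}" for A B
  proof -
    have *: "ennreal (\<mu> X) + ennreal (\<mu> Y) \<le> V (A \<union> B)"
      if "X \<in> sets borel" "X \<subseteq> A" "Y \<in> sets borel" "Y \<subseteq> B" for X Y
    proof (cases "\<mu> X \<ge> 0 \<and> \<mu> Y \<ge> 0")
      case True
      have "\<mu> (X \<union> Y) = \<mu> X + \<mu> Y"
        using that \<open>A \<inter> B = {}\<close> by (intro borel_vector_measure_Un[OF \<mu>]) auto
      then show ?thesis
        using upper[of "X \<union> Y" "A \<union> B"] that True by (auto simp: ennreal_plus)
    next
      case False
      then have "ennreal (\<mu> X) + ennreal (\<mu> Y) \<le> max (ennreal (\<mu> X)) (ennreal (\<mu> Y))"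
        by (auto simp: not_le ennreal_neg)
      also have "\<dots> \<le> V (A \<union> B)"
        using that by (intro max.boundedI upper) auto
      finally show ?thesis .
    qed
    have ne: "{B\<in>sets borel. B \<subseteq> X} \<noteq> {}" for X :: "'a set" by auto
    have "V A + V B = (SUP X\<in>{X\<in>sets borel. X \<subseteq> A}. ennreal (\<mu> X) + V B)"
      unfolding V_def by (rule ennreal_SUP_add_left[OF ne, symmetric])
    also have "\<dots> = (SUP X\<in>{X\<in>sets borel. X \<subseteq> A}. SUP Y\<in>{Y\<in>sets borel. Y \<subseteq> B}.
        ennreal (\<mu> X) + ennreal (\<mu> Y))"
      unfolding V_def by (intro SUP_cong refl) (simp add: ennreal_SUP_add_right[OF ne])
    also have "\<dots> \<le> V (A \<union> B)"
      using * by (auto intro!: SUP_least)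
    finally show ?thesis .
  qed
  have "countably_additive (sets borel) V"
  proof (rule countably_additiveI)
    fix A :: "nat \<Rightarrow> 'a set"
    assume A: "range A \<subseteq> sets borel" "disjoint_family A"
    have fin: "(\<Sum>i<n. V (A i)) \<le> V (\<Union>i<n. A i)" for n
    proof (induction n)
      case 0
      then show ?case by (simp add: V0)
    next
      case (Suc n)
      have "A i \<inter> A n = {}" if "i < n" for i
        using A(2) that by (simp add: disjoint_family_on_def)
      then have "(\<Union>i<n. A i) \<inter> A n = {}"
        by blast
      from super[OF this] have "V (\<Union>i<n. A i) + V (A n) \<le> V (\<Union>i<Suc n. A i)"
        by (simp add: lessThan_Suc Un_commute)
      moreover have "(\<Sum>i<Suc n. V (A i)) \<le> V (\<Union>i<n. A i) + V (A n)"
        unfolding sum.lessThan_Suc by (rule add_right_mono[OF Suc])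
      ultimately show ?case
        by (rule order_trans[rotated])
    qed
    have mono: "V X \<le> V Y" if "X \<subseteq> Y" for X Y
      unfolding V_def using that by (intro SUP_subset_mono) auto
    show "(\<Sum>i. V (A i)) = V (\<Union>i. A i)"
    proof (rule antisym)
      show "(\<Sum>i. V (A i)) \<le> V (\<Union>i. A i)"
        unfolding suminf_eq_SUP
        by (rule SUP_least, rule order_trans[OF fin mono]) blast
      show "V (\<Union>i. A i) \<le> (\<Sum>i. V (A i))"
        unfolding V_def[of "\<Union>i. A i"]
      proof (rule SUP_least, clarify)
        fix B :: "'a set" assume B: "B \<in> sets borel" "B \<subseteq> (\<Union>i. A i)"
        let ?S = "\<Sum>i. V (A i)"
        have "range (\<lambda>i. B \<inter> A i) \<subseteq> sets borel" "disjoint_family (\<lambda>i. B \<inter> A i)"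
          using A B by (auto simp: disjoint_family_on_def)
        then have "(\<lambda>i. \<mu> (B \<inter> A i)) sums \<mu> (\<Union>i. B \<inter> A i)"
          using \<mu> unfolding borel_vector_measure_def by blast
        moreover have "(\<Union>i. B \<inter> A i) = B" using B by auto
        ultimately have sums: "(\<lambda>n. \<Sum>i<n. \<mu> (B \<inter> A i)) \<longlonglongrightarrow> \<mu> B"
          by (simp add: sums_def)
        show "ennreal (\<mu> B) \<le> ?S"
        proof (cases ?S)
          case (real s)
          have "(\<Sum>i<n. \<mu> (B \<inter> A i)) \<le> s" for n
          proof -
            have "ennreal (\<Sum>i<n. \<mu> (B \<inter> A i)) \<le> ennreal (\<Sum>i<n. max 0 (\<mu> (B \<inter> A i)))"
              by (intro ennreal_leI sum_mono) auto
            also have "\<dots> = (\<Sum>i<n. ennreal (max 0 (\<mu> (B \<inter> A i))))"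
              by (rule sum_ennreal[symmetric]) simp
            also have "\<dots> = (\<Sum>i<n. ennreal (\<mu> (B \<inter> A i)))"
              by (simp add: ennreal_max_0)
            also have "\<dots> \<le> (\<Sum>i<n. V (A i))"
              using A B by (intro sum_mono upper) auto
            also have "\<dots> \<le> ?S"
              by (intro sum_le_suminf) auto
            finally show ?thesis
              using real by (simp add: ennreal_le_iff)
          qed
          then have "\<mu> B \<le> s"
            using LIMSEQ_le_const2[OF sums] by blast
          then show ?thesis using real by (simp add: ennreal_leI)
        qed simp
      qed
    qed
  qed
  moreover have "positive (sets borel) V"
    by (simp add: positive_def V0)
  ultimately show ?thesis
    using emeasure_measure_of[OF positive_part_def[of \<mu>], of E] E
    unfolding V_def by simp
qed

lemma signed_integral_measure:
  fixes M :: "'a::topological_space measure"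
  assumes "finite_measure M" "sets M = sets borel"
  shows "signed_integral (measure M) f = (LINT x|M. f x)"
proof -
  interpret finite_measure M by fact
  have sp: "space M = UNIV" using sets_eq_imp_space_eq[OF assms(2)] by simp
  have bvm: "borel_vector_measure (measure M)"
    using assms(2) finite_measure_UNION by (auto simp: borel_vector_measure_def)
  then have bvm': "borel_vector_measure (\<lambda>A. - measure M A)"
    by (auto simp: borel_vector_measure_def intro: sums_minus)
  have "positive_part (measure M) = M"
  proof (rule measure_eqI)
    fix A assume "A \<in> sets (positive_part (measure M))"
    then have A: "A \<in> sets borel" by simp
    have "(SUP B\<in>{B\<in>sets borel. B \<subseteq> A}. ennreal (measure M B)) = emeasure M A"
      using A assms(2)
      by (intro antisym SUP_least)
         (auto simp: emeasure_eq_measure intro!: ennreal_leI finite_measure_mono SUP_upper2[of A])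
    then show "emeasure (positive_part (measure M)) A = emeasure M A"
      using emeasure_positive_part[OF bvm A] by simp
  qed (simp add: assms(2))
  moreover have "negative_part (measure M) = null_measure borel"
    unfolding negative_part_def
  proof (rule measure_eqI)
    fix A assume "A \<in> sets (positive_part (\<lambda>A. - measure M A))"
    then have A: "A \<in> sets borel" by simp
    have "{B\<in>sets borel. B \<subseteq> A} \<noteq> {}" by auto
    then have "(SUP B\<in>{B\<in>sets borel. B \<subseteq> A}. ennreal (- measure M B)) = 0"
      by (simp add: ennreal_neg)
    then show "emeasure (positive_part (\<lambda>A. - measure M A)) A = emeasure (null_measure borel) A"
      using emeasure_positive_part[OF bvm' A] by simp
  qed simp
  ultimately show ?thesis
    by (simp add: signed_integral_def)
qed

end

theory Submission
  imports Defs
begin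

text \<open>
  Put \<open>\<beta> = d - \<alpha>\<close>, a number in \<open>(0, 1]\<close>. For a unit Dirac mass at the origin the maximal function
  is a multiple of \<open>\<bar>x\<bar> powr (- \<beta>)\<close>, and a measure \<open>\<nu>\<close> with \<open>\<nu>(B(x, r)) \<le> C' r powr \<beta>\<close> may give each
  dyadic shell around the origin a contribution of order one: the estimate fails logarithmically, at
  small and at large distances. Divergence-free fields are better because they are superpositions of
  closed curves. A closed curve of length \<open>l\<close> that does not accumulate (a ball of radius \<open>r\<close> carries
  length at most of order \<open>r\<close>) has a maximal function of size \<open>l powr (1 - \<beta>)\<close> within distance
  \<open>l\<close>, where \<open>\<beta> \<le> 1\<close> makes small times harmless, and of size \<open>l\<^sup>2 \<bar>x\<bar> powr (- 1 - \<beta>)\<close> far away,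
  because the total moment of a closed curve vanishes. Both parts have \<open>\<nu>\<close>-integral of order \<open>l\<close>,
  which is the mass of the curve.

  Decomposing a divergence-free measure into curves is made elementary by working on the lattice
  \<open>\<epsilon> \<int>\<^sup>d\<close>. Testing \<open>F\<close> with the edge weights of a smooth partition of unity gives a finite flow along
  lattice edges; since the gradient of a vertex weight is a difference of edge weights, \<open>div F = 0\<close>
  becomes Kirchhoff's law (\<open>lattice_flux_conserved\<close>), and the weights are arranged so that the flow
  has mass at most \<open>2 d \<parallel>F\<parallel>\<close>. A finite conservative flow is a nonnegative
  combination of cycles without cancellation (\<open>conservative_flow_induct\<close>). A cycle need not be free of
  accumulation, but it can be cut: at the first moment at which it comes back much
  closer to its past than the length travelled in between, the loop just made is closed by a short
  chord and removed. Neither its arc nor its chord accumulates (\<open>atom_bound\<close>), and the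
  rest of the cycle is shorter by at least half of the length of the removed arc, so an induction on
  the length bounds every cycle by a multiple of its length (\<open>closed_walk_bound\<close>).

  All of this is uniform in \<open>\<epsilon>\<close> if only the times \<open>t \<ge> \<epsilon>\<^sup>2\<close>, which do not see the lattice, enter
  the supremum. As \<open>\<epsilon> \<rightarrow> 0\<close> the heat extensions of the discrete flows converge pointwise to the one of
  \<open>F\<close> (\<open>lattice_approximation_tendsto\<close>), and Fatou's lemma gives the theorem.
\<close>

section \<open>Pointwise estimates for the heat kernel\<close>


lemma powr_times_gaussian_le:
  fixes u \<beta> :: real
  assumes "u > 0" "0 \<le> \<beta>" "\<beta> \<le> 1"
  shows "u powr (2 + \<beta>) * exp (- u\<^sup>2 / 4) \<le> 32"
proof (cases "u \<le> 1")
  case True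
  have "u powr (2 + \<beta>) \<le> 1 powr (2 + \<beta>)" using assms True by (intro powr_mono2) auto
  moreover have "exp (- u\<^sup>2 / 4) \<le> 1" by simp
  ultimately have "u powr (2 + \<beta>) * exp (- u\<^sup>2 / 4) \<le> 1 * 1"
    by (intro mult_mono) auto
  then show ?thesis by simp
next
  case False
  have "u powr (2 + \<beta>) \<le> u powr (real 4)" using assms False by (intro powr_mono) auto
  also have "\<dots> = u ^ 4" using assms by (subst powr_realpow) auto
  finally have 1: "u powr (2 + \<beta>) \<le> u ^ 4" .
  have "(u\<^sup>2 / 4)\<^sup>2 / 2 \<le> exp (u\<^sup>2 / 4)"
  proof -
    have "0 \<le> u\<^sup>2 / 4" by simp
    then show ?thesis using exp_lower_Taylor_quadratic[of "u\<^sup>2 / 4"] by linarith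
  qed
  then have 2: "u ^ 4 \<le> 32 * exp (u\<^sup>2 / 4)" by (simp add: power2_eq_square power4_eq_xxxx)
  have "u powr (2 + \<beta>) * exp (- u\<^sup>2 / 4) \<le> (32 * exp (u\<^sup>2 / 4)) * exp (- u\<^sup>2 / 4)"
    using 1 2 by (intro mult_right_mono) auto
  also have "\<dots> = 32" by (simp add: exp_minus)
  finally show ?thesis .
qed

lemma weighted_heat_kernel:
  fixes z :: "'a::euclidean_space"
  assumes "t > 0"
  shows "t powr (\<alpha> / 2) * heat_kernel t z =
    (4 * pi) powr (- real DIM('a) / 2) * (t powr (- ((real DIM('a) - \<alpha>) / 2)) * exp (- (norm z)\<^sup>2 / (4 * t)))"
proof -
  have "t powr (\<alpha> / 2) * t powr (- real DIM('a) / 2) = t powr (- ((real DIM('a) - \<alpha>) / 2))"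
  proof -
    have "\<alpha> / 2 + - real DIM('a) / 2 = - ((real DIM('a) - \<alpha>) / 2)" by (simp add: field_simps)
    then show ?thesis by (metis powr_add)
  qed
  then show ?thesis
    using assms unfolding heat_kernel_def by (simp add: powr_mult mult_ac)
qed

lemma four_pi_powr_le_1: "(4 * pi) powr (- real n / 2) \<le> 1"
proof -
  have "1 \<le> 4 * pi" using pi_gt3 by linarith
  then show ?thesis using powr_mono[of "- real n / 2" 0 "4*pi"] by auto
qed

lemma weighted_heat_kernel_le:
  fixes z :: "'a::euclidean_space"
  assumes "t > 0"
  shows "t powr (\<alpha> / 2) * heat_kernel t z
    \<le> t powr (- ((real DIM('a) - \<alpha>) / 2)) * exp (- (norm z)\<^sup>2 / (4 * t))"
  unfolding weighted_heat_kernel[OF assms]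
  using mult_right_mono[OF four_pi_powr_le_1] by fastforce

lemma heat_kernel_nonneg: "heat_kernel t z \<ge> 0"
  by (simp add: heat_kernel_def)

text \<open>
  Away from the origin the weighted kernel is Lipschitz with a constant that is independent of \<open>t\<close>: in
  the radial variable \<open>r = u \<surd>t\<close> its derivative is at most \<open>r powr (- 1 - \<beta>)\<close> times
  \<open>u powr (2 + \<beta>) exp (- u\<^sup>2 / 4) / 2\<close>, which is bounded. Since the kernel is radial, only the distances
  of the two points from the origin matter, and the segment between them may cross it.
\<close>

lemma weighted_heat_kernel_diff:
  fixes z1 z2 :: "'a::euclidean_space"
  assumes t: "t > 0" and \<beta>: "\<beta> = real DIM('a) - \<alpha>" "0 \<le> \<beta>" "\<beta> \<le> 1"
    and s: "s > 0" "s \<le> norm z1" "s \<le> norm z2"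
  shows "t powr (\<alpha> / 2) * \<bar>heat_kernel t z1 - heat_kernel t z2\<bar>
    \<le> 16 * norm (z1 - z2) * s powr (- 1 - \<beta>)"
proof -
  define q where "q = (\<lambda>r::real. t powr (- (\<beta> / 2)) * exp (- r\<^sup>2 / (4 * t)))"
  have der: "(q has_real_derivative - (t powr (- (\<beta> / 2)) * (r / (2 * t)) * exp (- r\<^sup>2 / (4 * t)))) (at r)" for r
    unfolding q_def by (rule derivative_eq_intros refl | use t in simp)+
  have bd: "\<bar>- (t powr (- (\<beta> / 2)) * (r / (2 * t)) * exp (- r\<^sup>2 / (4 * t)))\<bar> \<le> 16 * s powr (- 1 - \<beta>)"
    if "s \<le> r" for r
  proof -
    have r: "r > 0" using s that by simp
    define u where "u = r / sqrt t"
    have u: "u > 0" "r = u * sqrt t" using r t by (auto simp: u_def)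
    have pr: "r powr (1 + \<beta>) * (t powr (- (\<beta> / 2)) * (r / (2 * t))) = u powr (2 + \<beta>) / 2"
    proof -
      have a: "sqrt t powr (1 + \<beta>) * t powr (- (\<beta> / 2)) = sqrt t"
        using t by (simp add: powr_half_sqrt[symmetric] powr_powr powr_add[symmetric] field_simps)
      have b: "r powr (1 + \<beta>) = u powr (1 + \<beta>) * sqrt t powr (1 + \<beta>)"
        using u t by (simp add: powr_mult)
      have c: "u powr (2 + \<beta>) = u powr (1 + \<beta>) * u"
        using u powr_add[of u "1+\<beta>" 1] by (simp add: add_ac)
      have d: "sqrt t * (u * sqrt t / (2 * t)) = u / 2"
        using t by (simp add: field_simps)
      have "r powr (1 + \<beta>) * (t powr (- (\<beta> / 2)) * (r / (2 * t)))
        = u powr (1 + \<beta>) * (sqrt t powr (1 + \<beta>) * t powr (- (\<beta> / 2))) * (r / (2 * t))"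
        unfolding b by (simp only: mult.assoc)
      also have "\<dots> = u powr (1 + \<beta>) * (sqrt t * (u * sqrt t / (2 * t)))"
        unfolding a u(2)[symmetric] by (simp only: mult.assoc)
      also have "\<dots> = u powr (2 + \<beta>) / 2" unfolding c d by simp
      finally show ?thesis .
    qed
    have e: "r\<^sup>2 / (4 * t) = u\<^sup>2 / 4" using t u by (simp add: power_mult_distrib)
    have le16: "r powr (1 + \<beta>) * (t powr (- (\<beta> / 2)) * (r / (2 * t)) * exp (- r\<^sup>2 / (4 * t))) \<le> 16"
    proof -
      have "r powr (1 + \<beta>) * (t powr (- (\<beta> / 2)) * (r / (2 * t)) * exp (- r\<^sup>2 / (4 * t)))
        = r powr (1 + \<beta>) * (t powr (- (\<beta> / 2)) * (r / (2 * t))) * exp (- r\<^sup>2 / (4 * t))"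
        by (simp only: mult.assoc)
      also have "\<dots> = (u powr (2 + \<beta>) * exp (- u\<^sup>2 / 4)) / 2"
        unfolding pr using e by simp
      also have "\<dots> \<le> 32 / 2" by (intro divide_right_mono powr_times_gaussian_le u \<beta>) auto
      finally show ?thesis by simp
    qed
    have inv: "r powr (-1 - \<beta>) * r powr (1 + \<beta>) = 1" using r by (simp add: powr_add[symmetric])
    have "r powr (-1 - \<beta>) * (r powr (1 + \<beta>) * (t powr (- (\<beta> / 2)) * (r / (2 * t)) * exp (- r\<^sup>2 / (4 * t)))) \<le> r powr (-1 - \<beta>) * 16"
      by (rule mult_left_mono[OF le16]) simp
    moreover have "r powr (-1 - \<beta>) * (r powr (1 + \<beta>) * Y) = Y" for Y
      unfolding mult.assoc[symmetric] inv by simp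
    ultimately have "t powr (- (\<beta> / 2)) * (r / (2 * t)) * exp (- r\<^sup>2 / (4 * t)) \<le> r powr (-1 - \<beta>) * 16"
      by simp
    also have "\<dots> \<le> s powr (-1 - \<beta>) * 16"
      using s that \<beta> by (intro mult_right_mono powr_mono2') auto
    finally show ?thesis using r t by (simp add: abs_mult)
  qed
  have "\<bar>q (norm z1) - q (norm z2)\<bar> \<le> 16 * s powr (- 1 - \<beta>) * \<bar>norm z1 - norm z2\<bar>"
  proof -
    have "norm (q (norm z1) - q (norm z2)) \<le> 16 * s powr (- 1 - \<beta>) * norm (norm z1 - norm z2)"
      by (rule field_differentiable_bound[where S="{s..}"])
        (use s in \<open>auto intro!: has_field_derivative_at_within[OF der] bd[unfolded real_norm_def[symmetric]] simp del: real_norm_def norm_minus_cancel\<close>)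
    then show ?thesis by simp
  qed
  also have "\<dots> \<le> 16 * s powr (- 1 - \<beta>) * norm (z1 - z2)"
    by (intro mult_left_mono norm_triangle_ineq3) auto
  finally have *: "\<bar>q (norm z1) - q (norm z2)\<bar> \<le> 16 * norm (z1 - z2) * s powr (- 1 - \<beta>)" by (simp add: mult_ac)
  have "t powr (\<alpha> / 2) * \<bar>heat_kernel t z1 - heat_kernel t z2\<bar>
     = \<bar>t powr (\<alpha> / 2) * heat_kernel t z1 - t powr (\<alpha> / 2) * heat_kernel t z2\<bar>"
    by (simp add: right_diff_distrib[symmetric] abs_mult)
  also have "\<dots> = (4 * pi) powr (- real DIM('a) / 2) * \<bar>q (norm z1) - q (norm z2)\<bar>"
    unfolding weighted_heat_kernel[OF t] q_def \<beta>(1) by (simp add: right_diff_distrib[symmetric] abs_mult)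
  also have "\<dots> \<le> 1 * \<bar>q (norm z1) - q (norm z2)\<bar>"
    by (intro mult_right_mono four_pi_powr_le_1) auto
  finally show ?thesis using * by (auto intro: order_trans)
qed

section \<open>Walks in the integer lattice\<close>

definition lattice_vec :: "int ^ 'n \<Rightarrow> real ^ 'n" where
  "lattice_vec v = (\<chi> i. real_of_int (v $ i))"

definition grid_dist :: "int ^ 'n \<Rightarrow> int ^ 'n \<Rightarrow> int" where
  "grid_dist x y = (\<Sum>i\<in>UNIV. \<bar>x $ i - y $ i\<bar>)"

lemma grid_dist_commute: "grid_dist x y = grid_dist y x"
  by (simp add: grid_dist_def abs_minus_commute)

lemma grid_dist_nonneg [simp]: "grid_dist x y \<ge> 0"
  by (simp add: grid_dist_def sum_nonneg)

lemma grid_dist_triangle: "grid_dist x z \<le> grid_dist x y + grid_dist y z"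
  unfolding grid_dist_def sum.distrib[symmetric] by (intro sum_mono) auto

lemma grid_dist_eq_0 [simp]: "grid_dist x y = 0 \<longleftrightarrow> x = y"
  by (auto simp: grid_dist_def sum_nonneg_eq_0_iff vec_eq_iff)

lemma norm_lattice_vec_le: "norm (lattice_vec x - lattice_vec y) \<le> grid_dist x y"
  using norm_le_l1_cart[of "lattice_vec x - lattice_vec y"] by (simp add: lattice_vec_def grid_dist_def)

lemma grid_dist_le_norm:
  fixes x y :: "int ^ 'n"
  shows "grid_dist x y \<le> real CARD('n) * norm (lattice_vec x - lattice_vec y)"
proof -
  have "real_of_int (grid_dist x y) = (\<Sum>i\<in>UNIV. \<bar>(lattice_vec x - lattice_vec y) $ i\<bar>)"
    by (simp add: lattice_vec_def grid_dist_def)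
  also have "\<dots> \<le> (\<Sum>i\<in>(UNIV::'n set). norm (lattice_vec x - lattice_vec y))"
    by (intro sum_mono component_le_norm_cart)
  finally show ?thesis by simp
qed

definition adjacent :: "int ^ 'n \<Rightarrow> int ^ 'n \<Rightarrow> bool" where
  "adjacent x y \<longleftrightarrow> grid_dist x y = 1"

lemma adjacent_commute: "adjacent x y \<longleftrightarrow> adjacent y x"
  by (simp add: adjacent_def grid_dist_commute)

lemma walk_grid_dist_le:
  assumes "successively adjacent p" "k \<le> l" "l < length p"
  shows "grid_dist (p ! k) (p ! l) \<le> int (l - k)"
  using assms(2,3)
proof (induction l rule: dec_induct)
  case base
  then show ?case by (simp add: grid_dist_def)
next
  case (step m)
  have "grid_dist (p ! m) (p ! Suc m) = 1"
    using assms(1) step by (simp add: successively_conv_nth adjacent_def)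
  then show ?case using step grid_dist_triangle[of "p ! k" "p ! Suc m" "p ! m"] by (simp add: of_nat_diff)
qed

lemma ex_geodesic:
  "\<exists>q. q \<noteq> [] \<and> hd q = x \<and> last q = y \<and> successively adjacent q \<and> int (length q) = grid_dist x y + 1"
proof (induction "nat (grid_dist x y)" arbitrary: x)
  case 0
  then have "x = y" by (metis grid_dist_nonneg nat_0_iff order_antisym grid_dist_eq_0)
  then show ?case by (intro exI[of _ "[x]"]) (simp add: grid_dist_def)
next
  case (Suc n)
  then have "x \<noteq> y" by (metis grid_dist_eq_0 nat_zero_as_int Zero_not_Suc nat_int)
  then obtain i where i: "x $ i \<noteq> y $ i" by (auto simp: vec_eq_iff)
  define z where "z = (\<chi> j. if j = i then x $ i + sgn (y $ i - x $ i) else x $ j)"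
  have "grid_dist z y = (\<Sum>j\<in>UNIV. \<bar>x $ j - y $ j\<bar> - (if j = i then 1 else 0))"
    unfolding grid_dist_def using i by (intro sum.cong refl) (auto simp: z_def sgn_if)
  then have zy: "grid_dist z y = grid_dist x y - 1" by (simp add: grid_dist_def sum_subtractf)
  have "grid_dist x z = (\<Sum>j\<in>UNIV. (if j = i then 1 else 0))"
    unfolding grid_dist_def using i by (intro sum.cong refl) (auto simp: z_def sgn_if)
  then have xz: "adjacent x z" by (simp add: adjacent_def)
  have "n = nat (grid_dist z y)" using Suc zy by simp
  from Suc.hyps(1)[OF this] obtain q where q: "q \<noteq> []" "hd q = z" "last q = y" "successively adjacent q"
     "int (length q) = grid_dist z y + 1" by blast
  then show ?case
    using xz zy by (intro exI[of _ "x # q"]) (cases q; auto)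
qed

text \<open>
  A chord-arc condition: the walk never returns to within half of the length travelled. It
  replaces the growth condition on balls, because it passes to segments of a walk and a violation
  tells where to cut.
\<close>

definition spread :: "(int ^ 'n) list \<Rightarrow> bool" where
  "spread p \<longleftrightarrow> (\<forall>l < length p. \<forall>k < l. int (l - k) < 2 * grid_dist (p ! k) (p ! l))"

lemma spread_geodesic:
  assumes q: "q \<noteq> []" "successively adjacent q" "int (length q) = grid_dist (hd q) (last q) + 1"
  shows "spread q"
  unfolding spread_def
proof (intro allI impI)
  fix l k assume kl: "l < length q" "k < l"
  let ?m = "length q - 1"
  have "grid_dist (q ! 0) (q ! k) \<le> int k" "grid_dist (q ! l) (q ! ?m) \<le> int (?m - l)"
    using walk_grid_dist_le[OF q(2), of 0 k] walk_grid_dist_le[OF q(2), of l ?m] kl by auto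
  moreover have "grid_dist (q ! 0) (q ! ?m) = int ?m"
    using q by (cases q) (auto simp: hd_conv_nth last_conv_nth)
  ultimately have "int (l - k) \<le> grid_dist (q ! k) (q ! l)"
    using grid_dist_triangle[of "q!0" "q!?m" "q!k"] grid_dist_triangle[of "q!k" "q!?m" "q!l"] kl
    by (simp add: of_nat_diff)
  then show "int (l - k) < 2 * grid_dist (q ! k) (q ! l)" using kl by linarith
qed

lemma sum_power_dist_le:
  fixes q :: real
  assumes "0 \<le> q" "q < 1"
  shows "(\<Sum>k<n. q ^ (nat \<bar>int k - int m\<bar>)) \<le> 2 / (1 - q)"
proof -
  have geo: "(\<Sum>k<j. q ^ k) \<le> 1 / (1 - q)" for j
    using assms sum_gp_strict[of q j] by (auto simp: divide_right_mono)
  have 1: "(\<Sum>k\<in>{..<n} \<inter> {..<m}. q ^ (nat \<bar>int k - int m\<bar>)) \<le> (\<Sum>k\<in>{..m}. q ^ k)"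
    by (rule sum_le_included[where i="\<lambda>k. m - k"]) (use assms in \<open>auto intro!: bexI[of _ "m - _"] simp: nat_diff_distrib' abs_if\<close>)
  have 2: "(\<Sum>k\<in>{..<n} - {..<m}. q ^ (nat \<bar>int k - int m\<bar>)) \<le> (\<Sum>k\<in>{..n}. q ^ k)"
    by (rule sum_le_included[where i="\<lambda>k. m + k"]) (use assms in \<open>auto intro!: bexI[of _ "_ - m"] simp: nat_diff_distrib' abs_if\<close>)
  have "(\<Sum>k<n. q ^ (nat \<bar>int k - int m\<bar>)) = (\<Sum>k\<in>{..<n} \<inter> {..<m}. q ^ (nat \<bar>int k - int m\<bar>)) + (\<Sum>k\<in>{..<n} - {..<m}. q ^ (nat \<bar>int k - int m\<bar>))"
    by (metis sum.Int_Diff finite_lessThan)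
  then show ?thesis using 1 2 geo[of "Suc m"] geo[of "Suc n"] by (simp add: lessThan_Suc_atMost)
qed

text \<open>
  On the scale \<open>\<surd>t \<ge> \<epsilon>\<close> a spread walk looks at most one-dimensional, so it meets the Gaussian at
  \<open>O(\<surd>t / \<epsilon>)\<close> vertices. Seen from the vertex nearest to \<open>x\<close>, the distance to \<open>x\<close> grows at least
  linearly along the walk, and the sum is dominated by a geometric series.
\<close>

lemma gaussian_sum_spread:
  fixes p :: "(int ^ 'n) list" and x :: "real ^ 'n"
  assumes p: "spread p" and \<epsilon>: "\<epsilon> > 0" and t: "\<epsilon>\<^sup>2 \<le> t"
  shows "(\<Sum>v\<leftarrow>p. exp (- (norm (x - \<epsilon> *\<^sub>R lattice_vec v))\<^sup>2 / (4 * t)))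
     \<le> 2 * exp 1 * (1 + 4 * real CARD('n)) * (sqrt t / \<epsilon>)"
proof (cases "p = []")
  case True
  have "t \<ge> 0" using t by (meson order_trans zero_le_power2)
  then show ?thesis using True \<epsilon> by simp
next
  case False
  let ?n = "length p"
  let ?d = "real CARD('n)"
  define D where "D k = norm (x - \<epsilon> *\<^sub>R lattice_vec (p ! k))" for k
  have t0: "t > 0" using t \<epsilon> by (meson order_less_le_trans zero_less_power)
  have st: "\<epsilon> \<le> sqrt t" using t \<epsilon> by (simp add: real_le_rsqrt)
  define m where "m = arg_min_on D {..<?n}"
  have m: "m < ?n" "\<And>k. k < ?n \<Longrightarrow> D m \<le> D k"
    using arg_min_if_finite(1)[of "{..<?n}" D] arg_min_least[of "{..<?n}" _ D] False unfolding m_def by auto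
  define h where "h = \<epsilon> / (4 * ?d * sqrt t)"
  have d: "?d > 0" by simp
  have h: "h > 0" using \<epsilon> t0 d by (simp add: h_def)
  have low: "h * real (nat \<bar>int k - int m\<bar>) * sqrt t \<le> D k" if k: "k < ?n" for k
  proof -
    have "int (nat \<bar>int k - int m\<bar>) \<le> 2 * grid_dist (p ! k) (p ! m)"
    proof (cases k m rule: linorder_cases)
      case less
      then have "int (m - k) < 2 * grid_dist (p ! k) (p ! m)" using p m unfolding spread_def by auto
      then show ?thesis using less by (simp add: of_nat_diff)
    next
      case greater
      then have "int (k - m) < 2 * grid_dist (p ! k) (p ! m)"
        using p k unfolding spread_def by (metis grid_dist_commute)
      then show ?thesis using greater by (simp add: of_nat_diff)
    qed auto
    then have "real (nat \<bar>int k - int m\<bar>) \<le> 2 * real_of_int (grid_dist (p ! k) (p ! m))" by linarith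
    also have "\<dots> \<le> 2 * (?d * norm (lattice_vec (p!k) - lattice_vec (p!m)))"
      using grid_dist_le_norm[of "p!k" "p!m"] by simp
    finally have "\<epsilon> * real (nat \<bar>int k - int m\<bar>) \<le> 2 * ?d * (\<epsilon> * norm (lattice_vec (p!k) - lattice_vec (p!m)))"
      using \<epsilon> mult_left_mono[of "real (nat \<bar>int k - int m\<bar>)" _ \<epsilon>] by (simp add: mult_ac)
    also have "\<epsilon> * norm (lattice_vec (p!k) - lattice_vec (p!m)) = norm (\<epsilon> *\<^sub>R lattice_vec (p!k) - \<epsilon> *\<^sub>R lattice_vec (p!m))"
      using \<epsilon> by (metis abs_of_pos norm_scaleR scaleR_diff_right)
    also have "\<dots> \<le> D k + D m"
      unfolding D_def by (metis norm_triangle_sub norm_minus_commute dist_norm dist_triangle2)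
    also have "\<dots> \<le> 2 * D k" using m(2)[OF k] by simp
    finally have "\<epsilon> * real (nat \<bar>int k - int m\<bar>) \<le> 4 * ?d * D k" using d by simp
    then show ?thesis using d t0 by (simp add: h_def field_simps)
  qed
  have ex: "exp (- (D k)\<^sup>2 / (4 * t)) \<le> exp 1 * exp (- h) ^ (nat \<bar>int k - int m\<bar>)" if k: "k < ?n" for k
  proof -
    define s where "s = D k / sqrt t"
    have s: "h * real (nat \<bar>int k - int m\<bar>) \<le> s" using low[OF k] t0 by (simp add: s_def field_simps)
    have "(D k)\<^sup>2 / (4 * t) = s\<^sup>2 / 4" using t0 by (simp add: s_def power_divide)
    moreover have "0 \<le> (s / 2 - 1)\<^sup>2" by simp
    then have "s - 1 \<le> s\<^sup>2 / 4" by (simp add: power2_eq_square field_simps)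
    ultimately have "- (D k)\<^sup>2 / (4 * t) \<le> 1 - h * real (nat \<bar>int k - int m\<bar>)" using s by simp
    then have "exp (- (D k)\<^sup>2 / (4 * t)) \<le> exp (1 - h * real (nat \<bar>int k - int m\<bar>))" by simp
    also have "\<dots> = exp 1 * exp (- h) ^ (nat \<bar>int k - int m\<bar>)"
      by (simp add: exp_diff exp_minus exp_of_nat2_mult[symmetric] power_inverse field_simps)
    finally show ?thesis .
  qed
  have "(\<Sum>v\<leftarrow>p. exp (- (norm (x - \<epsilon> *\<^sub>R lattice_vec v))\<^sup>2 / (4 * t))) = (\<Sum>k<?n. exp (- (D k)\<^sup>2 / (4 * t)))"
    unfolding D_def by (simp add: sum_list_sum_nth atLeast0LessThan)
  also have "\<dots> \<le> (\<Sum>k<?n. exp 1 * exp (- h) ^ (nat \<bar>int k - int m\<bar>))"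
    by (intro sum_mono ex) auto
  also have "\<dots> \<le> exp 1 * (2 / (1 - exp (- h)))"
    unfolding sum_distrib_left[symmetric] by (intro mult_left_mono sum_power_dist_le) (use h in auto)
  also have "1 / (1 - exp (- h)) \<le> 1 + 1 / h"
  proof -
    have "1 + h \<le> exp h" by (simp add: exp_ge_add_one_self add.commute)
    then have "exp (- h) \<le> 1 / (1 + h)" using h by (simp add: exp_minus field_simps)
    then have "h / (1 + h) \<le> 1 - exp (- h)" using h by (simp add: field_simps)
    then have "1 / (1 - exp (- h)) \<le> 1 / (h / (1 + h))" using h by (intro divide_left_mono) auto
    then show ?thesis using h by (simp add: field_simps)
  qed
  then have "exp 1 * (2 / (1 - exp (- h))) \<le> exp 1 * (2 * (1 + 1 / h))"
    using mult_left_mono[of "1 / (1 - exp (- h))" "1 + 1 / h" "exp 1 * 2"] by (simp add: algebra_simps)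
  also have "1 + 1 / h \<le> (1 + 4 * ?d) * (sqrt t / \<epsilon>)"
    using st \<epsilon> t0 by (simp add: h_def field_simps)
  then have "exp 1 * (2 * (1 + 1 / h)) \<le> 2 * exp 1 * (1 + 4 * ?d) * (sqrt t / \<epsilon>)"
    using mult_left_mono[of "1 + 1 / h" "(1 + 4 * ?d) * (sqrt t / \<epsilon>)" "2 * exp 1"] by (simp add: mult_ac)
  finally show ?thesis .
qed

section \<open>Currents carried by lattice walks\<close>

text \<open>
  The unit current along an edge, applied to the function \<open>\<phi>\<close>. Averaging over both endpoints makes it
  antisymmetric, so that a chord inserted in both directions cancels exactly.
\<close>

definition edge_current :: "(int ^ 'n \<Rightarrow> real) \<Rightarrow> int ^ 'n \<Rightarrow> int ^ 'n \<Rightarrow> real ^ 'n" where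
  "edge_current \<phi> x y = ((\<phi> x + \<phi> y) / 2) *\<^sub>R (lattice_vec y - lattice_vec x)"

fun walk_current :: "(int ^ 'n \<Rightarrow> real) \<Rightarrow> (int ^ 'n) list \<Rightarrow> real ^ 'n" where
  "walk_current \<phi> (x # y # p) = edge_current \<phi> x y + walk_current \<phi> (y # p)"
| "walk_current \<phi> p = 0"

lemma edge_current_swap: "edge_current \<phi> y x = - edge_current \<phi> x y"
  by (simp add: edge_current_def add.commute scaleR_right_diff_distrib)

lemma walk_current_append:
  "p \<noteq> [] \<Longrightarrow> walk_current \<phi> (p @ q) = walk_current \<phi> p + walk_current \<phi> (last p # q)"
  by (induction \<phi> p rule: walk_current.induct) auto

lemma walk_current_join:
  assumes "p \<noteq> []" "q \<noteq> []" "last p = hd q"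
  shows "walk_current \<phi> (p @ tl q) = walk_current \<phi> p + walk_current \<phi> q"
  using assms walk_current_append[of p \<phi> "tl q"] by simp

lemma walk_current_rev: "walk_current \<phi> (rev p) = - walk_current \<phi> p"
proof (induction \<phi> p rule: walk_current.induct)
  case (1 \<phi> x y p)
  have "walk_current \<phi> (rev (x # y # p)) = walk_current \<phi> (rev (y # p)) + walk_current \<phi> (last (rev (y # p)) # [x])"
    using walk_current_append[of "rev (y # p)" \<phi> "[x]"] by simp
  then show ?case using 1 edge_current_swap[of \<phi> y x] by (simp add: last_rev)
qed auto

text \<open>
  The cancellation of closed walks: constants may be subtracted from \<open>\<phi>\<close> once the endpoints agree.
\<close>

lemma walk_current_diff_const:
  "p \<noteq> [] \<Longrightarrow> walk_current (\<lambda>v. \<phi> v - c) p = walk_current \<phi> p - c *\<^sub>R (lattice_vec (last p) - lattice_vec (hd p))"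
proof (induction \<phi> p rule: walk_current.induct)
  case (1 \<phi> x y p)
  have "edge_current (\<lambda>v. \<phi> v - c) x y = edge_current \<phi> x y - c *\<^sub>R (lattice_vec y - lattice_vec x)"
    unfolding edge_current_def scaleR_left_diff_distrib[symmetric] by (simp add: field_simps)
  then show ?case using 1 by (simp add: algebra_simps)
qed auto

lemma norm_walk_current_le:
  assumes "successively adjacent p"
  shows "norm (walk_current \<phi> p) \<le> (\<Sum>v\<leftarrow>p. \<bar>\<phi> v\<bar>)"
proof -
  have edge: "norm (edge_current \<phi> x y) \<le> \<bar>\<phi> x\<bar> / 2 + \<bar>\<phi> y\<bar> / 2" if "adjacent x y" for x y
  proof -
    have "norm (lattice_vec y - lattice_vec x) \<le> 1"
      using norm_lattice_vec_le[of y x] that by (simp add: adjacent_def grid_dist_commute)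
    then have "norm (edge_current \<phi> x y) \<le> \<bar>(\<phi> x + \<phi> y) / 2\<bar> * 1"
      unfolding edge_current_def norm_scaleR by (intro mult_left_mono) auto
    then show ?thesis by (simp add: field_simps)
  qed
  have "norm (walk_current \<phi> (x # q)) \<le> \<bar>\<phi> x\<bar> / 2 + (\<Sum>v\<leftarrow>q. \<bar>\<phi> v\<bar>)" if "successively adjacent (x # q)" for x q
    using that
  proof (induction q arbitrary: x)
    case (Cons y q)
    have "norm (walk_current \<phi> (x # y # q)) \<le> norm (edge_current \<phi> x y) + norm (walk_current \<phi> (y # q))"
      by (simp add: norm_triangle_ineq)
    then show ?case using Cons.IH[of y] Cons.prems edge[of x y] by simp
  qed simp
  note * = this
  show ?thesis
  proof (cases p)
    case (Cons x q)
    then show ?thesis using *[of x q] assms by simp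
  qed simp
qed

text \<open>
  The supremum starts at a positive time \<open>\<tau>\<close>: near an atom of the discretized measure the supremum
  over all \<open>t > 0\<close> need not be integrable.
\<close>

definition heat_sup :: "real \<Rightarrow> real \<Rightarrow> (real \<Rightarrow> 'a \<Rightarrow> 'b::real_normed_vector) \<Rightarrow> 'a \<Rightarrow> ennreal" where
  "heat_sup \<alpha> \<tau> u x = (SUP t\<in>{\<tau>..}. ennreal (t powr (\<alpha> / 2) * norm (u t x)))"

lemma heat_sup_measurable:
  fixes u :: "real \<Rightarrow> 'a::topological_space \<Rightarrow> 'b::real_normed_vector"
  assumes "\<And>t. t \<ge> \<tau> \<Longrightarrow> continuous_on UNIV (u t)"
  shows "heat_sup \<alpha> \<tau> u \<in> borel_measurable borel"
proof (rule borel_measurableI_greater)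
  fix c :: ennreal
  have "{x. c < heat_sup \<alpha> \<tau> u x} = (\<Union>t\<in>{\<tau>..}. {x. c < ennreal (t powr (\<alpha> / 2) * norm (u t x))})"
    by (auto simp: heat_sup_def less_SUP_iff)
  also have "open \<dots>"
  proof (intro open_UN ballI)
    fix t assume "t \<in> {\<tau>..}"
    then show "open {x. c < ennreal (t powr (\<alpha> / 2) * norm (u t x))}"
      by (intro open_Collect_less continuous_intros continuous_on_ennreal assms) auto
  qed
  finally show "{x \<in> space borel. c < heat_sup \<alpha> \<tau> u x} \<in> sets borel" by simp
qed

lemma heat_sup_add_le: "heat_sup \<alpha> \<tau> (\<lambda>t x. u t x + v t x) x \<le> heat_sup \<alpha> \<tau> u x + heat_sup \<alpha> \<tau> v x"
  unfolding heat_sup_def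
proof (rule SUP_least)
  fix t assume t: "t \<in> {\<tau>..}"
  have "ennreal (t powr (\<alpha> / 2) * norm (u t x + v t x)) \<le> ennreal (t powr (\<alpha> / 2) * norm (u t x) + t powr (\<alpha> / 2) * norm (v t x))"
    unfolding distrib_left[symmetric] by (intro ennreal_leI mult_left_mono norm_triangle_ineq) auto
  also have "\<dots> = ennreal (t powr (\<alpha> / 2) * norm (u t x)) + ennreal (t powr (\<alpha> / 2) * norm (v t x))"
    by (intro ennreal_plus) auto
  also have "\<dots> \<le> (SUP t\<in>{\<tau>..}. ennreal (t powr (\<alpha> / 2) * norm (u t x))) + (SUP t\<in>{\<tau>..}. ennreal (t powr (\<alpha> / 2) * norm (v t x)))"
    using t by (intro add_mono SUP_upper)
  finally show "ennreal (t powr (\<alpha> / 2) * norm (u t x + v t x)) \<le> (SUP t\<in>{\<tau>..}. ennreal (t powr (\<alpha> / 2) * norm (u t x))) + (SUP t\<in>{\<tau>..}. ennreal (t powr (\<alpha> / 2) * norm (v t x)))" .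
qed

lemma heat_sup_scale_le: "heat_sup \<alpha> \<tau> (\<lambda>t x. c *\<^sub>R u t x) x \<le> ennreal \<bar>c\<bar> * heat_sup \<alpha> \<tau> u x"
  unfolding heat_sup_def
proof (rule SUP_least)
  fix t assume t: "t \<in> {\<tau>..}"
  have "ennreal (t powr (\<alpha> / 2) * norm (c *\<^sub>R u t x)) = ennreal \<bar>c\<bar> * ennreal (t powr (\<alpha> / 2) * norm (u t x))"
    by (simp add: ennreal_mult[symmetric] mult_ac)
  also have "\<dots> \<le> ennreal \<bar>c\<bar> * (SUP t\<in>{\<tau>..}. ennreal (t powr (\<alpha> / 2) * norm (u t x)))"
    using t by (intro mult_left_mono SUP_upper) auto
  finally show "ennreal (t powr (\<alpha> / 2) * norm (c *\<^sub>R u t x)) \<le> ennreal \<bar>c\<bar> * (SUP t\<in>{\<tau>..}. ennreal (t powr (\<alpha> / 2) * norm (u t x)))" .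
qed

lemma continuous_heat_kernel: "t > 0 \<Longrightarrow> continuous_on UNIV (heat_kernel t)"
  unfolding heat_kernel_def by (intro continuous_intros) auto

definition lattice_heat :: "real \<Rightarrow> real \<Rightarrow> real ^ 'n \<Rightarrow> int ^ 'n \<Rightarrow> real" where
  "lattice_heat \<epsilon> t x v = heat_kernel t (x - \<epsilon> *\<^sub>R lattice_vec v)"

lemma continuous_lattice_heat [continuous_intros]:
  "t > 0 \<Longrightarrow> continuous_on S (\<lambda>x. lattice_heat \<epsilon> t x v)"
  unfolding lattice_heat_def
  by (rule continuous_on_compose2[OF continuous_heat_kernel]) (auto intro!: continuous_intros)

lemma continuous_walk_heat:
  "t > 0 \<Longrightarrow> continuous_on S (\<lambda>x. walk_current (lattice_heat \<epsilon> t x) p)"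
  by (induction p rule: induct_list012)
     (auto simp: edge_current_def intro!: continuous_intros)

section \<open>Closed walks against a measure with ball growth\<close>

locale ball_growth =
  fixes \<nu> :: "(real ^ 'n) measure" and \<alpha> \<beta> c :: real
  assumes sets_\<nu> [measurable_cong]: "sets \<nu> = sets borel"
    and growth: "\<And>x r. r > 0 \<Longrightarrow> emeasure \<nu> (ball x r) \<le> ennreal (c * r powr \<beta>)"
    and \<beta>_eq: "\<beta> = real CARD('n) - \<alpha>"
    and \<beta>_nonneg: "0 \<le> \<beta>" and \<beta>_le_1: "\<beta> \<le> 1"
    and c_pos: "c > 0"
begin

lemma measurable_\<nu>: "measurable \<nu> N = measurable borel N"
  by (rule measurable_cong_sets[OF sets_\<nu> refl])

text \<open>
  The dyadic shell of radius \<open>2\<^sup>j \<rho>\<close> contributes a multiple of \<open>(2\<^sup>j \<rho>) powr (- 1 - \<beta>) (2\<^sup>j \<rho>) powr \<beta>\<close>,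
  which is \<open>1 / (2\<^sup>j \<rho>)\<close>, and these sum up to the contribution of the innermost one.
\<close>

lemma nn_integral_tail_le:
  assumes \<rho>: "\<rho> > 0"
  shows "(\<integral>\<^sup>+ x. ennreal (norm (x - o') powr (- 1 - \<beta>)) * indicator {x. \<rho> \<le> norm (x - o')} x \<partial>\<nu>)
    \<le> ennreal (4 * c / \<rho>)"
proof -
  let ?a = "\<lambda>j. (2 ^ j * \<rho>) powr (- 1 - \<beta>)"
  have "(\<integral>\<^sup>+ x. ennreal (norm (x - o') powr (- 1 - \<beta>)) * indicator {x. \<rho> \<le> norm (x - o')} x \<partial>\<nu>)
    \<le> (\<integral>\<^sup>+ x. (\<Sum>j. ennreal (?a j) * indicator (ball o' (2 ^ Suc j * \<rho>)) x) \<partial>\<nu>)"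
  proof (rule nn_integral_mono)
    fix x
    show "ennreal (norm (x - o') powr (- 1 - \<beta>)) * indicator {x. \<rho> \<le> norm (x - o')} x
      \<le> (\<Sum>j. ennreal (?a j) * indicator (ball o' (2 ^ Suc j * \<rho>)) x)"
    proof (cases "\<rho> \<le> norm (x - o')")
      case True
      obtain n where "norm (x - o') / \<rho> < 2 ^ n"
        using real_arch_pow[of 2 "norm (x - o') / \<rho>"] by auto
      then have ex: "norm (x - o') < 2 ^ n * \<rho>" using \<rho> by (simp add: field_simps)
      define m where "m = (LEAST n. norm (x - o') < 2 ^ n * \<rho>)"
      have m: "norm (x - o') < 2 ^ m * \<rho>" unfolding m_def by (rule LeastI[of "\<lambda>n. norm (x - o') < 2 ^ n * \<rho>", OF ex])
      have "m \<noteq> 0" using m True by (intro notI) simp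
      then obtain j where j: "m = Suc j" by (cases m) auto
      have "\<not> norm (x - o') < 2 ^ j * \<rho>" using not_less_Least[of j "\<lambda>n. norm (x - o') < 2 ^ n * \<rho>"] j unfolding m_def by auto
      then have "norm (x - o') powr (- 1 - \<beta>) \<le> ?a j"
        using \<rho> \<beta>_nonneg by (intro powr_mono2') auto
      moreover have "x \<in> ball o' (2 ^ Suc j * \<rho>)" using m j by (simp add: dist_norm norm_minus_commute)
      ultimately have "ennreal (norm (x - o') powr (- 1 - \<beta>)) * indicator {x. \<rho> \<le> norm (x - o')} x
        \<le> ennreal (?a j) * indicator (ball o' (2 ^ Suc j * \<rho>)) x"
        using True by (auto intro: ennreal_leI)
      also have "\<dots> \<le> (\<Sum>j. ennreal (?a j) * indicator (ball o' (2 ^ Suc j * \<rho>)) x)"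
        (is "?F j \<le> _")
      proof -
        have "(\<Sum>i\<in>{j}. ?F i) \<le> (\<Sum>i. ?F i)" by (rule sum_le_suminf) auto
        then show ?thesis by (simp only: sum.insert finite.emptyI empty_iff not_False_eq_True sum.empty add_0_right)
      qed
      finally show ?thesis .
    qed simp
  qed
  also have "\<dots> = (\<Sum>j. \<integral>\<^sup>+ x. ennreal (?a j) * indicator (ball o' (2 ^ Suc j * \<rho>)) x \<partial>\<nu>)"
    by (intro nn_integral_suminf borel_measurable_times_ennreal borel_measurable_const borel_measurable_indicator)
      (simp add: sets_\<nu>)
  also have "\<dots> = (\<Sum>j. ennreal (?a j) * emeasure \<nu> (ball o' (2 ^ Suc j * \<rho>)))"
    using sets_\<nu> by (intro suminf_cong nn_integral_cmult_indicator) auto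
  also have "\<dots> \<le> (\<Sum>j. ennreal ((2 * c / \<rho>) * (1 / 2) ^ j))"
  proof (intro suminf_le summableI)
    fix j :: nat
    have p: "2 ^ j * \<rho> > 0" using \<rho> by simp
    have "ennreal (?a j) * emeasure \<nu> (ball o' (2 ^ Suc j * \<rho>)) \<le> ennreal (?a j) * ennreal (c * (2 ^ Suc j * \<rho>) powr \<beta>)"
      using \<rho> by (intro mult_left_mono growth) auto
    also have "\<dots> = ennreal (?a j * (c * (2 ^ Suc j * \<rho>) powr \<beta>))"
      using c_pos by (simp add: ennreal_mult)
    also have "\<dots> \<le> ennreal ((2 * c / \<rho>) * (1 / 2) ^ j)"
    proof (rule ennreal_leI)
      have "(2 ^ Suc j * \<rho>) powr \<beta> = 2 powr \<beta> * (2 ^ j * \<rho>) powr \<beta>"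
        using p by (simp add: powr_mult mult_ac)
      then have "?a j * (c * (2 ^ Suc j * \<rho>) powr \<beta>) = c * 2 powr \<beta> * (?a j * (2 ^ j * \<rho>) powr \<beta>)"
        by (simp only: mult_ac)
      also have "\<dots> = c * 2 powr \<beta> * (1 / (2 ^ j * \<rho>))"
        using p by (simp add: powr_add[symmetric] powr_minus_divide)
      also have "\<dots> \<le> c * 2 * (1 / (2 ^ j * \<rho>))"
        using powr_mono[OF \<beta>_le_1, of 2] c_pos \<rho> by (intro mult_right_mono mult_left_mono) auto
      finally show "?a j * (c * (2 ^ Suc j * \<rho>) powr \<beta>) \<le> (2 * c / \<rho>) * (1 / 2) ^ j"
        by (simp add: field_simps)
    qed
    finally show "ennreal (?a j) * emeasure \<nu> (ball o' (2 ^ Suc j * \<rho>)) \<le> ennreal ((2 * c / \<rho>) * (1 / 2) ^ j)" .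
  qed
  also have "\<dots> = ennreal (\<Sum>j. (2 * c / \<rho>) * (1 / 2) ^ j)"
    using c_pos \<rho> by (intro suminf_ennreal2 summable_mult summable_geometric) auto
  also have "(\<Sum>j. (2 * c / \<rho>) * (1 / 2) ^ j) = 4 * c / \<rho>"
    using suminf_mult[OF summable_geometric[of "1/2::real"], of "2 * c / \<rho>"] suminf_geometric[of "1/2::real"] by simp
  finally show ?thesis .
qed

lemma nn_integral_profile_le:
  assumes R: "R > 0" and M: "M \<ge> 0" "L \<ge> 0"
    and near: "\<And>x. norm (x - o') < 2 * R \<Longrightarrow> g x \<le> ennreal M"
    and far: "\<And>x. 2 * R \<le> norm (x - o') \<Longrightarrow> g x \<le> ennreal (L * norm (x - o') powr (- 1 - \<beta>))"
  shows "(\<integral>\<^sup>+ x. g x \<partial>\<nu>) \<le> ennreal (2 * c * M * R powr \<beta> + 2 * c * L / R)"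
proof -
  have "(\<integral>\<^sup>+ x. g x \<partial>\<nu>) \<le> (\<integral>\<^sup>+ x. ennreal M * indicator (ball o' (2 * R)) x
     + ennreal L * (ennreal (norm (x - o') powr (- 1 - \<beta>)) * indicator {x. 2 * R \<le> norm (x - o')} x) \<partial>\<nu>)"
  proof (rule nn_integral_mono)
    fix x
    show "g x \<le> ennreal M * indicator (ball o' (2 * R)) x
     + ennreal L * (ennreal (norm (x - o') powr (- 1 - \<beta>)) * indicator {x. 2 * R \<le> norm (x - o')} x)"
      using near[of x] far[of x] M
      by (cases "norm (x - o') < 2 * R") (auto simp: dist_norm norm_minus_commute indicator_def ennreal_mult)
  qed
  also have "\<dots> = ennreal M * emeasure \<nu> (ball o' (2 * R)) + ennreal L *
     (\<integral>\<^sup>+ x. ennreal (norm (x - o') powr (- 1 - \<beta>)) * indicator {x. 2 * R \<le> norm (x - o')} x \<partial>\<nu>)"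
  proof -
    have 1: "(\<lambda>x. ennreal M * indicator (ball o' (2 * R)) x) \<in> borel_measurable \<nu>"
      by (intro borel_measurable_times_ennreal borel_measurable_const borel_measurable_indicator) (simp add: sets_\<nu>)
    have cl: "closed {x. 2 * R \<le> norm (x - o')}"
      by (intro closed_Collect_le continuous_intros)
    have 2: "(\<lambda>x. ennreal (norm (x - o') powr (- 1 - \<beta>)) * indicator {x. 2 * R \<le> norm (x - o')} x) \<in> borel_measurable \<nu>"
    proof (intro borel_measurable_times_ennreal borel_measurable_indicator)
      show "(\<lambda>x. ennreal (norm (x - o') powr (- 1 - \<beta>))) \<in> borel_measurable \<nu>"
        unfolding measurable_\<nu> by measurable
      show "{x. 2 * R \<le> norm (x - o')} \<in> sets \<nu>"
        using cl by (simp add: sets_\<nu> borel_closed)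
    qed
    have "(\<lambda>x. ennreal L * (ennreal (norm (x - o') powr (- 1 - \<beta>)) * indicator {x. 2 * R \<le> norm (x - o')} x)) \<in> borel_measurable \<nu>"
      using 2 by (rule borel_measurable_times_ennreal[OF borel_measurable_const])
    note nn_integral_add[OF 1 this]
    then show ?thesis
      using sets_\<nu> by (simp only: nn_integral_cmult[OF 2]) (simp add: nn_integral_cmult_indicator)
  qed
  also have "\<dots> \<le> ennreal M * ennreal (c * (2 * R) powr \<beta>) + ennreal L * ennreal (4 * c / (2 * R))"
    using R by (intro add_mono mult_left_mono growth nn_integral_tail_le) auto
  also have "\<dots> = ennreal (M * (c * (2 * R) powr \<beta>) + L * (4 * c / (2 * R)))"
  proof -
    have "ennreal M * ennreal (c * (2 * R) powr \<beta>) = ennreal (M * (c * (2 * R) powr \<beta>))"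
      "ennreal L * ennreal (4 * c / (2 * R)) = ennreal (L * (4 * c / (2 * R)))"
      using M R c_pos by (intro ennreal_mult[symmetric]; simp)+
    then show ?thesis using M R c_pos by (simp only:) (intro ennreal_plus[symmetric]; simp)
  qed
  also have "\<dots> \<le> ennreal (2 * c * M * R powr \<beta> + 2 * c * L / R)"
  proof (rule ennreal_leI)
    have "(2 * R) powr \<beta> = 2 powr \<beta> * R powr \<beta>" using R by (simp add: powr_mult)
    also have "\<dots> \<le> 2 powr 1 * R powr \<beta>" using \<beta>_le_1 by (intro mult_right_mono powr_mono) auto
    finally have "M * (c * (2 * R) powr \<beta>) \<le> M * (c * (2 * R powr \<beta>))"
      using M c_pos by (intro mult_left_mono) auto
    then show "M * (c * (2 * R) powr \<beta>) + L * (4 * c / (2 * R)) \<le> 2 * c * M * R powr \<beta> + 2 * c * L / R"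
      by (simp add: mult_ac)
  qed
  finally show ?thesis .
qed

end

lemma walk_split:
  assumes "k < length p"
  shows "walk_current \<phi> p = walk_current \<phi> (take (Suc k) p) + walk_current \<phi> (drop k p)"
proof -
  have "take (Suc k) p \<noteq> []" "last (take (Suc k) p) = p ! k" using assms by (auto simp: take_Suc_conv_app_nth)
  then show ?thesis
    using walk_current_append[of "take (Suc k) p" \<phi> "drop (Suc k) p"] Cons_nth_drop_Suc[OF assms] by simp
qed

lemma walk_join:
  assumes "p \<noteq> []" "q \<noteq> []" "last p = hd q" "successively P p" "successively P q"
  shows "p @ tl q \<noteq> []" "hd (p @ tl q) = hd p" "last (p @ tl q) = last q"
    "successively P (p @ tl q)" "length (p @ tl q) = length p + length q - 1"
proof -
  obtain y r where q: "q = y # r" using assms by (cases q) auto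
  show "p @ tl q \<noteq> []" "hd (p @ tl q) = hd p" "last (p @ tl q) = last q" "length (p @ tl q) = length p + length q - 1"
    using assms q by auto
  show "successively P (p @ tl q)"
    using assms q by (cases r) (auto simp: successively_append_iff)
qed

lemma sum_list_le_const:
  fixes f :: "'a \<Rightarrow> real"
  assumes "\<And>v. v \<in> set p \<Longrightarrow> f v \<le> b"
  shows "(\<Sum>v\<leftarrow>p. f v) \<le> real (length p) * b"
  using assms by (induction p) (auto simp: algebra_simps add_mono)

text \<open>
The constant of \<open>gaussian_sum_spread\<close>.
\<close>

definition gauss_const :: "'n itself \<Rightarrow> real" where
  "gauss_const _ = 2 * exp 1 * (1 + 4 * real CARD('n))"

context ball_growth
begin

text \<open>
  The near part of an atom costs \<open>2 c (2 G + 5)\<close> per unit of length, where \<open>G\<close> is the constant of the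
  Gaussian sums, and the far part costs \<open>512 c\<close>.
\<close>

definition atom_const :: real where
  "atom_const = c * (4 * gauss_const TYPE('n) + 522)"

lemma gauss_const_nonneg: "gauss_const TYPE('n) \<ge> 0"
  by (simp add: gauss_const_def)

lemma atom_const_pos: "atom_const > 0"
  unfolding atom_const_def using c_pos gauss_const_nonneg by (intro mult_pos_pos) auto

text \<open>
  The building block: a spread arc \<open>A\<close>, ending at \<open>z\<close>, closed up by a spread chord \<open>Q\<close> that is not
  longer than the arc. With \<open>R = \<epsilon> a\<close> for the length \<open>a\<close> of the arc in lattice units, the maximal function
  is \<open>O(a R powr (- \<beta>))\<close> everywhere and \<open>O(a R \<bar>x - o'\<bar> powr (- 1 - \<beta>))\<close> at distance at least \<open>2 R\<close>
  from the starting point \<open>o'\<close>; integrating each bound where it is better gives \<open>O(a)\<close>, independently of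
  \<open>\<epsilon>\<close>.
\<close>

lemma atom_bound:
  fixes A Q :: "(int ^ 'n) list"
  assumes \<epsilon>: "\<epsilon> > 0"
    and A: "A \<noteq> []" "spread A" "successively adjacent (A @ [z])"
    and Q: "Q \<noteq> []" "spread Q" "successively adjacent Q"
    and closed: "hd Q = z" "last Q = hd A" and len: "length Q \<le> length A + 1"
  shows "(\<integral>\<^sup>+ x. heat_sup \<alpha> (\<epsilon>\<^sup>2)
      (\<lambda>t x. walk_current (lattice_heat \<epsilon> t x) (A @ [z]) + walk_current (lattice_heat \<epsilon> t x) Q) x \<partial>\<nu>)
    \<le> ennreal (atom_const * real (length A))"
proof -
  define a where "a = real (length A)"
  define R where "R = \<epsilon> * a"
  define o' where "o' = \<epsilon> *\<^sub>R lattice_vec (hd A)"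
  define G where "G = gauss_const TYPE('n)"
  define u where "u = (\<lambda>t x. walk_current (lattice_heat \<epsilon> t x) (A @ [z]) + walk_current (lattice_heat \<epsilon> t x) Q)"
  have a: "a \<ge> 1" using A(1) by (cases A) (auto simp: a_def)
  have R: "R > 0" using a \<epsilon> by (simp add: R_def)
  have G0: "G \<ge> 0" using gauss_const_nonneg by (simp add: G_def)
  have lenQ: "real (length Q) \<le> a + 1" using len by (simp add: a_def)
  have t_pos: "t > 0" and st: "\<epsilon> \<le> sqrt t" if "\<epsilon>\<^sup>2 \<le> t" for t
    using that \<epsilon> by (meson order_less_le_trans zero_less_power, simp add: real_le_rsqrt)
  (* For times up to R^2 the one-dimensional Gaussian sums are sharp and the bound increases with t
     because \<beta> \<le> 1; for later times the trivial bound by the number of vertices takes over. *)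
  have near: "heat_sup \<alpha> (\<epsilon>\<^sup>2) u x \<le> ennreal ((2 * G + 5) * a * R powr (- \<beta>))" for x
    unfolding heat_sup_def
  proof (rule SUP_least, rule ennreal_leI)
    fix t assume "t \<in> {\<epsilon>\<^sup>2..}"
    then have t: "\<epsilon>\<^sup>2 \<le> t" by simp
    note t0 = t_pos[OF t]
    define w where "w v = exp (- (norm (x - \<epsilon> *\<^sub>R lattice_vec v))\<^sup>2 / (4 * t))" for v
    define W where "W = (\<Sum>v\<leftarrow>A. w v) + w z + (\<Sum>v\<leftarrow>Q. w v)"
    have w1: "w v \<le> 1" for v using t0 by (simp add: w_def)
    have W1: "W \<le> 4 * a"
    proof -
      have "(\<Sum>v\<leftarrow>A. w v) \<le> real (length A) * 1" "(\<Sum>v\<leftarrow>Q. w v) \<le> real (length Q) * 1"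
        by (intro sum_list_le_const w1)+
      then show ?thesis using w1[of z] lenQ a unfolding W_def a_def by linarith
    qed
    have "1 \<le> sqrt t / \<epsilon>" using st[OF t] \<epsilon> by simp
    moreover have "(\<Sum>v\<leftarrow>A. w v) \<le> G * (sqrt t / \<epsilon>)" "(\<Sum>v\<leftarrow>Q. w v) \<le> G * (sqrt t / \<epsilon>)"
      using gaussian_sum_spread[OF A(2) \<epsilon> t] gaussian_sum_spread[OF Q(2) \<epsilon> t]
      unfolding w_def G_def gauss_const_def by auto
    ultimately have "W \<le> G * (sqrt t / \<epsilon>) + sqrt t / \<epsilon> + G * (sqrt t / \<epsilon>)"
      unfolding W_def using w1[of z] by linarith
    also have "\<dots> = (2 * G + 1) * (sqrt t / \<epsilon>)" by (simp add: algebra_simps add_divide_distrib)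
    finally have W2: "W \<le> (2 * G + 1) * (sqrt t / \<epsilon>)" .
    have pw: "t powr (\<alpha> / 2) * \<bar>lattice_heat \<epsilon> t x v\<bar> \<le> t powr (- (\<beta> / 2)) * w v" for v
      using weighted_heat_kernel_le[OF t0, of \<alpha> "x - \<epsilon> *\<^sub>R lattice_vec v"]
      by (simp add: lattice_heat_def w_def \<beta>_eq heat_kernel_nonneg)
    have pws: "t powr (\<alpha> / 2) * (\<Sum>v\<leftarrow>p. \<bar>lattice_heat \<epsilon> t x v\<bar>) \<le> t powr (- (\<beta> / 2)) * (\<Sum>v\<leftarrow>p. w v)" for p
      unfolding sum_list_const_mult[symmetric] by (intro sum_list_mono pw)
    have "t powr (\<alpha> / 2) * norm (u t x) \<le> t powr (\<alpha> / 2) *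
       ((\<Sum>v\<leftarrow>A @ [z]. \<bar>lattice_heat \<epsilon> t x v\<bar>) + (\<Sum>v\<leftarrow>Q. \<bar>lattice_heat \<epsilon> t x v\<bar>))"
      unfolding u_def using norm_walk_current_le[OF A(3), of "lattice_heat \<epsilon> t x"] norm_walk_current_le[OF Q(3), of "lattice_heat \<epsilon> t x"]
      by (intro mult_left_mono norm_triangle_mono) auto
    also have "\<dots> \<le> t powr (- (\<beta> / 2)) * W"
      using pws[of "A @ [z]"] pws[of Q] unfolding W_def by (simp add: distrib_left)
    also have "\<dots> \<le> (2 * G + 5) * a * R powr (- \<beta>)"
    proof (cases "sqrt t \<le> R")
      case True
      have "t powr (- (\<beta> / 2)) * W \<le> t powr (- (\<beta> / 2)) * ((2 * G + 1) * (sqrt t / \<epsilon>))"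
        using W2 by (intro mult_left_mono) auto
      also have "\<dots> = (2 * G + 1) / \<epsilon> * (t powr (- (\<beta> / 2)) * sqrt t)" by simp
      also have "t powr (- (\<beta> / 2)) * sqrt t = sqrt t powr (1 - \<beta>)"
        using t0 by (simp add: powr_half_sqrt[symmetric] powr_powr powr_add[symmetric] diff_divide_distrib)
      also have "\<dots> \<le> R powr (1 - \<beta>)" using True \<beta>_le_1 t0 by (intro powr_mono2) auto
      also have "R powr (1 - \<beta>) = R * R powr (- \<beta>)" using R by (simp add: powr_diff powr_minus_divide)
      finally have "t powr (- (\<beta> / 2)) * W \<le> (2 * G + 1) / \<epsilon> * (R * R powr (- \<beta>))"
        using G0 \<epsilon> by (simp add: mult_left_mono divide_right_mono)
      also have "\<dots> = (2 * G + 1) * a * R powr (- \<beta>)" using \<epsilon> by (simp add: R_def)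
      also have "\<dots> \<le> (2 * G + 5) * a * R powr (- \<beta>)" using a by (intro mult_right_mono) auto
      finally show ?thesis .
    next
      case False
      have "t powr (- (\<beta> / 2)) * W \<le> t powr (- (\<beta> / 2)) * (4 * a)"
        using W1 by (intro mult_left_mono) auto
      also have "\<dots> = sqrt t powr (- \<beta>) * (4 * a)"
        using t0 by (simp add: powr_half_sqrt[symmetric] powr_powr)
      also have "\<dots> \<le> R powr (- \<beta>) * (4 * a)"
        using False R \<beta>_nonneg a by (intro mult_right_mono powr_mono2') auto
      also have "\<dots> \<le> R powr (- \<beta>) * ((2 * G + 5) * a)" using a G0 by (intro mult_left_mono mult_right_mono) auto
      finally show ?thesis by (simp add: mult_ac)
    qed
    finally show "t powr (\<alpha> / 2) * norm (u t x) \<le> (2 * G + 5) * a * R powr (- \<beta>)" .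
  qed
  have dA: "norm (\<epsilon> *\<^sub>R lattice_vec v - o') \<le> R" if v: "v \<in> set (A @ [z]) \<union> set Q" for v
  proof -
    have "real_of_int (grid_dist v (hd A)) \<le> a"
    proof (cases "v \<in> set (A @ [z])")
      case True
      then obtain k where k: "k < length (A @ [z])" "v = (A @ [z]) ! k" by (metis in_set_conv_nth)
      have "grid_dist ((A @ [z]) ! 0) ((A @ [z]) ! k) \<le> int (k - 0)"
        by (rule walk_grid_dist_le[OF A(3)]) (use k in auto)
      moreover have "(A @ [z]) ! 0 = hd A" using A(1) by (simp add: hd_conv_nth nth_append)
      ultimately have "grid_dist v (hd A) \<le> int k" using k by (simp add: grid_dist_commute)
      then have "real_of_int (grid_dist v (hd A)) \<le> real k" by linarith
      then show ?thesis using k by (simp add: a_def)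
    next
      case False
      then obtain k where k: "k < length Q" "v = Q ! k" using v by (metis in_set_conv_nth Un_iff)
      have "grid_dist (Q ! k) (Q ! (length Q - 1)) \<le> int (length Q - 1 - k)"
        by (rule walk_grid_dist_le[OF Q(3)]) (use k in auto)
      then have "grid_dist v (hd A) \<le> int (length Q - 1 - k)" using k closed(2) Q(1) by (simp add: last_conv_nth)
      also have "\<dots> \<le> int (length A)" using len by simp
      finally show ?thesis by (simp add: a_def)
    qed
    then have "norm (lattice_vec v - lattice_vec (hd A)) \<le> a" using norm_lattice_vec_le[of v "hd A"] by linarith
    then show ?thesis
      unfolding o'_def R_def using \<epsilon> by (simp add: scaleR_diff_right[symmetric] mult_left_mono)
  qed
  (* The loop is closed, so the kernel may be replaced by its difference to the value at o'. *)
  have far: "heat_sup \<alpha> (\<epsilon>\<^sup>2) u x \<le> ennreal (256 * a * R * norm (x - o') powr (- 1 - \<beta>))"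
    if x: "2 * R \<le> norm (x - o')" for x
    unfolding heat_sup_def
  proof (rule SUP_least, rule ennreal_leI)
    fix t assume "t \<in> {\<epsilon>\<^sup>2..}"
    then have t: "\<epsilon>\<^sup>2 \<le> t" by simp
    note t0 = t_pos[OF t]
    define r where "r = norm (x - o')"
    have r: "r > 0" using x R unfolding r_def by linarith
    define \<phi> where "\<phi> = lattice_heat \<epsilon> t x"
    define k where "k = \<phi> (hd A)"
    have pointwise: "t powr (\<alpha> / 2) * \<bar>\<phi> v - k\<bar> \<le> 64 * R * r powr (- 1 - \<beta>)" if v: "v \<in> set (A @ [z]) \<union> set Q" for v
    proof -
      let ?z1 = "x - \<epsilon> *\<^sub>R lattice_vec v"
      have d: "norm (?z1 - (x - o')) \<le> R" using dA[OF v] by (simp add: norm_minus_commute)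
      have "r - R \<le> norm ?z1"
        using norm_triangle_ineq2[of "x - o'" "(x - o') - ?z1"] d unfolding r_def by (simp add: norm_minus_commute)
      then have z1: "r / 2 \<le> norm ?z1" using x unfolding r_def by linarith
      have "t powr (\<alpha> / 2) * \<bar>\<phi> v - k\<bar> \<le> 16 * norm (?z1 - (x - o')) * (r / 2) powr (- 1 - \<beta>)"
        unfolding \<phi>_def k_def lattice_heat_def o'_def[symmetric]
        by (rule weighted_heat_kernel_diff[OF t0]) (use \<beta>_eq \<beta>_nonneg \<beta>_le_1 r z1 in \<open>auto simp: r_def\<close>)
      also have "\<dots> \<le> 16 * R * (r / 2) powr (- 1 - \<beta>)"
        using d by (intro mult_right_mono mult_left_mono) auto
      also have "(r / 2) powr (- 1 - \<beta>) = 2 powr (1 + \<beta>) * r powr (- 1 - \<beta>)"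
      proof -
        have "(1 / 2 :: real) powr (- 1 - \<beta>) = 2 powr (1 + \<beta>)"
          using powr_minus[of "1/2::real" "1 + \<beta>"] by (simp add: powr_divide)
        then show ?thesis using r powr_mult[of "1/2" r "- 1 - \<beta>"] by simp
      qed
      also have "16 * R * (2 powr (1 + \<beta>) * r powr (- 1 - \<beta>)) \<le> 16 * R * (4 * r powr (- 1 - \<beta>))"
      proof -
        have "2 powr (1 + \<beta>) \<le> (2::real) powr (real 2)" using \<beta>_le_1 by (intro powr_mono) auto
        also have "\<dots> = 4" by (subst powr_realpow) auto
        finally show ?thesis using R by (intro mult_left_mono mult_right_mono) auto
      qed
      finally show ?thesis by simp
    qed
    have sums: "t powr (\<alpha> / 2) * (\<Sum>v\<leftarrow>p. \<bar>\<phi> v - k\<bar>) \<le> real (length p) * (64 * R * r powr (- 1 - \<beta>))"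
      if "set p \<subseteq> set (A @ [z]) \<union> set Q" for p
      unfolding sum_list_const_mult[symmetric] using that by (intro sum_list_le_const pointwise) auto
    have "u t x = walk_current (\<lambda>v. \<phi> v - k) (A @ [z]) + walk_current (\<lambda>v. \<phi> v - k) Q"
      using Q(1) A(1) closed by (simp add: u_def \<phi>_def walk_current_diff_const scaleR_right_diff_distrib)
    then have "norm (u t x) \<le> (\<Sum>v\<leftarrow>A @ [z]. \<bar>\<phi> v - k\<bar>) + (\<Sum>v\<leftarrow>Q. \<bar>\<phi> v - k\<bar>)"
      using norm_walk_current_le[OF A(3), of "\<lambda>v. \<phi> v - k"] norm_walk_current_le[OF Q(3), of "\<lambda>v. \<phi> v - k"]
      by (simp only:) (intro norm_triangle_mono)
    then have "t powr (\<alpha> / 2) * norm (u t x) \<le> t powr (\<alpha> / 2) * ((\<Sum>v\<leftarrow>A @ [z]. \<bar>\<phi> v - k\<bar>) + (\<Sum>v\<leftarrow>Q. \<bar>\<phi> v - k\<bar>))"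
      by (rule mult_left_mono) simp
    also have "\<dots> \<le> real (length (A @ [z])) * (64 * R * r powr (- 1 - \<beta>)) + real (length Q) * (64 * R * r powr (- 1 - \<beta>))"
      unfolding distrib_left by (intro add_mono sums) auto
    also have "\<dots> = (real (length (A @ [z])) + real (length Q)) * (64 * R * r powr (- 1 - \<beta>))"
      by (simp add: distrib_right)
    also have "\<dots> \<le> (4 * a) * (64 * R * r powr (- 1 - \<beta>))"
      using lenQ a R by (intro mult_right_mono) (auto simp: a_def)
    finally show "t powr (\<alpha> / 2) * norm (u t x) \<le> 256 * a * R * norm (x - o') powr (- 1 - \<beta>)"
      by (simp add: r_def mult_ac)
  qed
  have "(\<integral>\<^sup>+ x. heat_sup \<alpha> (\<epsilon>\<^sup>2) u x \<partial>\<nu>)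
    \<le> ennreal (2 * c * ((2 * G + 5) * a * R powr (- \<beta>)) * R powr \<beta> + 2 * c * (256 * a * R) / R)"
    by (rule nn_integral_profile_le[OF R]) (use near far a R G0 in auto)
  also have "2 * c * ((2 * G + 5) * a * R powr (- \<beta>)) * R powr \<beta> + 2 * c * (256 * a * R) / R = atom_const * a"
  proof -
    have "R powr (- \<beta>) * R powr \<beta> = 1" using R by (simp add: powr_add[symmetric])
    then have "2 * c * ((2 * G + 5) * a * R powr (- \<beta>)) * R powr \<beta> = 2 * c * ((2 * G + 5) * a)"
      by (metis mult.assoc mult.right_neutral)
    then show ?thesis using R unfolding atom_const_def G_def by (simp add: algebra_simps)
  qed
  finally show ?thesis unfolding u_def a_def .
qed

lemma nn_integral_heat_sup_add_le:
  assumes "\<tau> > 0" "\<And>t. t > 0 \<Longrightarrow> continuous_on UNIV (u t)" "\<And>t. t > 0 \<Longrightarrow> continuous_on UNIV (v t)"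
  shows "(\<integral>\<^sup>+ x. heat_sup \<alpha> \<tau> (\<lambda>t x. u t x + v t x) x \<partial>\<nu>)
    \<le> (\<integral>\<^sup>+ x. heat_sup \<alpha> \<tau> u x \<partial>\<nu>) + (\<integral>\<^sup>+ x. heat_sup \<alpha> \<tau> v x \<partial>\<nu>)"
proof -
  have m: "heat_sup \<alpha> \<tau> u \<in> borel_measurable \<nu>" "heat_sup \<alpha> \<tau> v \<in> borel_measurable \<nu>"
    using assms heat_sup_measurable[of \<tau> u \<alpha>] heat_sup_measurable[of \<tau> v \<alpha>] sets_\<nu>
    by (simp_all cong: measurable_cong_sets)
  show ?thesis
    unfolding nn_integral_add[OF m, symmetric] by (intro nn_integral_mono heat_sup_add_le)
qed

text \<open>
  Surgery by induction on the length. The walk is cut at the first index \<open>j\<close> at which it violates the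
  chord-arc condition with some earlier index \<open>i\<close>; such an index exists because the walk is closed. Up
  to \<open>j\<close> the condition holds, so the arc between \<open>i\<close> and \<open>j\<close> and a geodesic chord back form an
  atom. In the remaining closed walk the chord replaces the arc and is at most half as long;
  hence the loss of length pays for the atom, with the factor \<open>2\<close>.
\<close>

lemma closed_walk_bound:
  fixes p :: "(int ^ 'n) list"
  assumes \<epsilon>: "\<epsilon> > 0"
  shows "p \<noteq> [] \<Longrightarrow> hd p = last p \<Longrightarrow> successively adjacent p \<Longrightarrow>
    (\<integral>\<^sup>+ x. heat_sup \<alpha> (\<epsilon>\<^sup>2) (\<lambda>t x. walk_current (lattice_heat \<epsilon> t x) p) x \<partial>\<nu>)
      \<le> ennreal (2 * atom_const * real (length p - 1))"
proof (induction "length p" arbitrary: p rule: less_induct)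
  case less
  note p = less.prems
  show ?case
  proof (cases "length p = 1")
    case True
    then obtain x where "p = [x]" by (auto simp: length_Suc_conv)
    then show ?thesis by (simp add: heat_sup_def[abs_def])
  next
    case False
    define bad where "bad j \<longleftrightarrow> j < length p \<and> (\<exists>i<j. 2 * grid_dist (p ! i) (p ! j) \<le> int (j - i))" for j
    define j where "j = (LEAST j. bad j)"
    have "length p > 1" using False p(1) by (cases p) auto
    then have "bad (length p - 1)"
      using p unfolding bad_def by (auto intro!: exI[of _ 0] simp: hd_conv_nth last_conv_nth grid_dist_def)
    then have "bad j" unfolding j_def by (rule LeastI)
    then obtain i where j: "j < length p" and i: "i < j" and ij: "2 * grid_dist (p ! i) (p ! j) \<le> int (j - i)"
      by (auto simp: bad_def)
    have nb: "\<not> bad l" if "l < j" for l using not_less_Least that unfolding j_def by blast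
    define A where "A = take (j - i) (drop i p)"
    have lenA: "length A = j - i" using i j by (simp add: A_def)
    have nthA: "A ! k = p ! (i + k)" if "k < j - i" for k using that i j by (simp add: A_def)
    have Az: "A @ [p ! j] = take (Suc (j - i)) (drop i p)"
      unfolding A_def using i j by (subst take_Suc_conv_app_nth) auto
    have A1: "A \<noteq> []" using lenA i by auto
    have A2: "spread A"
      unfolding spread_def
    proof (intro allI impI)
      fix l k assume l: "l < length A" and k: "k < l"
      have "\<not> bad (i + l)" using l lenA by (intro nb) simp
      moreover have "bad (i + l)" if "2 * grid_dist (p ! (i + k)) (p ! (i + l)) \<le> int (i + l - (i + k))"
        unfolding bad_def
      proof (intro conjI exI[of _ "i + k"])
        show "i + l < length p" "i + k < i + l" using l k lenA j by auto
      qed (rule that)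
      ultimately have "\<not> 2 * grid_dist (p ! (i + k)) (p ! (i + l)) \<le> int (i + l - (i + k))" by blast
      then show "int (l - k) < 2 * grid_dist (A ! k) (A ! l)" using l k lenA nthA by simp
    qed
    have adj_take: "successively adjacent (take n r)" "successively adjacent (drop n r)" if "successively adjacent r" for n r
      using that by (metis append_take_drop_id successively_append_iff)+
    have A3: "successively adjacent (A @ [p ! j])" unfolding Az by (intro adj_take p)
    obtain Q where Q: "Q \<noteq> []" "hd Q = p ! j" "last Q = p ! i" "successively adjacent Q"
        "int (length Q) = grid_dist (p ! j) (p ! i) + 1"
      using ex_geodesic[of "p ! j" "p ! i"] by auto
    have lQ: "2 * (int (length Q) - 1) \<le> int (j - i)" using Q(5) ij by (simp add: grid_dist_commute)
    have sQ: "spread Q" using Q by (intro spread_geodesic) auto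
    have hdA: "hd A = p ! i" using nthA[of 0] A1 i by (simp add: hd_conv_nth)
    define P where "P = take (Suc i) p"
    define S where "S = drop j p"
    have P: "P \<noteq> []" "hd P = hd p" "last P = p ! i" "length P = i + 1" "successively adjacent P"
      using i j p adj_take(1)[OF p(3), of "Suc i"] by (auto simp: P_def take_Suc_conv_app_nth hd_append hd_conv_nth nth_append)
    have S: "S \<noteq> []" "hd S = p ! j" "last S = last p" "length S = length p - j" "successively adjacent S"
      using j p adj_take(2)[OF p(3), of j] by (auto simp: S_def hd_drop_conv_nth)
    define T where "T = (P @ tl (rev Q)) @ tl S"
    have rQ: "rev Q \<noteq> []" "hd (rev Q) = p ! i" "last (rev Q) = p ! j" "successively adjacent (rev Q)"
    proof -
      have "successively (\<lambda>x y. adjacent y x) Q"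
        using Q(4) adjacent_commute by (auto simp: successively_conv_nth)
      then show "rev Q \<noteq> []" "hd (rev Q) = p ! i" "last (rev Q) = p ! j" "successively adjacent (rev Q)"
        using Q by (simp_all add: hd_rev last_rev)
    qed
    note j1 = walk_join[OF P(1) rQ(1) _ P(5) rQ(4), unfolded P(3) rQ(2), OF refl]
    note j2 = walk_join[OF j1(1) S(1) _ j1(4) S(5), unfolded j1(3) rQ(3) S(2), OF refl]
    have T: "T \<noteq> []" "hd T = last T" "successively adjacent T"
      using j2 j1(2) P(2) S(3) p(2) unfolding T_def by simp_all
    have lenQ: "length Q \<ge> 1" using Q(1) by (cases Q) auto
    have lenT: "length T + 1 = i + length Q + (length p - j)"
      using j2(5) j1(5) P(4) S(4) lenQ j unfolding T_def by simp
    have "length T - 1 + (j - i) + 1 = length p - 1 + length Q"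
      using lenT i j lenQ by linarith
    then have "real (length T - 1 + (j - i) + 1) = real (length p - 1 + length Q)" by (rule arg_cong)
    then have lT: "real (length T - 1) = real (length p - 1) - real (j - i) + (real (length Q) - 1)"
      unfolding of_nat_add by simp
    have "2 * q \<le> d + 2" if "2 * (int q - 1) \<le> int d" for q d using that by presburger
    from this[OF lQ] have nQ: "2 * length Q \<le> j - i + 2" .
    then have "real (2 * length Q) \<le> real (j - i + 2)" unfolding of_nat_le_iff .
    then have lQ': "2 * (real (length Q) - 1) \<le> real (j - i)" unfolding of_nat_add of_nat_mult by simp
    have ltT: "length T < length p" using lenT nQ i j by linarith
    have split: "walk_current \<phi> p = (walk_current \<phi> (A @ [p ! j]) + walk_current \<phi> Q) + walk_current \<phi> T" for \<phi>
    proof -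
      have "walk_current \<phi> p = walk_current \<phi> P + walk_current \<phi> (drop i p)"
        unfolding P_def using i j by (intro walk_split) auto
      also have "walk_current \<phi> (drop i p) = walk_current \<phi> (A @ [p ! j]) + walk_current \<phi> S"
        using walk_split[of "j - i" "drop i p" \<phi>] i j unfolding Az S_def by simp
      finally have "walk_current \<phi> p = walk_current \<phi> P + (walk_current \<phi> (A @ [p ! j]) + walk_current \<phi> S)" .
      moreover have "walk_current \<phi> T = walk_current \<phi> P - walk_current \<phi> Q + walk_current \<phi> S"
      proof -
        have "walk_current \<phi> T = walk_current \<phi> (P @ tl (rev Q)) + walk_current \<phi> S"
          unfolding T_def by (rule walk_current_join) (use j1(1,3) S rQ in auto)
        also have "walk_current \<phi> (P @ tl (rev Q)) = walk_current \<phi> P + walk_current \<phi> (rev Q)"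
          by (rule walk_current_join) (use P rQ in auto)
        finally show ?thesis by (simp add: walk_current_rev)
      qed
      ultimately show ?thesis by simp
    qed
    have "(\<integral>\<^sup>+ x. heat_sup \<alpha> (\<epsilon>\<^sup>2) (\<lambda>t x. walk_current (lattice_heat \<epsilon> t x) p) x \<partial>\<nu>)
      \<le> (\<integral>\<^sup>+ x. heat_sup \<alpha> (\<epsilon>\<^sup>2) (\<lambda>t x. walk_current (lattice_heat \<epsilon> t x) (A @ [p ! j]) + walk_current (lattice_heat \<epsilon> t x) Q) x \<partial>\<nu>)
       + (\<integral>\<^sup>+ x. heat_sup \<alpha> (\<epsilon>\<^sup>2) (\<lambda>t x. walk_current (lattice_heat \<epsilon> t x) T) x \<partial>\<nu>)"
      unfolding split using \<epsilon>
      by (intro nn_integral_heat_sup_add_le continuous_intros continuous_walk_heat) auto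
    also have "\<dots> \<le> ennreal (atom_const * real (length A)) + ennreal (2 * atom_const * real (length T - 1))"
      using lQ lenA Q hdA
      by (intro add_mono atom_bound less.hyps ltT T \<epsilon> A1 A2 A3 sQ) auto
    also have "\<dots> = ennreal (atom_const * real (length A) + 2 * atom_const * real (length T - 1))"
      using atom_const_pos by (intro ennreal_plus[symmetric]) auto
    also have "\<dots> \<le> ennreal (2 * atom_const * real (length p - 1))"
    proof (rule ennreal_leI)
      have "atom_const * (real (length A) + 2 * real (length T - 1)) \<le> atom_const * (2 * real (length p - 1))"
        using lT lQ' lenA atom_const_pos by (intro mult_left_mono) auto
      then show "atom_const * real (length A) + 2 * atom_const * real (length T - 1) \<le> 2 * atom_const * real (length p - 1)"
        by (simp add: algebra_simps)
    qed
    finally show ?thesis .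
  qed
qed

end

section \<open>Conservative flows on finite graphs\<close>

text \<open>
  Following edges of positive weight never gets stuck, by conservation, and must repeat an
  edge. The stretch up to the first repetition is a cycle without repeated edges.
\<close>

lemma flow_contains_cycle:
  fixes w :: "'e \<Rightarrow> real" and src tgt :: "'e \<Rightarrow> 'v"
  assumes E: "finite E" and nonneg: "\<And>e. e \<in> E \<Longrightarrow> 0 \<le> w e"
    and conserved: "\<And>x. (\<Sum>e\<in>E. w e * (of_bool (src e = x) - of_bool (tgt e = x))) = 0"
    and e0: "e0 \<in> E" "w e0 > 0"
  obtains e :: "nat \<Rightarrow> 'e" and n where "n > 0" "inj_on e {..<n}"
    "\<And>k. e k \<in> E" "\<And>k. w (e k) > 0" "\<And>k. tgt (e k) = src (e (Suc k))" "e n = e 0"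
proof -
  define S where "S = {e \<in> E. w e > 0}"
  have "\<exists>e'\<in>S. src e' = tgt e" if e: "e \<in> S" for e
  proof (rule ccontr)
    assume none: "\<not> ?thesis"
    have "(\<Sum>e'\<in>E. w e' * (of_bool (src e' = tgt e) - of_bool (tgt e' = tgt e)))
        \<le> (\<Sum>e'\<in>E. if e' = e then - w e else 0)"
    proof (rule sum_mono)
      fix e' assume e': "e' \<in> E"
      have "w e' = 0 \<or> src e' \<noteq> tgt e" using none e' nonneg[OF e'] by (auto simp: S_def)
      then show "w e' * (of_bool (src e' = tgt e) - of_bool (tgt e' = tgt e)) \<le> (if e' = e then - w e else 0)"
        using nonneg[OF e'] by auto
    qed
    also have "\<dots> < 0" using e E by (simp add: S_def)
    finally show False using conserved[of "tgt e"] by simp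
  qed
  then obtain nx where nx: "\<And>e. e \<in> S \<Longrightarrow> nx e \<in> S \<and> src (nx e) = tgt e" by metis
  define f where "f k = (nx ^^ k) e0" for k
  have fS: "f k \<in> S" for k
    by (induction k) (use e0 nx in \<open>auto simp: f_def S_def\<close>)
  have step: "tgt (f k) = src (f (Suc k))" for k using nx[OF fS[of k]] by (simp add: f_def)
  have "\<not> inj_on f (UNIV :: nat set)"
    using E fS finite_imageD[of f UNIV] finite_subset[of "range f" S] by (auto simp: S_def)
  then have ex: "\<exists>j. \<exists>i<j. f i = f j" by (metis inj_onI linorder_neqE_nat)
  define j where "j = (LEAST j. \<exists>i<j. f i = f j)"
  obtain i where i: "i < j" "f i = f j" using LeastI_ex[OF ex] unfolding j_def by blast
  have inj: "f k \<noteq> f l" if "k < l" "l < j" for k l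
    using not_less_Least[of l "\<lambda>j. \<exists>i<j. f i = f j"] that unfolding j_def by blast
  show thesis
  proof (rule that[of "j - i" "\<lambda>k. f (i + k)"])
    show "inj_on (\<lambda>k. f (i + k)) {..<j - i}"
    proof (rule inj_onI)
      fix k l assume kl: "k \<in> {..<j - i}" "l \<in> {..<j - i}" and eq: "f (i + k) = f (i + l)"
      have "i + k < j" "i + l < j" using kl i by auto
      then show "k = l" using inj[of "i + k" "i + l"] inj[of "i + l" "i + k"] eq
        by (cases k l rule: linorder_cases) auto
    qed
  qed (use i fS step in \<open>auto simp: S_def\<close>)
qed

text \<open>
  Subtracting the least weight along a cycle keeps the flow nonnegative and conservative and removes an
  edge from its support. Phrased as an induction principle, the decomposition into cycles yields
  estimates for every subadditive functional without naming the cycles. Edges are abstract, with source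
  and target maps, so that the orientation of an edge may depend on the sign of the flow through it.
\<close>

lemma conservative_flow_induct:
  fixes w :: "'e \<Rightarrow> real" and src tgt :: "'e \<Rightarrow> 'v"
  assumes E: "finite E" and nonneg: "\<And>e. e \<in> E \<Longrightarrow> 0 \<le> w e" and outside: "\<And>e. e \<notin> E \<Longrightarrow> w e = 0"
    and conserved: "\<And>x. (\<Sum>e\<in>E. w e * (of_bool (src e = x) - of_bool (tgt e = x))) = 0"
    and zero: "P (\<lambda>_. 0)"
    and cycle: "\<And>w c e n. P w \<Longrightarrow> (\<And>e. e \<in> E \<Longrightarrow> 0 \<le> w e) \<Longrightarrow> c > 0 \<Longrightarrow> inj_on e {..<n} \<Longrightarrow> (\<And>k. e k \<in> E) \<Longrightarrow>
      (\<And>k. tgt (e k) = src (e (Suc k))) \<Longrightarrow> e n = e 0 \<Longrightarrow>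
      P (\<lambda>x. w x + c * of_bool (x \<in> e ` {..<(n::nat)}))"
  shows "P w"
  using nonneg outside conserved
proof (induction "card {e \<in> E. w e > 0}" arbitrary: w rule: less_induct)
  case less
  show ?case
  proof (cases "\<exists>e0\<in>E. w e0 > 0")
    case False
    then have "w = (\<lambda>_. 0)" using less.prems(1,2) by (metis ext order_less_le)
    then show ?thesis using zero by simp
  next
    case True
    then obtain e0 where e0: "e0 \<in> E" "w e0 > 0" by blast
    have "\<exists>(e :: nat \<Rightarrow> 'e) n. n > 0 \<and> inj_on e {..<n} \<and> (\<forall>k. e k \<in> E) \<and> (\<forall>k. w (e k) > 0) \<and>
        (\<forall>k. tgt (e k) = src (e (Suc k))) \<and> e n = e 0"
      by (rule flow_contains_cycle[OF E less.prems(1) less.prems(3) e0]) blast+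
    then obtain e :: "nat \<Rightarrow> 'e" and n where n: "n > 0" and inj: "inj_on e {..<n}"
      and eE: "\<And>k. e k \<in> E" "\<And>k. w (e k) > 0" and step: "\<And>k. tgt (e k) = src (e (Suc k))" and closed: "e n = e 0"
      by blast
    define c where "c = Min (w ` e ` {..<n})"
    have fin: "finite (w ` e ` {..<n})" "w ` e ` {..<n} \<noteq> {}" using n by auto
    have c: "c > 0" unfolding c_def using fin eE by (subst Min_gr_iff) auto
    have c_le: "c \<le> w (e k)" if "k < n" for k unfolding c_def using fin that by (intro Min_le) auto
    obtain k0 where k0: "k0 < n" "w (e k0) = c" using Min_in[OF fin] unfolding c_def by auto
    define w' where "w' x = w x - c * of_bool (x \<in> e ` {..<n})" for x
    have w'_nonneg: "0 \<le> w' x" if "x \<in> E" for x using less.prems(1)[OF that] c_le by (auto simp: w'_def)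
    have "{x \<in> E. w' x > 0} \<subset> {x \<in> E. w x > 0}"
    proof
      show "{x \<in> E. w' x > 0} \<subseteq> {x \<in> E. w x > 0}" using c by (auto simp: w'_def)
      have "e k0 \<in> {x \<in> E. w x > 0}" "e k0 \<notin> {x \<in> E. w' x > 0}" using k0 eE by (auto simp: w'_def)
      then show "{x \<in> E. w' x > 0} \<noteq> {x \<in> E. w x > 0}" by blast
    qed
    then have card: "card {x \<in> E. w' x > 0} < card {x \<in> E. w x > 0}"
      using E by (intro psubset_card_mono) auto
    have w'_out: "w' x = 0" if "x \<notin> E" for x using that less.prems(2) eE by (auto simp: w'_def)
    have cyc: "(\<Sum>x\<in>E. c * of_bool (x \<in> e ` {..<n}) * g x) = c * (\<Sum>k<n. g (e k))" for g :: "'e \<Rightarrow> real"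
    proof -
      have "(\<Sum>x\<in>E. c * of_bool (x \<in> e ` {..<n}) * g x) = (\<Sum>x\<in>e ` {..<n}. c * g x)"
        using E eE by (intro sum.mono_neutral_cong_right) auto
      also have "\<dots> = (\<Sum>k<n. c * g (e k))" by (simp add: sum.reindex[OF inj])
      finally show ?thesis by (simp add: sum_distrib_left)
    qed
    have "(\<Sum>x\<in>E. w' x * (of_bool (src x = y) - of_bool (tgt x = y))) = 0" for y
    proof -
      have "(\<Sum>k<n. of_bool (src (e k) = y) - of_bool (tgt (e k) = y)) = (0::real)"
      proof -
        have "(\<Sum>k<n. of_bool (src (e k) = y) - of_bool (tgt (e k) = y))
          = (\<Sum>k<n. of_bool (src (e k) = y) - (of_bool (src (e (Suc k)) = y) :: real))"
          using step by simp
        also have "\<dots> = of_bool (src (e 0) = y) - of_bool (src (e n) = y)" by (rule sum_lessThan_telescope')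
        finally show ?thesis using closed by simp
      qed
      then show ?thesis
        using less.prems(3)[of y] cyc[of "\<lambda>x. of_bool (src x = y) - of_bool (tgt x = y)"]
        unfolding w'_def left_diff_distrib[of "w _"] sum_subtractf by simp
    qed
    from less.hyps[OF card w'_nonneg w'_out this] have "P w'" .
    from cycle[OF this w'_nonneg c inj eE(1) step closed]
    have "P (\<lambda>x. w' x + c * of_bool (x \<in> e ` {..<n}))" .
    then show ?thesis by (simp add: w'_def)
  qed
qed

lemma walk_current_map:
  "walk_current \<phi> (map v [0..<Suc n]) = (\<Sum>k<n. edge_current \<phi> (v k) (v (Suc k)))"
proof (induction n)
  case (Suc n)
  have "walk_current \<phi> (map v [0..<Suc (Suc n)]) = walk_current \<phi> (map v [0..<Suc n] @ [v (Suc n)])" by simp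
  also have "\<dots> = walk_current \<phi> (map v [0..<Suc n]) + edge_current \<phi> (v n) (v (Suc n))"
    by (subst walk_current_append) auto
  finally show ?case using Suc by simp
qed simp

lemma adjacent_axis: "adjacent (a - axis i 1) a"
proof -
  have "grid_dist (a - axis i 1) a = (\<Sum>j\<in>UNIV. if j = i then 1 else 0)"
    unfolding grid_dist_def by (intro sum.cong refl) (auto simp: axis_def)
  then show ?thesis by (simp add: adjacent_def)
qed

context ball_growth
begin

lemma conservative_flow_bound:
  fixes w :: "'e \<Rightarrow> real" and src tgt :: "'e \<Rightarrow> int ^ 'n"
  assumes \<epsilon>: "\<epsilon> > 0" and E: "finite E"
    and nonneg: "\<And>e. e \<in> E \<Longrightarrow> 0 \<le> w e" and outside: "\<And>e. e \<notin> E \<Longrightarrow> w e = 0"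
    and adj: "\<And>e. e \<in> E \<Longrightarrow> adjacent (src e) (tgt e)"
    and conserved: "\<And>x. (\<Sum>e\<in>E. w e * (of_bool (src e = x) - of_bool (tgt e = x))) = 0"
  shows "(\<integral>\<^sup>+ x. heat_sup \<alpha> (\<epsilon>\<^sup>2) (\<lambda>t x. \<Sum>e\<in>E. w e *\<^sub>R edge_current (lattice_heat \<epsilon> t x) (src e) (tgt e)) x \<partial>\<nu>)
    \<le> ennreal (2 * atom_const * (\<Sum>e\<in>E. w e))"
  using E nonneg outside conserved
proof (rule conservative_flow_induct)
  show "(\<integral>\<^sup>+ x. heat_sup \<alpha> (\<epsilon>\<^sup>2) (\<lambda>t x. \<Sum>e\<in>E. 0 *\<^sub>R edge_current (lattice_heat \<epsilon> t x) (src e) (tgt e)) x \<partial>\<nu>)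
    \<le> ennreal (2 * atom_const * (\<Sum>e\<in>E. 0))"
    by (simp add: heat_sup_def[abs_def])
next
  fix w :: "'e \<Rightarrow> real" and c :: real and e :: "nat \<Rightarrow> 'e" and n :: nat
  assume IH: "(\<integral>\<^sup>+ x. heat_sup \<alpha> (\<epsilon>\<^sup>2) (\<lambda>t x. \<Sum>e\<in>E. w e *\<^sub>R edge_current (lattice_heat \<epsilon> t x) (src e) (tgt e)) x \<partial>\<nu>)
    \<le> ennreal (2 * atom_const * (\<Sum>e\<in>E. w e))"
    and w: "\<And>e. e \<in> E \<Longrightarrow> 0 \<le> w e"
    and c: "c > 0" and inj: "inj_on e {..<n}" and eE: "\<And>k. e k \<in> E"
    and step: "\<And>k. tgt (e k) = src (e (Suc k))" and closed: "e n = e 0"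
  define p where "p = map (\<lambda>k. src (e k)) [0..<Suc n]"
  have p: "p \<noteq> []" "hd p = last p" "successively adjacent p" "length p - 1 = n"
  proof -
    show "p \<noteq> []" "length p - 1 = n" by (simp_all add: p_def)
    show "hd p = last p" using closed by (simp add: p_def hd_conv_nth last_conv_nth del: upt_Suc)
    have "adjacent (src (e k)) (src (e (Suc k)))" for k using adj[OF eE[of k]] step[of k] by simp
    then show "successively adjacent p"
      by (auto simp: p_def successively_conv_nth simp del: upt_Suc)
  qed
  have split: "(\<Sum>x\<in>E. (c * of_bool (x \<in> e ` {..<n})) *\<^sub>R g x) = c *\<^sub>R (\<Sum>k<n. g (e k))" for g :: "'e \<Rightarrow> 'z::real_vector"
  proof -
    have "(\<Sum>x\<in>E. (c * of_bool (x \<in> e ` {..<n})) *\<^sub>R g x) = (\<Sum>x\<in>e ` {..<n}. c *\<^sub>R g x)"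
      using E eE by (intro sum.mono_neutral_cong_right) auto
    also have "\<dots> = (\<Sum>k<n. c *\<^sub>R g (e k))" by (simp add: sum.reindex[OF inj])
    finally show ?thesis by (simp add: scaleR_sum_right)
  qed
  let ?U = "\<lambda>t x. \<Sum>e\<in>E. w e *\<^sub>R edge_current (lattice_heat \<epsilon> t x) (src e) (tgt e)"
  have eq: "(\<lambda>t x. \<Sum>y\<in>E. (w y + c * of_bool (y \<in> e ` {..<n})) *\<^sub>R edge_current (lattice_heat \<epsilon> t x) (src y) (tgt y))
    = (\<lambda>t x. ?U t x + c *\<^sub>R walk_current (lattice_heat \<epsilon> t x) p)"
    unfolding scaleR_left_distrib sum.distrib split p_def walk_current_map by (simp add: step)
  have sum_eq: "(\<Sum>y\<in>E. w y + c * of_bool (y \<in> e ` {..<n})) = (\<Sum>y\<in>E. w y) + c * real n"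
    using split[of "\<lambda>_. 1 :: real"] by (simp add: sum.distrib)
  have "(\<integral>\<^sup>+ x. heat_sup \<alpha> (\<epsilon>\<^sup>2) (\<lambda>t x. \<Sum>y\<in>E. (w y + c * of_bool (y \<in> e ` {..<n})) *\<^sub>R edge_current (lattice_heat \<epsilon> t x) (src y) (tgt y)) x \<partial>\<nu>)
    \<le> (\<integral>\<^sup>+ x. heat_sup \<alpha> (\<epsilon>\<^sup>2) ?U x \<partial>\<nu>) + (\<integral>\<^sup>+ x. heat_sup \<alpha> (\<epsilon>\<^sup>2) (\<lambda>t x. c *\<^sub>R walk_current (lattice_heat \<epsilon> t x) p) x \<partial>\<nu>)"
    unfolding eq using \<epsilon>
    by (intro nn_integral_heat_sup_add_le continuous_intros continuous_walk_heat) (auto simp: edge_current_def intro!: continuous_intros)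
  also have "(\<integral>\<^sup>+ x. heat_sup \<alpha> (\<epsilon>\<^sup>2) (\<lambda>t x. c *\<^sub>R walk_current (lattice_heat \<epsilon> t x) p) x \<partial>\<nu>)
    \<le> (\<integral>\<^sup>+ x. ennreal c * heat_sup \<alpha> (\<epsilon>\<^sup>2) (\<lambda>t x. walk_current (lattice_heat \<epsilon> t x) p) x \<partial>\<nu>)"
    using heat_sup_scale_le[of \<alpha> "\<epsilon>\<^sup>2" c "\<lambda>t x. walk_current (lattice_heat \<epsilon> t x) p"] c by (intro nn_integral_mono) simp
  also have "\<dots> = ennreal c * (\<integral>\<^sup>+ x. heat_sup \<alpha> (\<epsilon>\<^sup>2) (\<lambda>t x. walk_current (lattice_heat \<epsilon> t x) p) x \<partial>\<nu>)"
  proof (rule nn_integral_cmult)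
    have "0 < \<epsilon>\<^sup>2" using \<epsilon> by simp
    then show "heat_sup \<alpha> (\<epsilon>\<^sup>2) (\<lambda>t x. walk_current (lattice_heat \<epsilon> t x) p) \<in> borel_measurable \<nu>"
      unfolding measurable_\<nu>
      by (intro heat_sup_measurable continuous_walk_heat) (rule less_le_trans[OF \<open>0 < \<epsilon>\<^sup>2\<close>])
  qed
  also have "\<dots> \<le> ennreal c * ennreal (2 * atom_const * real n)"
    using closed_walk_bound[OF \<epsilon> p(1-3)] p(4) by (intro mult_left_mono) auto
  also have "(\<integral>\<^sup>+ x. heat_sup \<alpha> (\<epsilon>\<^sup>2) ?U x \<partial>\<nu>) + ennreal c * ennreal (2 * atom_const * real n)
     \<le> ennreal (2 * atom_const * (\<Sum>y\<in>E. w y)) + ennreal (c * (2 * atom_const * real n))"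
    using IH c atom_const_pos by (intro add_mono) (auto simp: ennreal_mult)
  also have "\<dots> = ennreal (2 * atom_const * (\<Sum>y\<in>E. w y) + c * (2 * atom_const * real n))"
    using c atom_const_pos w by (intro ennreal_plus[symmetric]) (auto intro!: mult_nonneg_nonneg sum_nonneg)
  also have "\<dots> = ennreal (2 * atom_const * (\<Sum>y\<in>E. w y + c * of_bool (y \<in> e ` {..<n})))"
    unfolding sum_eq by (simp add: algebra_simps)
  finally show "(\<integral>\<^sup>+ x. heat_sup \<alpha> (\<epsilon>\<^sup>2) (\<lambda>t x. \<Sum>y\<in>E. (w y + c * of_bool (y \<in> e ` {..<n})) *\<^sub>R edge_current (lattice_heat \<epsilon> t x) (src y) (tgt y)) x \<partial>\<nu>)
    \<le> ennreal (2 * atom_const * (\<Sum>y\<in>E. w y + c * of_bool (y \<in> e ` {..<n})))"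
    by (simp add: add_mono order_trans)
qed


text \<open>
  A signed flow becomes a nonnegative one when every edge with a negative value is turned around.
\<close>

lemma signed_flow_bound:
  fixes f :: "(int ^ 'n) \<times> 'n \<Rightarrow> real"
  assumes \<epsilon>: "\<epsilon> > 0" and E: "finite E"
    and conserved: "\<And>x. (\<Sum>(a, i)\<in>E. f (a, i) * (of_bool (a - axis i 1 = x) - of_bool (a = x))) = 0"
  shows "(\<integral>\<^sup>+ x. heat_sup \<alpha> (\<epsilon>\<^sup>2)
      (\<lambda>t x. \<Sum>(a, i)\<in>E. f (a, i) *\<^sub>R edge_current (lattice_heat \<epsilon> t x) (a - axis i 1) a) x \<partial>\<nu>)
    \<le> ennreal (2 * atom_const * (\<Sum>e\<in>E. \<bar>f e\<bar>))"
proof -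
  define w where "w e = (if e \<in> E then \<bar>f e\<bar> else 0)" for e
  define src where "src e = (if f e \<ge> 0 then fst e - axis (snd e) 1 else fst e)" for e
  define tgt where "tgt e = (if f e \<ge> 0 then fst e else fst e - axis (snd e) 1)" for e
  have "(\<integral>\<^sup>+ x. heat_sup \<alpha> (\<epsilon>\<^sup>2) (\<lambda>t x. \<Sum>e\<in>E. w e *\<^sub>R edge_current (lattice_heat \<epsilon> t x) (src e) (tgt e)) x \<partial>\<nu>)
    \<le> ennreal (2 * atom_const * (\<Sum>e\<in>E. w e))"
  proof (rule conservative_flow_bound[OF \<epsilon> E])
    fix x
    have "(\<Sum>e\<in>E. w e * (of_bool (src e = x) - of_bool (tgt e = x)))
      = (\<Sum>e\<in>E. f e * (of_bool (fst e - axis (snd e) 1 = x) - of_bool (fst e = x)))"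
      by (intro sum.cong refl) (auto simp: w_def src_def tgt_def)
    then show "(\<Sum>e\<in>E. w e * (of_bool (src e = x) - of_bool (tgt e = x))) = 0"
      using conserved[of x] by (simp add: case_prod_unfold)
  next
    fix e assume "e \<in> E"
    show "adjacent (src e) (tgt e)"
      using adjacent_axis adjacent_commute by (auto simp: src_def tgt_def)
  qed (auto simp: w_def)
  moreover have "(\<Sum>e\<in>E. w e *\<^sub>R edge_current \<phi> (src e) (tgt e)) = (\<Sum>(a, i)\<in>E. f (a, i) *\<^sub>R edge_current \<phi> (a - axis i 1) a)" for \<phi>
    unfolding case_prod_unfold
    by (intro sum.cong refl) (auto simp: w_def src_def tgt_def edge_current_swap[of \<phi> "fst _" "fst _ - _"])
  moreover have "(\<Sum>e\<in>E. w e) = (\<Sum>e\<in>E. \<bar>f e\<bar>)" by (simp add: w_def)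
  ultimately show ?thesis by simp
qed

end

section \<open>A smooth step function\<close>

text \<open>
  With \<open>w = s (1 - s)\<close>, these are the functions \<open>p exp (- 1 / w) / w\<^sup>n\<close> on the unit interval. The family
  contains a smooth bump and is closed under differentiation, \<open>bump_step\<close> giving the new
  polynomial for \<open>n + 2\<close>.
\<close>

definition bump :: "real poly \<Rightarrow> nat \<Rightarrow> real \<Rightarrow> real" where
  "bump p n s = (if 0 < s \<and> s < 1
     then poly p s * (1 / (s * (1 - s))) ^ n * exp (- (1 / (s * (1 - s)))) else 0)"

definition bump_step :: "real poly \<Rightarrow> nat \<Rightarrow> real poly" where
  "bump_step p n = pderiv p * [:0, 1, -1:]\<^sup>2 - smult (real n) (p * [:1, -2:] * [:0, 1, -1:]) + p * [:1, -2:]"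

text \<open>
  With \<open>k = n + 2\<close>, raising \<open>1 / (k w) \<le> exp (1 / (k w))\<close> to the power \<open>k\<close> shows that \<open>exp (- 1 / w)\<close> is
  at most \<open>(k w)\<^sup>k\<close>.
\<close>

lemma exp_flat:
  fixes w :: real
  assumes "w > 0"
  shows "(1 / w) ^ n * exp (- (1 / w)) \<le> real (n + 2) ^ (n + 2) * w\<^sup>2"
proof -
  let ?k = "n + 2"
  have "1 / (real ?k * w) \<le> exp (1 / (real ?k * w))"
    using exp_ge_add_one_self[of "1 / (real ?k * w)"] by linarith
  then have "(1 / (real ?k * w)) ^ ?k \<le> exp (1 / (real ?k * w)) ^ ?k"
    using assms by (intro power_mono) auto
  also have "\<dots> = exp (real ?k * (1 / (real ?k * w)))" by (rule exp_of_nat_mult[symmetric])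
  also have "real ?k * (1 / (real ?k * w)) = 1 / w" by (simp add: divide_simps)
  finally have "(1 / (real ?k * w)) ^ ?k \<le> exp (1 / w)" .
  then have "exp (- (1 / w)) \<le> (real ?k * w) ^ ?k"
    using assms by (simp add: exp_minus power_divide divide_simps mult.commute)
  then have "(1 / w) ^ n * exp (- (1 / w)) \<le> (1 / w) ^ n * (real ?k * w) ^ ?k"
    using assms by (intro mult_left_mono) auto
  also have "\<dots> = real ?k ^ ?k * w\<^sup>2"
    using assms by (simp add: power_mult_distrib power_add power_divide power2_eq_square)
  finally show ?thesis .
qed

lemma DERIV_zero_if_quadratic:
  fixes f :: "real \<Rightarrow> real"
  assumes "\<And>s. \<bar>f s - f x\<bar> \<le> M * (s - x)\<^sup>2"
  shows "(f has_real_derivative 0) (at x)"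
  unfolding has_field_derivative_iff
proof (rule Lim_null_comparison[where g="\<lambda>s. M * \<bar>s - x\<bar>"])
  show "\<forall>\<^sub>F s in at x. norm ((f s - f x) / (s - x)) \<le> M * \<bar>s - x\<bar>"
    unfolding eventually_at_filter
  proof (intro always_eventually allI impI)
    fix s assume "s \<noteq> x"
    then show "norm ((f s - f x) / (s - x)) \<le> M * \<bar>s - x\<bar>"
      using assms[of s] by (simp add: divide_simps abs_mult power2_eq_square abs_mult_self_eq mult.assoc)
  qed
  have "((\<lambda>s. M * \<bar>s - x\<bar>) \<longlongrightarrow> M * \<bar>x - x\<bar>) (at x)" by (intro tendsto_intros)
  then show "((\<lambda>s. M * \<bar>s - x\<bar>) \<longlongrightarrow> 0) (at x)" by simp
qed

lemma bump_derivative: "(bump p n has_real_derivative bump (bump_step p n) (n + 2) x) (at x)"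
proof -
  consider "x < 0 \<or> x > 1" | "0 < x" "x < 1" | "x = 0 \<or> x = 1" by linarith
  then show ?thesis
  proof cases
    case 1
    have "((\<lambda>_. 0) has_real_derivative 0) (at x)" by simp
    then have "(bump p n has_real_derivative 0) (at x)"
      by (rule has_field_derivative_transform_within_open[where S="{..<0} \<union> {1<..}"]) (use 1 in \<open>auto simp: bump_def\<close>)
    then show ?thesis using 1 by (auto simp: bump_def)
  next
    case 2
    define w where "w = x * (1 - x)"
    have w: "w > 0" using 2 by (simp add: w_def)
    have pw: "real n * (1 / w) ^ (n - Suc 0) = real n * w * (1 / w) ^ n"
      using w by (cases n) auto
    define v where "v s = 1 / (s * (1 - s))" for s :: real
    have dv: "(v has_real_derivative - ((1 - 2 * x) / w\<^sup>2)) (at x)"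
    proof -
      have "((\<lambda>s. s * (1 - s)) has_real_derivative 1 - 2 * x) (at x)"
        by (auto intro!: derivative_eq_intros)
      from DERIV_inverse'[OF this] show ?thesis
        using 2 by (simp add: v_def[abs_def] w_def inverse_eq_divide power2_eq_square)
    qed
    have vx: "v x = 1 / w" by (simp add: v_def w_def)
    have "((\<lambda>s. poly p s * v s ^ n * exp (- v s)) has_real_derivative
        (poly (pderiv p) x * (1 / w) ^ n + poly p x * (real n * (1 / w) ^ (n - Suc 0) * (- ((1 - 2 * x) / w\<^sup>2)))) * exp (- (1 / w))
        + poly p x * (1 / w) ^ n * (exp (- (1 / w)) * ((1 - 2 * x) / w\<^sup>2))) (at x)"
      by (rule derivative_eq_intros dv poly_DERIV refl)+ (simp add: vx algebra_simps)
    also have "(poly (pderiv p) x * (1 / w) ^ n + poly p x * (real n * (1 / w) ^ (n - Suc 0) * (- ((1 - 2 * x) / w\<^sup>2)))) * exp (- (1 / w))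
        + poly p x * (1 / w) ^ n * (exp (- (1 / w)) * ((1 - 2 * x) / w\<^sup>2)) = bump (bump_step p n) (n + 2) x"
    proof -
      have "poly (bump_step p n) x = poly (pderiv p) x * w\<^sup>2 - real n * poly p x * (1 - 2 * x) * w + poly p x * (1 - 2 * x)"
        by (simp add: bump_step_def w_def algebra_simps)
      moreover have "bump (bump_step p n) (n + 2) x = poly (bump_step p n) x * ((1 / w) ^ n * (1 / w)\<^sup>2) * exp (- (1 / w))"
        unfolding power_add[symmetric] using 2 by (simp add: bump_def w_def)
      ultimately have "bump (bump_step p n) (n + 2) x = (poly (pderiv p) x * w\<^sup>2 - real n * poly p x * (1 - 2 * x) * w + poly p x * (1 - 2 * x))
         * ((1 / w) ^ n * (1 / w)\<^sup>2) * exp (- (1 / w))"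
        by simp
      also have "\<dots> = ((poly (pderiv p) x * w\<^sup>2 - real n * poly p x * (1 - 2 * x) * w + poly p x * (1 - 2 * x)) / w\<^sup>2)
         * (1 / w) ^ n * exp (- (1 / w))" by (simp add: power_divide)
      also have "(poly (pderiv p) x * w\<^sup>2 - real n * poly p x * (1 - 2 * x) * w + poly p x * (1 - 2 * x)) / w\<^sup>2
         = poly (pderiv p) x - real n * w * poly p x * ((1 - 2 * x) / w\<^sup>2) + poly p x * ((1 - 2 * x) / w\<^sup>2)"
        using w by (simp add: field_simps power2_eq_square)
      finally show ?thesis unfolding pw by (simp add: algebra_simps)
    qed
    finally have "((\<lambda>s. poly p s * v s ^ n * exp (- v s)) has_real_derivative
        bump (bump_step p n) (n + 2) x) (at x)" .
    then show ?thesis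
      by (rule has_field_derivative_transform_within_open[where S="{0<..<1}"]) (use 2 in \<open>auto simp: bump_def v_def\<close>)
  next
    case 3
    have "compact (poly p ` {0..1})" by (intro compact_continuous_image continuous_intros compact_Icc)
    then obtain B where B: "\<And>s. 0 \<le> s \<Longrightarrow> s \<le> 1 \<Longrightarrow> \<bar>poly p s\<bar> \<le> B"
      by (metis compact_imp_bounded bounded_iff image_eqI atLeastAtMost_iff real_norm_def)
    have B0: "B \<ge> 0" using B[of 0] abs_ge_zero[of "poly p 0"] by linarith
    have "\<bar>bump p n s - bump p n x\<bar> \<le> (B * real (n + 2) ^ (n + 2)) * (s - x)\<^sup>2" for s
    proof (cases "0 < s \<and> s < 1")
      case True
      define w where "w = s * (1 - s)"
      have w: "w > 0" using True by (simp add: w_def)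
      have "w \<le> \<bar>s - x\<bar>" using 3 True unfolding w_def by (auto simp: mult_left_le mult_left_le_one_le)
      then have w2: "w\<^sup>2 \<le> (s - x)\<^sup>2" using w by (metis abs_of_pos abs_le_square_iff)
      have "\<bar>bump p n s - bump p n x\<bar> = \<bar>poly p s\<bar> * ((1 / w) ^ n * exp (- (1 / w)))"
        using True 3 w by (auto simp: bump_def w_def abs_mult)
      also have "\<dots> \<le> B * (real (n + 2) ^ (n + 2) * w\<^sup>2)"
        using B[of s] True B0 w by (intro mult_mono exp_flat) auto
      also have "\<dots> \<le> B * (real (n + 2) ^ (n + 2) * (s - x)\<^sup>2)"
        using B0 w2 by (intro mult_left_mono) auto
      finally show ?thesis by simp
    qed (use 3 B0 in \<open>auto simp: bump_def\<close>)
    then have "(bump p n has_real_derivative 0) (at x)" by (rule DERIV_zero_if_quadratic)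
    then show ?thesis using 3 by (auto simp: bump_def)
  qed
qed

primrec bump_poly :: "nat \<Rightarrow> real poly" where
  "bump_poly 0 = 1"
| "bump_poly (Suc k) = bump_step (bump_poly k) (2 * k)"

lemma bump_poly_derivative:
  "(bump (bump_poly k) (2 * k) has_real_derivative bump (bump_poly (Suc k)) (2 * Suc k) x) (at x)"
  using bump_derivative[of "bump_poly k" "2 * k"] by simp

lemma real_antiderivative:
  fixes f :: "real \<Rightarrow> real"
  assumes "continuous_on UNIV f"
  shows "\<exists>F. \<forall>x. (F has_real_derivative f x) (at x)"
proof -
  have "\<exists>F. \<forall>x. (- \<infinity>) < ereal x \<longrightarrow> ereal x < \<infinity> \<longrightarrow> (F has_vector_derivative f x) (at x)"
    using assms by (intro einterval_antiderivative) (auto simp: continuous_on_eq_continuous_at)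
  then show ?thesis by (simp add: has_real_derivative_iff_has_vector_derivative)
qed

text \<open>
  \<open>G 0\<close> is a smooth step from \<open>0\<close> to \<open>1\<close> and \<open>G r\<close> is its \<open>r\<close>-th derivative. The integer translates of
  a difference \<open>G 0 s - G 0 (s - 1)\<close> telescope to \<open>1\<close>; the assumption on \<open>G 1\<close> makes the translates of the
  derivative telescope as well, so that both kinds of factors of an edge weight are partitions of unity.
\<close>

locale smooth_step =
  fixes G :: "nat \<Rightarrow> real \<Rightarrow> real" and \<sigma> :: "real \<Rightarrow> real"
  assumes G_derivative: "\<And>r s. (G r has_real_derivative G (Suc r) s) (at s)"
    and G_low: "\<And>s. s \<le> 0 \<Longrightarrow> G 0 s = 0" and G_high: "\<And>s. 2 \<le> s \<Longrightarrow> G 0 s = 1"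
    and G_mono: "mono (G 0)" and G1: "\<And>s. G (Suc 0) s = \<sigma> s - \<sigma> (s - 1)"
    and \<sigma>_mono: "mono \<sigma>" and \<sigma>_low: "\<And>s. s \<le> 0 \<Longrightarrow> \<sigma> s = 0" and \<sigma>_high: "\<And>s. 1 \<le> s \<Longrightarrow> \<sigma> s = 1"

lemma mono_if_DERIV_nonneg:
  assumes "\<And>s. (f has_real_derivative f' s) (at s)" "\<And>s. f' s \<ge> 0"
  shows "mono f"
  using assms by (intro monoI DERIV_nonneg_imp_nondecreasing[of _ _ f]) auto

text \<open>
  Normalize the antiderivative of a bump to a monotone step \<open>\<sigma>\<close>, and let \<open>G 0\<close> be the average of \<open>\<sigma>\<close>
  over \<open>[s - 1, s]\<close>: this is a difference of values of an antiderivative \<open>S\<close> of \<open>\<sigma>\<close>, so its derivative has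
  the required form.
\<close>

lemma ex_smooth_step: "\<exists>G \<sigma>. smooth_step G \<sigma>"
proof -
  define b where "b k = bump (bump_poly k) (2 * k)" for k
  have b_der: "(b k has_real_derivative b (Suc k) s) (at s)" for k s
    unfolding b_def by (rule bump_poly_derivative)
  have b_nonneg: "b 0 s \<ge> 0" for s by (simp add: b_def bump_def)
  have b_cont: "continuous_on UNIV (b k)" for k
    using b_der by (meson DERIV_isCont continuous_at_imp_continuous_on)
  obtain \<sigma>0 where \<sigma>0: "\<And>s. (\<sigma>0 has_real_derivative b 0 s) (at s)"
    using real_antiderivative[OF b_cont] by blast
  have const: "f x = f y" if der: "\<And>s. (f has_real_derivative f' s) (at s)"
     and zero: "\<And>s. a < s \<Longrightarrow> s < c \<Longrightarrow> f' s = 0" and xy: "a \<le> x" "x < y" "y \<le> c" for f f' :: "real \<Rightarrow> real" and a c x y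
  proof -
    obtain z where "x < z" "z < y" "f y - f x = (y - x) * f' z"
      using MVT2[of x y f f'] der xy(2) by auto
    then show ?thesis using zero[of z] xy by simp
  qed
  have low0: "\<sigma>0 s = \<sigma>0 0" if "s \<le> 0" for s
    using const[of \<sigma>0 "b 0" s 0 s 0] \<sigma>0 that by (cases "s = 0") (auto simp: b_def bump_def)
  have high0: "\<sigma>0 s = \<sigma>0 1" if "1 \<le> s" for s
    using const[of \<sigma>0 "b 0" 1 s 1 s] \<sigma>0 that by (cases "s = 1") (auto simp: b_def bump_def)
  obtain z where z: "0 < z" "z < 1" "\<sigma>0 1 - \<sigma>0 0 = (1 - 0) * b 0 z" using MVT2[of 0 1 \<sigma>0 "b 0"] \<sigma>0 by auto
  define m where "m = \<sigma>0 1 - \<sigma>0 0"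
  have m: "m > 0" using z by (simp add: m_def b_def bump_def)
  define \<sigma> where "\<sigma> s = (\<sigma>0 s - \<sigma>0 0) / m" for s
  have \<sigma>_der: "(\<sigma> has_real_derivative b 0 s / m) (at s)" for s
    unfolding \<sigma>_def[abs_def] using m by (auto intro!: derivative_eq_intros \<sigma>0)
  have \<sigma>_mono: "mono \<sigma>" using \<sigma>_der b_nonneg m by (intro mono_if_DERIV_nonneg[of \<sigma>]) auto
  have \<sigma>_low: "\<sigma> s = 0" if "s \<le> 0" for s using low0[OF that] by (simp add: \<sigma>_def)
  have \<sigma>_high: "\<sigma> s = 1" if "s \<ge> 1" for s using high0[OF that] m by (simp add: \<sigma>_def m_def)
  have "continuous_on UNIV \<sigma>" using \<sigma>_der by (meson DERIV_isCont continuous_at_imp_continuous_on)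
  then obtain S where S: "\<And>s. (S has_real_derivative \<sigma> s) (at s)"
    using real_antiderivative by blast
  define g where "g r s = (case r of 0 \<Rightarrow> S s | Suc 0 \<Rightarrow> \<sigma> s | Suc (Suc k) \<Rightarrow> b k s / m)" for r s
  have g_der: "(g r has_real_derivative g (Suc r) s) (at s)" for r s
    unfolding g_def[abs_def] using S \<sigma>_der b_der
    by (cases r; cases "r - 1") (auto split: nat.splits intro!: DERIV_cdivide)
  define G where "G r s = g r s - g r (s - 1)" for r s
  have G_der: "(G r has_real_derivative G (Suc r) s) (at s)" for r s
    unfolding G_def[abs_def]
    using DERIV_diff[OF g_der[of r s] DERIV_chain'[OF DERIV_diff[OF DERIV_ident DERIV_const[of 1]] g_der[of r "s - 1"]]] by simp
  have G1: "G (Suc 0) s = \<sigma> s - \<sigma> (s - 1)" for s by (simp add: G_def g_def)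
  have G0: "G 0 s = S s - S (s - 1)" for s by (simp add: G_def g_def)
  have Gm: "mono (G 0)"
    using G_der[of 0] G1 \<sigma>_mono by (intro mono_if_DERIV_nonneg[of "G 0" "G (Suc 0)"]) (auto simp: mono_def)
  have Gl: "G 0 s = 0" if "s \<le> 0" for s
  proof -
    obtain z where "s - 1 < z" "z < s" "S s - S (s - 1) = (s - (s - 1)) * \<sigma> z" using MVT2[of "s - 1" s S \<sigma>] S by auto
    then show ?thesis using that \<sigma>_low[of z] by (simp add: G0)
  qed
  have Gh: "G 0 s = 1" if "2 \<le> s" for s
  proof -
    obtain z where "s - 1 < z" "z < s" "S s - S (s - 1) = (s - (s - 1)) * \<sigma> z" using MVT2[of "s - 1" s S \<sigma>] S by auto
    then show ?thesis using that \<sigma>_high[of z] by (simp add: G0)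
  qed
  have "smooth_step G \<sigma>"
    by unfold_locales (use G_der G1 Gm Gl Gh \<sigma>_mono \<sigma>_low \<sigma>_high in auto)
  then show ?thesis by blast
qed

section \<open>Products of one-dimensional functions\<close>

lemma product_has_derivative:
  fixes H :: "'n::finite \<Rightarrow> nat \<Rightarrow> real \<Rightarrow> real"
  assumes H: "\<And>j r s. (H j r has_real_derivative H j (Suc r) s) (at s)"
  shows "((\<lambda>y. \<Prod>j\<in>UNIV. H j (m j) (y $ j)) has_derivative
     (\<lambda>h. \<Sum>i\<in>UNIV. h $ i * H i (Suc (m i)) (x $ i) * (\<Prod>j\<in>UNIV - {i}. H j (m j) (x $ j)))) (at x)"
proof (rule has_derivative_prod)
  fix i :: 'n
  show "((\<lambda>y. H i (m i) (y $ i)) has_derivative (\<lambda>h. h $ i * H i (Suc (m i)) (x $ i))) (at x)"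
  proof -
    have "((\<lambda>y. y $ i) has_derivative (\<lambda>h. h $ i)) (at x)"
      using bounded_linear_vec_nth by (rule bounded_linear_imp_has_derivative)
    note 1 = this
    have "(H i (m i) has_derivative (\<lambda>h. h * H i (Suc (m i)) (x $ i))) (at (x $ i))"
    proof -
      have "(\<lambda>h. h * H i (Suc (m i)) (x $ i)) = (*) (H i (Suc (m i)) (x $ i))"
        by (simp add: fun_eq_iff mult.commute)
      then show ?thesis using H[of i "m i" "x $ i"] by (simp only: has_field_derivative_def)
    qed
    from has_derivative_compose[OF 1 this] show ?thesis .
  qed
qed

lemma product_partial:
  fixes H :: "'n::finite \<Rightarrow> nat \<Rightarrow> real \<Rightarrow> real"
  assumes H: "\<And>j r s. (H j r has_real_derivative H j (Suc r) s) (at s)"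
  shows "frechet_derivative (\<lambda>y. \<Prod>j\<in>UNIV. H j (m j) (y $ j)) (at x) (axis i 1)
    = (\<Prod>j\<in>UNIV. H j ((m(i := Suc (m i))) j) (x $ j))"
proof -
  have "frechet_derivative (\<lambda>y. \<Prod>j\<in>UNIV. H j (m j) (y $ j)) (at x) =
     (\<lambda>h. \<Sum>i\<in>UNIV. h $ i * H i (Suc (m i)) (x $ i) * (\<Prod>j\<in>UNIV - {i}. H j (m j) (x $ j)))"
    by (rule frechet_derivative_at[OF product_has_derivative[where H = H, OF H], symmetric])
  then have "frechet_derivative (\<lambda>y. \<Prod>j\<in>UNIV. H j (m j) (y $ j)) (at x) (axis i 1)
    = (\<Sum>k\<in>UNIV. if k = i then H i (Suc (m i)) (x $ i) * (\<Prod>j\<in>UNIV - {i}. H j (m j) (x $ j)) else 0)"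
    by (simp only:) (auto intro!: sum.cong simp: axis_def simp del: sum.delta)
  also have "\<dots> = H i (Suc (m i)) (x $ i) * (\<Prod>j\<in>UNIV - {i}. H j (m j) (x $ j))" by simp
  also have "\<dots> = (\<Prod>j\<in>UNIV. H j ((m(i := Suc (m i))) j) (x $ j))"
    by (subst prod.remove[of UNIV i]) (auto intro!: prod.cong)
  finally show ?thesis .
qed

text \<open>
  Every partial derivative raises the order of one factor, so all iterated partial derivatives are
  products of the same kind.
\<close>

lemma product_smooth:
  fixes H :: "'n::finite \<Rightarrow> nat \<Rightarrow> real \<Rightarrow> real"
  assumes H: "\<And>j r s. (H j r has_real_derivative H j (Suc r) s) (at s)"
  shows "smooth (\<lambda>y :: real ^ 'n. \<Prod>j\<in>UNIV. H j 0 (y $ j))"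
proof -
  have "\<exists>m. iterated_partial bs (\<lambda>y :: real ^ 'n. \<Prod>j\<in>UNIV. H j 0 (y $ j)) = (\<lambda>y. \<Prod>j\<in>UNIV. H j (m j) (y $ j))"
    if "bs \<in> lists Basis" for bs
    using that
  proof (induction bs)
    case Nil
    show ?case by (intro exI[of _ "\<lambda>_. 0"]) simp
  next
    case (Cons b bs)
    then obtain m where m: "iterated_partial bs (\<lambda>y :: real ^ 'n. \<Prod>j\<in>UNIV. H j 0 (y $ j)) = (\<lambda>y. \<Prod>j\<in>UNIV. H j (m j) (y $ j))"
      by auto
    from Cons obtain i where "b = axis i 1" by (auto simp: Basis_vec_def)
    then show ?case
      using m product_partial[where H = H, OF H, of m _ i] by (intro exI[of _ "m(i := Suc (m i))"]) (simp only: iterated_partial.simps)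
  qed
  note iterated = this
  show ?thesis
    unfolding smooth_def
  proof (intro ballI allI)
    fix bs :: "(real ^ 'n) list" and x
    assume "bs \<in> lists Basis"
    from iterated[OF this] obtain m
      where m: "iterated_partial bs (\<lambda>y :: real ^ 'n. \<Prod>j\<in>UNIV. H j 0 (y $ j)) = (\<lambda>y. \<Prod>j\<in>UNIV. H j (m j) (y $ j))"
      by blast
    show "iterated_partial bs (\<lambda>y. \<Prod>j\<in>UNIV. H j 0 (y $ j)) differentiable at x"
      unfolding m by (rule differentiableI[OF product_has_derivative[where H = H, OF H]])
  qed
qed


section \<open>Integrals against finite signed measures\<close>

locale finite_signed_measure =
  fixes \<mu> :: "'a::topological_space set \<Rightarrow> real" and m :: real
  assumes bvm: "borel_vector_measure \<mu>" and m_bound: "\<And>B. B \<in> sets borel \<Longrightarrow> \<bar>\<mu> B\<bar> \<le> m"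
begin

lemma m_nonneg: "m \<ge> 0"
  using m_bound[of "{}"] by simp

lemma emeasure_positive_part_le: "emeasure (positive_part \<mu>) UNIV \<le> ennreal m"
  using m_bound by (subst emeasure_positive_part[OF bvm]) (auto intro!: SUP_least ennreal_leI dest: abs_le_D1)

lemma uminus_measure: "finite_signed_measure (\<lambda>A. - \<mu> A) m"
  using bvm m_bound by unfold_locales (auto simp: borel_vector_measure_def intro: sums_minus)

lemma emeasure_negative_part_le: "emeasure (negative_part \<mu>) UNIV \<le> ennreal m"
  unfolding negative_part_def by (rule finite_signed_measure.emeasure_positive_part_le[OF uminus_measure])

lemma sets_negative_part [simp]: "sets (negative_part \<mu>) = sets borel"
  and space_negative_part [simp]: "space (negative_part \<mu>) = UNIV"
  by (simp_all add: negative_part_def)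

lemma finite_parts: "finite_measure (positive_part \<mu>)" "finite_measure (negative_part \<mu>)"
  using emeasure_positive_part_le emeasure_negative_part_le
  by (auto intro!: finite_measureI simp: top_unique)

lemma measure_parts_le: "measure (positive_part \<mu>) UNIV \<le> m" "measure (negative_part \<mu>) UNIV \<le> m"
  using emeasure_positive_part_le emeasure_negative_part_le m_nonneg
  by (auto simp: measure_def intro: enn2real_leI)

lemma integrable_parts:
  fixes f :: "'a \<Rightarrow> real"
  assumes "f \<in> borel_measurable borel" "\<And>x. \<bar>f x\<bar> \<le> K"
  shows "integrable (positive_part \<mu>) f" "integrable (negative_part \<mu>) f"
proof -
  have "f \<in> borel_measurable (positive_part \<mu>)" "f \<in> borel_measurable (negative_part \<mu>)"
    using assms(1) by (simp_all cong: measurable_cong_sets)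
  then show "integrable (positive_part \<mu>) f" "integrable (negative_part \<mu>) f"
    using assms(2) by (auto intro!: finite_measure.integrable_const_bound[OF finite_parts(1), of f K]
        finite_measure.integrable_const_bound[OF finite_parts(2), of f K])
qed

lemma signed_integral_sum:
  fixes f :: "'i \<Rightarrow> 'a \<Rightarrow> real"
  assumes "\<And>i. i \<in> I \<Longrightarrow> f i \<in> borel_measurable borel" "\<And>i x. i \<in> I \<Longrightarrow> \<bar>f i x\<bar> \<le> K i"
  shows "signed_integral \<mu> (\<lambda>x. \<Sum>i\<in>I. c i * f i x) = (\<Sum>i\<in>I. c i * signed_integral \<mu> (f i))"
proof -
  have "integrable (positive_part \<mu>) (f i)" "integrable (negative_part \<mu>) (f i)" if "i \<in> I" for i
    using integrable_parts[of "f i" "K i"] assms that by auto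
  then show ?thesis
    by (simp add: signed_integral_def Bochner_Integration.integral_sum right_diff_distrib sum_subtractf)
qed

lemma signed_integral_diff:
  assumes "f \<in> borel_measurable borel" "\<And>x. \<bar>f x\<bar> \<le> K" "g \<in> borel_measurable borel" "\<And>x. \<bar>g x\<bar> \<le> L"
  shows "signed_integral \<mu> (\<lambda>x. f x - g x) = signed_integral \<mu> f - signed_integral \<mu> g"
  using integrable_parts[OF assms(1,2)] integrable_parts[OF assms(3,4)]
  by (simp add: signed_integral_def)

text \<open>
  Integrals of a nonnegative subpartition of unity: the total mass of the discretized flow
  is controlled by the masses of the two Jordan parts.
\<close>

lemma sum_abs_signed_integral_le:
  fixes f :: "'i \<Rightarrow> 'a \<Rightarrow> real"
  assumes f: "\<And>i. i \<in> I \<Longrightarrow> f i \<in> borel_measurable borel" "\<And>i x. i \<in> I \<Longrightarrow> 0 \<le> f i x"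
    and sum: "\<And>x. (\<Sum>i\<in>I. f i x) \<le> 1" and I: "finite I"
  shows "(\<Sum>i\<in>I. \<bar>signed_integral \<mu> (f i)\<bar>) \<le> 2 * m"
proof -
  have "f i x \<le> 1" if "i \<in> I" for i x
    using member_le_sum[of i I "\<lambda>i. f i x"] f(2) sum[of x] I that by fastforce
  then have b: "\<bar>f i x\<bar> \<le> 1" if "i \<in> I" for i x using f(2) that by simp
  have int: "integrable (positive_part \<mu>) (f i)" "integrable (negative_part \<mu>) (f i)" if "i \<in> I" for i
    using integrable_parts[of "f i" 1] f(1) b that by auto
  have one: "(LINT x|M. (\<Sum>i\<in>I. f i x)) \<le> m"
    if "\<And>i. i \<in> I \<Longrightarrow> integrable M (f i)" "finite_measure M" "measure M UNIV \<le> m" "space M = UNIV" for M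
  proof -
    interpret M: finite_measure M by fact
    have "(LINT x|M. (\<Sum>i\<in>I. f i x)) \<le> (LINT x|M. 1)"
      using that sum by (intro integral_mono) auto
    also have "\<dots> \<le> m" using that by simp
    finally show ?thesis .
  qed
  have "(\<Sum>i\<in>I. \<bar>signed_integral \<mu> (f i)\<bar>) \<le> (\<Sum>i\<in>I. (LINT x|positive_part \<mu>. f i x) + (LINT x|negative_part \<mu>. f i x))"
  proof (rule sum_mono)
    fix i assume i: "i \<in> I"
    have "0 \<le> (LINT x|positive_part \<mu>. f i x)" "0 \<le> (LINT x|negative_part \<mu>. f i x)"
      using f(2)[OF i] by (auto intro: integral_nonneg)
    then show "\<bar>signed_integral \<mu> (f i)\<bar> \<le> (LINT x|positive_part \<mu>. f i x) + (LINT x|negative_part \<mu>. f i x)"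
      by (simp add: signed_integral_def)
  qed
  also have "\<dots> = (LINT x|positive_part \<mu>. (\<Sum>i\<in>I. f i x)) + (LINT x|negative_part \<mu>. (\<Sum>i\<in>I. f i x))"
    using int by (simp add: sum.distrib Bochner_Integration.integral_sum)
  also have "\<dots> \<le> m + m"
    using int finite_parts measure_parts_le by (intro add_mono one) auto
  finally show ?thesis by simp
qed

lemma signed_integral_tendsto:
  fixes f :: "nat \<Rightarrow> 'a \<Rightarrow> real"
  assumes "\<And>n. f n \<in> borel_measurable borel" "g \<in> borel_measurable borel"
    and "\<And>x. (\<lambda>n. f n x) \<longlonglongrightarrow> g x" "\<And>n x. \<bar>f n x\<bar> \<le> K"
  shows "(\<lambda>n. signed_integral \<mu> (f n)) \<longlonglongrightarrow> signed_integral \<mu> g"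
proof -
  have "(\<lambda>n. LINT x|M. f n x) \<longlonglongrightarrow> (LINT x|M. g x)" if "sets M = sets borel" "finite_measure M" for M
  proof (rule integral_dominated_convergence[where w="\<lambda>_. K"])
    interpret M: finite_measure M by fact
    show "g \<in> borel_measurable M" "\<And>i. f i \<in> borel_measurable M"
      using assms that by (simp_all cong: measurable_cong_sets)
    show "integrable M (\<lambda>_. K)" by simp
  qed (use assms in auto)
  then show ?thesis
    unfolding signed_integral_def using finite_parts by (intro tendsto_diff) auto
qed

end

lemma component_bound_total_variation:
  fixes F :: "'a::topological_space set \<Rightarrow> 'b::euclidean_space"
  assumes F: "borel_vector_measure F" and tv: "total_variation F UNIV = ennreal T" "T \<ge> 0" and b: "norm b \<le> 1"
  shows "finite_signed_measure (\<lambda>A. F A \<bullet> b) T"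
proof
  show "borel_vector_measure (\<lambda>A. F A \<bullet> b)"
    using F unfolding borel_vector_measure_def by (auto intro: bounded_linear.sums[OF bounded_linear_inner_left])
  fix B :: "'a set" assume B: "B \<in> sets borel"
  have "ennreal (norm (F B)) \<le> total_variation F UNIV"
  proof -
    let ?A = "binaryset B (- B)"
    have A: "range ?A \<subseteq> sets borel" "disjoint_family ?A" "(\<Union>i. ?A i) = UNIV"
      using B by (auto simp: binaryset_def disjoint_family_on_def UN_binaryset_eq)
    have "ennreal (norm (F B)) = (\<Sum>i\<in>{0}. ennreal (norm (F (?A i))))" by (simp add: binaryset_def)
    also have "\<dots> \<le> (\<Sum>i. ennreal (norm (F (?A i))))" by (intro sum_le_suminf) auto
    also have "\<dots> \<le> total_variation F UNIV"
      unfolding total_variation_def using A by (intro SUP_upper) auto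
    finally show ?thesis .
  qed
  then have "norm (F B) \<le> T" using tv by simp
  moreover have "\<bar>F B \<bullet> b\<bar> \<le> norm (F B) * norm b" by (rule Cauchy_Schwarz_ineq2)
  moreover have "norm (F B) * norm b \<le> norm (F B) * 1" using b by (intro mult_left_mono) auto
  ultimately show "\<bar>F B \<bullet> b\<bar> \<le> T" by linarith
qed

lemma sum_Basis_vec: "(\<Sum>b\<in>(Basis :: (real ^ 'n) set). g b) = (\<Sum>i\<in>UNIV. g (axis i 1))"
proof -
  have "(Basis :: (real ^ 'n) set) = range (\<lambda>i. axis i 1)" by (auto simp: Basis_vec_def)
  moreover have "inj (\<lambda>i :: 'n. axis i (1::real))" by (auto intro!: injI simp: axis_eq_axis)
  note sum.reindex[OF this, of g]
  ultimately show ?thesis by (simp only: o_def)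
qed

section \<open>Lattice approximation of divergence-free measures\<close>

definition grid_box :: "nat \<Rightarrow> (int ^ 'n) set" where
  "grid_box N = {a. \<forall>j. \<bar>a $ j\<bar> \<le> int N}"

lemma sum_grid_box_prod:
  fixes q :: "'n::finite \<Rightarrow> int \<Rightarrow> real"
  shows "(\<Sum>a\<in>grid_box N. \<Prod>j\<in>UNIV. q j (a $ j)) = (\<Prod>j\<in>UNIV. \<Sum>k\<in>{- int N..int N}. q j k)"
proof -
  have "(\<Prod>j\<in>UNIV. \<Sum>k\<in>{- int N..int N}. q j k) = (\<Sum>g\<in>Pi\<^sub>E UNIV (\<lambda>_. {- int N..int N}). \<Prod>j\<in>UNIV. q j (g j))"
    by (rule prod_sum_PiE) auto
  also have "\<dots> = (\<Sum>a\<in>grid_box N. \<Prod>j\<in>UNIV. q j (a $ j))"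
    by (rule sum.reindex_bij_witness[of _ "vec_nth" "vec_lambda"])
       (auto simp: grid_box_def PiE_iff abs_le_iff minus_le_iff)
  finally show ?thesis by simp
qed

lemma finite_grid_box: "finite (grid_box N :: (int ^ 'n) set)"
proof -
  have "grid_box N \<subseteq> vec_lambda ` (Pi\<^sub>E (UNIV :: 'n set) (\<lambda>_. {- int N..int N}))"
  proof
    fix a :: "int ^ 'n" assume "a \<in> grid_box N"
    then have "vec_nth a \<in> Pi\<^sub>E UNIV (\<lambda>_. {- int N..int N})" by (auto simp: grid_box_def PiE_iff abs_le_iff minus_le_iff)
    then show "a \<in> vec_lambda ` (Pi\<^sub>E (UNIV :: 'n set) (\<lambda>_. {- int N..int N}))" by (metis image_eqI vec_nth_inverse)
  qed
  then show ?thesis by (rule finite_subset) (auto intro!: finite_imageI finite_PiE)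
qed

lemma sum_int_telescope:
  fixes q :: "int \<Rightarrow> real"
  shows "(\<Sum>k\<in>{a..<a + int n}. q k - q (k + 1)) = q a - q (a + int n)"
proof (induction n)
  case (Suc n)
  have "{a..<a + int (Suc n)} = insert (a + int n) {a..<a + int n}" by auto
  then show ?case using Suc by (simp add: add_ac)
qed simp

text \<open>
  Translates \<open>G r (s - k)\<close> of a step and its derivatives for lattice points \<open>k\<close> inside the box, continued
  by \<open>lo\<close> and \<open>hi\<close> beyond its ends. The continuation identifies all lattice points outside the box with
  points of its boundary, so that the network becomes finite and stays conservative.
\<close>

definition ramp :: "(nat \<Rightarrow> real \<Rightarrow> real) \<Rightarrow> (nat \<Rightarrow> real \<Rightarrow> real) \<Rightarrow> (nat \<Rightarrow> real \<Rightarrow> real) \<Rightarrow> nat \<Rightarrow> int \<Rightarrow> nat \<Rightarrow> real \<Rightarrow> real" where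
  "ramp G lo hi N k r s = (if k \<le> - int N then lo r s else if k > int N then hi r s else G r (s - real_of_int k))"

text \<open>
  The weight of the one-dimensional lattice point \<open>k\<close>, and its derivatives; it vanishes outside the box.
\<close>

definition hat where
  "hat G lo hi N k r s = ramp G lo hi N k r s - ramp G lo hi N (k + 1) r s"

text \<open>
  The weight of the edge that leads from \<open>a - axis i 1\<close> to \<open>a\<close>.
\<close>

definition edge_weight where
  "edge_weight G lo hi N \<epsilon> a i (y :: real ^ 'n) = (\<Prod>j\<in>UNIV.
     if j = i then ramp G lo hi N (a $ j) 1 (y $ j / \<epsilon>) else hat G lo hi N (a $ j) 0 (y $ j / \<epsilon>))"

definition vertex_weight where
  "vertex_weight G lo hi N \<epsilon> a (y :: real ^ 'n) = (\<Prod>j\<in>UNIV. hat G lo hi N (a $ j) 0 (y $ j / \<epsilon>))"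

text \<open>
  The gradient of a vertex weight is the incoming minus the outgoing edge weight, up to the
  factor \<open>1 / \<epsilon>\<close>, because only the \<open>i\<close>-th factor is differentiated and that factor is a difference of
  ramps. This turns the divergence of \<open>F\<close> into the net flux at a lattice point.
\<close>

lemma vertex_weight_calculus:
  assumes der: "\<And>r s. (G r has_real_derivative G (Suc r) s) (at s)"
     "\<And>r s. (lo r has_real_derivative lo (Suc r) s) (at s)"
     "\<And>r s. (hi r has_real_derivative hi (Suc r) s) (at s)"
    and \<epsilon>: "\<epsilon> > 0"
  shows "smooth (vertex_weight G lo hi N \<epsilon> a)"
    and "frechet_derivative (vertex_weight G lo hi N \<epsilon> a) (at y) (axis i 1)
      = 1 / \<epsilon> * (edge_weight G lo hi N \<epsilon> a i y - edge_weight G lo hi N \<epsilon> (a + axis i 1) i y)"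
proof -
  define H where "H j r s = hat G lo hi N (a $ j) r (s / \<epsilon>) / \<epsilon> ^ r" for j r s
  have ramp_der: "(ramp G lo hi N k r has_real_derivative ramp G lo hi N k (Suc r) s) (at s)" for k r s
  proof -
    have "((\<lambda>s. G r (s - real_of_int k)) has_real_derivative G (Suc r) (s - real_of_int k)) (at s)"
      using der(1)[of r "s + - real_of_int k"] unfolding DERIV_shift by simp
    then show ?thesis using der(2,3) unfolding ramp_def[abs_def] by auto
  qed
  have H: "(H j r has_real_derivative H j (Suc r) s) (at s)" for j r s
  proof -
    have hat_der: "(hat G lo hi N k r has_real_derivative hat G lo hi N k (Suc r) s) (at s)" for k s
      unfolding hat_def[abs_def] by (intro DERIV_diff ramp_der)
    have "((\<lambda>s. hat G lo hi N (a $ j) r (s / \<epsilon>)) has_real_derivative (1 / \<epsilon>) * hat G lo hi N (a $ j) (Suc r) (s / \<epsilon>)) (at s)"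
      using DERIV_chain2[OF hat_der DERIV_cdivide[OF DERIV_ident]] by (simp add: mult.commute)
    from DERIV_cdivide[OF this, of "\<epsilon> ^ r"] show ?thesis unfolding H_def[abs_def] by simp
  qed
  have eq: "vertex_weight G lo hi N \<epsilon> a = (\<lambda>y. \<Prod>j\<in>UNIV. H j 0 (y $ j))"
    by (simp add: vertex_weight_def[abs_def] H_def)
  show "smooth (vertex_weight G lo hi N \<epsilon> a)"
    unfolding eq by (rule product_smooth[where H = H, OF H])
  define R where "R = (\<Prod>j\<in>UNIV - {i}. hat G lo hi N (a $ j) 0 (y $ j / \<epsilon>))"
  have "frechet_derivative (vertex_weight G lo hi N \<epsilon> a) (at y) (axis i 1) = (\<Prod>j\<in>UNIV. H j (((\<lambda>_. 0)(i := Suc 0)) j) (y $ j))"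
    unfolding eq using product_partial[where H = H and m = "\<lambda>_. 0", OF H] by simp
  also have "\<dots> = H i 1 (y $ i) * (\<Prod>j\<in>UNIV - {i}. H j (((\<lambda>_. 0)(i := Suc 0)) j) (y $ j))"
    by (subst prod.remove[of UNIV i]) auto
  also have "(\<Prod>j\<in>UNIV - {i}. H j (((\<lambda>_. 0)(i := Suc 0)) j) (y $ j)) = R"
    unfolding R_def by (intro prod.cong) (auto simp: H_def)
  finally have lhs: "frechet_derivative (vertex_weight G lo hi N \<epsilon> a) (at y) (axis i 1) = H i 1 (y $ i) * R" .
  have w1: "edge_weight G lo hi N \<epsilon> a i y = ramp G lo hi N (a $ i) 1 (y $ i / \<epsilon>) * R"
    unfolding edge_weight_def R_def by (subst prod.remove[of UNIV i]) (auto intro!: prod.cong)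
  have w2: "edge_weight G lo hi N \<epsilon> (a + axis i 1) i y = ramp G lo hi N (a $ i + 1) 1 (y $ i / \<epsilon>) * R"
    unfolding edge_weight_def R_def by (subst prod.remove[of UNIV i]) (auto intro!: prod.cong simp: axis_def)
  show "frechet_derivative (vertex_weight G lo hi N \<epsilon> a) (at y) (axis i 1)
      = 1 / \<epsilon> * (edge_weight G lo hi N \<epsilon> a i y - edge_weight G lo hi N \<epsilon> (a + axis i 1) i y)"
    unfolding lhs w1 w2 by (simp add: H_def hat_def left_diff_distrib diff_divide_distrib)
qed

text \<open>
  The continuation whose vertex weights form a partition of unity on the whole space. Those on the boundary
  of the box have unbounded support.
\<close>

definition unit_lo :: "nat \<Rightarrow> real \<Rightarrow> real" where "unit_lo r s = (if r = 0 then 1 else 0)"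
definition unit_hi :: "nat \<Rightarrow> real \<Rightarrow> real" where "unit_hi r s = 0"

context smooth_step
begin

text \<open>
  A continuation with compactly supported vertex weights: the constants \<open>1\<close> and \<open>0\<close> are replaced by steps far
  away at \<open>- M\<close> and \<open>M\<close>, which disappear as \<open>M\<close> tends to infinity.
\<close>

definition cut_lo :: "nat \<Rightarrow> nat \<Rightarrow> real \<Rightarrow> real" where "cut_lo M r s = G r (s + real M)"
definition cut_hi :: "nat \<Rightarrow> nat \<Rightarrow> real \<Rightarrow> real" where "cut_hi M r s = G r (s - real M)"

lemma cut_derivative:
  "(cut_lo M r has_real_derivative cut_lo M (Suc r) s) (at s)"
  "(cut_hi M r has_real_derivative cut_hi M (Suc r) s) (at s)"
  unfolding cut_lo_def[abs_def] cut_hi_def[abs_def]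
  using G_derivative[of r "s + real M"] G_derivative[of r "s + - real M"] unfolding DERIV_shift by simp_all

lemma G_continuous: "continuous_on UNIV (G r)"
  using G_derivative by (meson DERIV_isCont continuous_at_imp_continuous_on)

lemma G0_bounds: "0 \<le> G 0 s" "G 0 s \<le> 1"
  using monoD[OF G_mono, of "min 0 s" s] G_low[of "min 0 s"] monoD[OF G_mono, of s "max 2 s"] G_high[of "max 2 s"] by auto

lemma \<sigma>_bounds: "0 \<le> \<sigma> s" "\<sigma> s \<le> 1"
  using monoD[OF \<sigma>_mono, of "min 0 s" s] \<sigma>_low[of "min 0 s"] monoD[OF \<sigma>_mono, of s "max 1 s"] \<sigma>_high[of "max 1 s"] by auto

lemma G1_bounds: "0 \<le> G (Suc 0) s" "G (Suc 0) s \<le> 1"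
  using monoD[OF \<sigma>_mono, of "s - 1" s] \<sigma>_bounds[of s] \<sigma>_bounds[of "s - 1"] by (auto simp: G1)

lemma G1_zero: "s \<le> 0 \<or> 2 \<le> s \<Longrightarrow> G (Suc 0) s = 0"
  using \<sigma>_low[of s] \<sigma>_low[of "s - 1"] \<sigma>_high[of s] \<sigma>_high[of "s - 1"] by (auto simp: G1)

abbreviation "cut_edge M N \<epsilon> a i y \<equiv> edge_weight G (cut_lo M) (cut_hi M) N \<epsilon> a i y"
abbreviation "cell_edge N \<epsilon> a i y \<equiv> edge_weight G unit_lo unit_hi N \<epsilon> a i y"

lemma cut_bounds:
  "r \<le> 1 \<Longrightarrow> 0 \<le> ramp G (cut_lo M) (cut_hi M) N k r s \<and> ramp G (cut_lo M) (cut_hi M) N k r s \<le> 1"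
  using G0_bounds G1_bounds by (cases r) (auto simp: ramp_def cut_lo_def cut_hi_def)

lemma unit_bounds:
  "r \<le> 1 \<Longrightarrow> 0 \<le> ramp G unit_lo unit_hi N k r s \<and> ramp G unit_lo unit_hi N k r s \<le> 1"
  using G0_bounds G1_bounds by (cases r) (auto simp: ramp_def unit_lo_def unit_hi_def)

lemma abs_cut_edge_le: "\<bar>cut_edge M N \<epsilon> a i y\<bar> \<le> 1"
  unfolding edge_weight_def abs_prod
proof (rule prod_le_1)
  fix j
  show "0 \<le> \<bar>if j = i then ramp G (cut_lo M) (cut_hi M) N (a $ j) 1 (y $ j / \<epsilon>) else hat G (cut_lo M) (cut_hi M) N (a $ j) 0 (y $ j / \<epsilon>)\<bar> \<and>
     \<bar>if j = i then ramp G (cut_lo M) (cut_hi M) N (a $ j) 1 (y $ j / \<epsilon>) else hat G (cut_lo M) (cut_hi M) N (a $ j) 0 (y $ j / \<epsilon>)\<bar> \<le> 1"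
    using cut_bounds[of 1 M N "a $ j" "y $ j / \<epsilon>"] cut_bounds[of 0 M N "a $ j" "y $ j / \<epsilon>"]
      cut_bounds[of 0 M N "a $ j + 1" "y $ j / \<epsilon>"] by (auto simp: hat_def)
qed

lemma hat_unit_nonneg: "0 \<le> hat G unit_lo unit_hi N k 0 s"
  using G0_bounds monoD[OF G_mono, of "s - real_of_int (k + 1)" "s - real_of_int k"]
  by (auto simp: hat_def ramp_def unit_lo_def unit_hi_def)

lemma cell_edge_nonneg: "0 \<le> cell_edge N \<epsilon> a i y"
  unfolding edge_weight_def using unit_bounds[of 1] hat_unit_nonneg by (intro prod_nonneg) auto

lemma ramp_continuous:
  assumes "\<And>r. r \<le> 1 \<Longrightarrow> continuous_on UNIV (lo r)" "\<And>r. r \<le> 1 \<Longrightarrow> continuous_on UNIV (hi r)" "r \<le> 1"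
    and "continuous_on UNIV f"
  shows "continuous_on UNIV (\<lambda>s. ramp G lo hi N k r (f s))"
proof -
  have "continuous_on UNIV (\<lambda>s. lo r (f s))" "continuous_on UNIV (\<lambda>s. hi r (f s))" "continuous_on UNIV (\<lambda>s. G r (f s - real_of_int k))"
    by (rule continuous_on_compose2[of UNIV "lo r"] continuous_on_compose2[of UNIV "hi r"] continuous_on_compose2[of UNIV "G r"];
        use assms G_continuous in \<open>auto intro!: continuous_intros\<close>)+
  then show ?thesis by (cases "k \<le> - int N"; cases "k > int N") (simp_all add: ramp_def)
qed

lemma edge_weight_continuous:
  fixes a :: "int ^ 'n"
  assumes "\<And>r. r \<le> 1 \<Longrightarrow> continuous_on UNIV (lo r)" "\<And>r. r \<le> 1 \<Longrightarrow> continuous_on UNIV (hi r)"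
  shows "continuous_on UNIV (edge_weight G lo hi N \<epsilon> a i)"
proof -
  have "continuous_on UNIV (\<lambda>y :: real ^ 'n. if j = i then ramp G lo hi N (a $ j) 1 (y $ j / \<epsilon>) else hat G lo hi N (a $ j) 0 (y $ j / \<epsilon>))" for j
  proof -
    have c: "continuous_on UNIV (\<lambda>y :: real ^ 'n. y $ j / \<epsilon>)" unfolding divide_inverse by (intro continuous_intros)
    show ?thesis
      unfolding hat_def using ramp_continuous[where lo = lo and hi = hi, OF assms _ c, where r = 1] ramp_continuous[where lo = lo and hi = hi, OF assms _ c, where r = 0]
      by (cases "j = i") (auto intro!: continuous_on_diff)
  qed
  then show ?thesis unfolding edge_weight_def[abs_def] by (intro continuous_on_prod) auto
qed

lemma cut_edge_measurable: "cut_edge M N \<epsilon> a i \<in> borel_measurable borel"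
proof (rule borel_measurable_continuous_onI, rule edge_weight_continuous)
  show "continuous_on UNIV (cut_lo M r)" "continuous_on UNIV (cut_hi M r)" for r
    using cut_derivative by (meson DERIV_isCont continuous_at_imp_continuous_on)+
qed

lemma cell_edge_measurable: "cell_edge N \<epsilon> a i \<in> borel_measurable borel"
  by (rule borel_measurable_continuous_onI, rule edge_weight_continuous)
     (auto simp: unit_lo_def[abs_def] unit_hi_def[abs_def])

lemma cut_edge_tendsto: "(\<lambda>M. cut_edge M N \<epsilon> a i y) \<longlonglongrightarrow> cell_edge N \<epsilon> a i y"
proof -
  have ramp: "(\<lambda>M. ramp G (cut_lo M) (cut_hi M) N k r s) \<longlonglongrightarrow> ramp G unit_lo unit_hi N k r s" if "r \<le> 1" for k r s
  proof (rule tendsto_eventually)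
    obtain M0 :: nat where M0: "\<bar>s\<bar> + 2 \<le> real M0" using real_arch_simple by blast
    show "\<forall>\<^sub>F M in sequentially. ramp G (cut_lo M) (cut_hi M) N k r s = ramp G unit_lo unit_hi N k r s"
      using eventually_ge_at_top[of M0]
    proof eventually_elim
      case (elim M)
      then have M: "s \<le> real M" "2 \<le> s + real M" using M0 by linarith+
      show ?case
        using that M G_low[of "s - real M"] G_high[of "s + real M"] G1_zero[of "s - real M"] G1_zero[of "s + real M"]
        by (cases r) (auto simp: ramp_def cut_lo_def cut_hi_def unit_lo_def unit_hi_def)
    qed
  qed
  show ?thesis
    unfolding edge_weight_def hat_def
    by (intro tendsto_prod) (auto intro!: tendsto_diff ramp)
qed

text \<open>
  Far out all ramps have the same value \<open>0\<close> or \<open>1\<close>, so their differences vanish there.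
\<close>

lemma vertex_weight_test_function:
  assumes \<epsilon>: "\<epsilon> > 0"
  shows "vertex_weight G (cut_lo M) (cut_hi M) N \<epsilon> a \<in> test_functions"
proof -
  have supp: "\<bar>s\<bar> \<le> real (N + M + 3)" if "hat G (cut_lo M) (cut_hi M) N k 0 s \<noteq> 0" for k s
  proof (rule ccontr)
    assume "\<not> \<bar>s\<bar> \<le> real (N + M + 3)"
    then consider "s \<le> - real (N + M + 3)" | "s \<ge> real (N + M + 3)" by linarith
    then have "\<exists>v. \<forall>k. ramp G (cut_lo M) (cut_hi M) N k 0 s = v"
    proof cases
      case 1
      then have "ramp G (cut_lo M) (cut_hi M) N k 0 s = 0" for k
        unfolding ramp_def cut_lo_def cut_hi_def by (auto intro!: G_low)
      then show ?thesis by blast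
    next
      case 2
      then have "ramp G (cut_lo M) (cut_hi M) N k 0 s = 1" for k
        unfolding ramp_def cut_lo_def cut_hi_def by (auto intro!: G_high)
      then show ?thesis by blast
    qed
    then show False using that by (auto simp: hat_def)
  qed
  have "bounded {y. vertex_weight G (cut_lo M) (cut_hi M) N \<epsilon> a y \<noteq> 0}"
    unfolding bounded_iff
  proof (intro exI ballI)
    fix y assume "y \<in> {y. vertex_weight G (cut_lo M) (cut_hi M) N \<epsilon> a y \<noteq> 0}"
    then have "hat G (cut_lo M) (cut_hi M) N (a $ j) 0 (y $ j / \<epsilon>) \<noteq> 0" for j
      by (auto simp: vertex_weight_def)
    then have "\<bar>y $ j\<bar> \<le> \<epsilon> * real (N + M + 3)" for j using supp[of "a $ j" "y $ j / \<epsilon>"] \<epsilon> by (simp add: field_simps)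
    then have "(\<Sum>j\<in>UNIV. \<bar>y $ j\<bar>) \<le> (\<Sum>j\<in>(UNIV :: 'a set). \<epsilon> * real (N + M + 3))" by (intro sum_mono)
    then show "norm y \<le> (\<Sum>j\<in>(UNIV :: 'a set). \<epsilon> * real (N + M + 3))" using norm_le_l1_cart[of y] by linarith
  qed
  then show ?thesis
    unfolding test_functions_def using vertex_weight_calculus(1)[where G = G and lo = "cut_lo M" and hi = "cut_hi M", OF G_derivative cut_derivative \<epsilon>] by (simp add: compact_closure)
qed

text \<open>
  Kirchhoff's law at every lattice point. For the cut-off weights it is \<open>div F = 0\<close> tested with the vertex
  weight of \<open>a\<close>; the cut-off is removed by dominated convergence.
\<close>

lemma lattice_flux_conserved:
  fixes F :: "(real ^ 'n) set \<Rightarrow> real ^ 'n" and a :: "int ^ 'n"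
  assumes F: "borel_vector_measure F" "total_variation F UNIV = ennreal T" "T \<ge> 0" and div: "divergence_free F" and \<epsilon>: "\<epsilon> > 0"
  shows "(\<Sum>i\<in>UNIV. signed_integral (\<lambda>A. F A \<bullet> axis i 1) (cell_edge N \<epsilon> a i)
      - signed_integral (\<lambda>A. F A \<bullet> axis i 1) (cell_edge N \<epsilon> (a + axis i 1) i)) = 0"
proof -
  have fsm: "finite_signed_measure (\<lambda>A. F A \<bullet> axis i 1) T" for i
    by (rule component_bound_total_variation[OF F], rule eq_refl, rule norm_Basis) (simp add: axis_in_Basis_iff)
  have zero: "(\<Sum>i\<in>UNIV. signed_integral (\<lambda>A. F A \<bullet> axis i 1) (cut_edge M N \<epsilon> a i)
      - signed_integral (\<lambda>A. F A \<bullet> axis i 1) (cut_edge M N \<epsilon> (a + axis i 1) i)) = 0" for M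
  proof -
    have "distributional_div F (vertex_weight G (cut_lo M) (cut_hi M) N \<epsilon> a) = 0"
      using div vertex_weight_test_function[OF \<epsilon>] unfolding divergence_free_def by blast
    then have "(\<Sum>i\<in>UNIV. signed_integral (\<lambda>A. F A \<bullet> axis i 1)
        (\<lambda>y. 1 / \<epsilon> * (cut_edge M N \<epsilon> a i y - cut_edge M N \<epsilon> (a + axis i 1) i y))) = 0"
      unfolding distributional_div_def sum_Basis_vec vertex_weight_calculus(2)[where G = G and lo = "cut_lo M" and hi = "cut_hi M", OF G_derivative cut_derivative \<epsilon>] by simp
    moreover have "signed_integral (\<lambda>A. F A \<bullet> axis i 1)
        (\<lambda>y. 1 / \<epsilon> * (cut_edge M N \<epsilon> a i y - cut_edge M N \<epsilon> (a + axis i 1) i y))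
       = 1 / \<epsilon> * (signed_integral (\<lambda>A. F A \<bullet> axis i 1) (cut_edge M N \<epsilon> a i)
      - signed_integral (\<lambda>A. F A \<bullet> axis i 1) (cut_edge M N \<epsilon> (a + axis i 1) i))" for i
    proof -
      interpret finite_signed_measure "\<lambda>A. F A \<bullet> axis i 1" T by (rule fsm)
      (* Scalar multiples are sums over one index. *)
      have "signed_integral (\<lambda>A. F A \<bullet> axis i 1) (\<lambda>y. \<Sum>u\<in>{()}. 1 / \<epsilon> * (cut_edge M N \<epsilon> a i y - cut_edge M N \<epsilon> (a + axis i 1) i y))
        = (\<Sum>u\<in>{()}. 1 / \<epsilon> * signed_integral (\<lambda>A. F A \<bullet> axis i 1) (\<lambda>y. cut_edge M N \<epsilon> a i y - cut_edge M N \<epsilon> (a + axis i 1) i y))"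
      proof (rule signed_integral_sum[where K = "\<lambda>_. 2"])
        show "\<bar>cut_edge M N \<epsilon> a i y - cut_edge M N \<epsilon> (a + axis i 1) i y\<bar> \<le> 2" for y
          using abs_cut_edge_le[of M N \<epsilon> a i y] abs_cut_edge_le[of M N \<epsilon> "a + axis i 1" i y] by linarith
      qed (intro borel_measurable_diff cut_edge_measurable)
      also have "signed_integral (\<lambda>A. F A \<bullet> axis i 1) (\<lambda>y. cut_edge M N \<epsilon> a i y - cut_edge M N \<epsilon> (a + axis i 1) i y)
        = signed_integral (\<lambda>A. F A \<bullet> axis i 1) (cut_edge M N \<epsilon> a i) - signed_integral (\<lambda>A. F A \<bullet> axis i 1) (cut_edge M N \<epsilon> (a + axis i 1) i)"
        by (rule signed_integral_diff[where K = 1 and L = 1]) (auto intro: cut_edge_measurable abs_cut_edge_le)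
      finally show ?thesis by simp
    qed
    ultimately have "1 / \<epsilon> * (\<Sum>i\<in>UNIV. signed_integral (\<lambda>A. F A \<bullet> axis i 1) (cut_edge M N \<epsilon> a i)
      - signed_integral (\<lambda>A. F A \<bullet> axis i 1) (cut_edge M N \<epsilon> (a + axis i 1) i)) = 0"
      by (simp only: sum_distrib_left)
    then show ?thesis using \<epsilon> by simp
  qed
  have "(\<lambda>M. signed_integral (\<lambda>A. F A \<bullet> axis i 1) (cut_edge M N \<epsilon> b i)) \<longlonglongrightarrow> signed_integral (\<lambda>A. F A \<bullet> axis i 1) (cell_edge N \<epsilon> b i)" for b i
    by (rule finite_signed_measure.signed_integral_tendsto[OF fsm, where K = 1])
       (auto intro: cut_edge_measurable cell_edge_measurable cut_edge_tendsto abs_cut_edge_le)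
  then have "(\<lambda>M. \<Sum>i\<in>UNIV. signed_integral (\<lambda>A. F A \<bullet> axis i 1) (cut_edge M N \<epsilon> a i)
      - signed_integral (\<lambda>A. F A \<bullet> axis i 1) (cut_edge M N \<epsilon> (a + axis i 1) i))
    \<longlonglongrightarrow> (\<Sum>i\<in>UNIV. signed_integral (\<lambda>A. F A \<bullet> axis i 1) (cell_edge N \<epsilon> a i)
      - signed_integral (\<lambda>A. F A \<bullet> axis i 1) (cell_edge N \<epsilon> (a + axis i 1) i))"
    by (intro tendsto_sum tendsto_diff) auto
  then show ?thesis unfolding zero by (simp add: LIMSEQ_const_iff)
qed

lemma sum_hat_unit: "(\<Sum>k\<in>{- int N..int N}. hat G unit_lo unit_hi N k 0 s) = 1"
proof -
  have "{- int N..int N} = {- int N..<- int N + int (2 * N + 1)}" by auto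
  then show ?thesis
    using sum_int_telescope[of "\<lambda>k. ramp G unit_lo unit_hi N k 0 s" "- int N" "2 * N + 1"]
    by (simp add: hat_def ramp_def unit_lo_def unit_hi_def)
qed

lemma sum_ramp_unit:
  "(\<Sum>k\<in>{- int N..int N}. ramp G unit_lo unit_hi N k 1 s) = \<sigma> (s + real N - 1) - \<sigma> (s - real N - 1)"
proof -
  have "(\<Sum>k\<in>{- int N..int N}. ramp G unit_lo unit_hi N k 1 s) = (\<Sum>k\<in>{- int N + 1..int N}. G (Suc 0) (s - real_of_int k))"
    by (rule sum.mono_neutral_cong_right) (auto simp: ramp_def unit_lo_def)
  also have "{- int N + 1..int N} = {- int N + 1..<- int N + 1 + int (2 * N)}" by auto
  also have "(\<Sum>k\<in>\<dots>. G (Suc 0) (s - real_of_int k)) = (\<Sum>k\<in>\<dots>. \<sigma> (s - real_of_int k) - \<sigma> (s - real_of_int (k + 1)))"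
    by (intro sum.cong) (auto simp: G1 algebra_simps)
  also have "\<dots> = \<sigma> (s - real_of_int (- int N + 1)) - \<sigma> (s - real_of_int (- int N + 1 + int (2 * N)))"
    by (rule sum_int_telescope)
  finally show ?thesis by (simp add: algebra_simps)
qed

lemma sum_cell_edge:
  "(\<Sum>a\<in>grid_box N. cell_edge N \<epsilon> a i y) = \<sigma> (y $ i / \<epsilon> + real N - 1) - \<sigma> (y $ i / \<epsilon> - real N - 1)"
proof -
  have "(\<Sum>a\<in>grid_box N. cell_edge N \<epsilon> a i y) = (\<Prod>j\<in>UNIV. \<Sum>k\<in>{- int N..int N}.
     if j = i then ramp G unit_lo unit_hi N k 1 (y $ j / \<epsilon>) else hat G unit_lo unit_hi N k 0 (y $ j / \<epsilon>))"
    unfolding edge_weight_def by (rule sum_grid_box_prod)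
  also have "\<dots> = (\<Prod>j\<in>UNIV. if j = i then \<sigma> (y $ i / \<epsilon> + real N - 1) - \<sigma> (y $ i / \<epsilon> - real N - 1) else 1)"
    using sum_hat_unit sum_ramp_unit by (intro prod.cong) auto
  finally show ?thesis by simp
qed

lemma sum_cell_edge_le_1: "(\<Sum>a\<in>grid_box N. cell_edge N \<epsilon> a i y) \<le> 1"
  unfolding sum_cell_edge using \<sigma>_bounds[of "y $ i / \<epsilon> + real N - 1"] \<sigma>_bounds[of "y $ i / \<epsilon> - real N - 1"] by linarith

lemma sum_cell_edge_eq_1:
  assumes "\<bar>y $ i / \<epsilon>\<bar> \<le> real N - 2"
  shows "(\<Sum>a\<in>grid_box N. cell_edge N \<epsilon> a i y) = 1"
proof -
  have "2 \<le> y $ i / \<epsilon> + real N" "y $ i / \<epsilon> - real N \<le> 1" using assms by linarith+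
  then show ?thesis
    unfolding sum_cell_edge using \<sigma>_high[of "y $ i / \<epsilon> + real N - 1"] \<sigma>_low[of "y $ i / \<epsilon> - real N - 1"] by simp
qed

lemma cell_edge_outside: "a \<notin> grid_box N \<Longrightarrow> cell_edge N \<epsilon> a i y = 0"
proof -
  assume "a \<notin> grid_box N"
  then obtain j where "\<bar>a $ j\<bar> > int N" by (auto simp: grid_box_def not_le)
  then have "a $ j < - int N \<or> a $ j > int N" by linarith
  then have "(if j = i then ramp G unit_lo unit_hi N (a $ j) 1 (y $ j / \<epsilon>) else hat G unit_lo unit_hi N (a $ j) 0 (y $ j / \<epsilon>)) = 0"
    by (auto simp: hat_def ramp_def unit_lo_def unit_hi_def)
  then show ?thesis unfolding edge_weight_def by (intro prod_zero bexI[of _ j]) simp_all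
qed

text \<open>
  A point well inside the box only sees edges at a bounded lattice distance: the boundary ramps are constant
  near it.
\<close>

lemma cell_edge_local:
  assumes "cell_edge N \<epsilon> a i y \<noteq> 0" "\<bar>y $ j / \<epsilon>\<bar> \<le> real N - 4"
  shows "\<bar>y $ j / \<epsilon> - real_of_int (a $ j)\<bar> \<le> 3"
proof (rule ccontr)
  define s where "s = y $ j / \<epsilon>"
  define k where "k = a $ j"
  assume "\<not> ?thesis"
  then have far: "s - real_of_int k < - 3 \<or> s - real_of_int k > 3" unfolding s_def k_def by linarith
  have s: "\<bar>s\<bar> \<le> real N - 4" using assms(2) by (simp add: s_def)
  have "(if j = i then ramp G unit_lo unit_hi N k 1 s else hat G unit_lo unit_hi N k 0 s) = 0"
  proof -
    have r1: "ramp G unit_lo unit_hi N k 1 s = 0"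
      using far G1_zero[of "s - real_of_int k"] by (auto simp: ramp_def unit_lo_def unit_hi_def)
    have small: "ramp G unit_lo unit_hi N k' 0 s = 0" if "s \<le> real_of_int k'" for k'
      using that s G_low[of "s - real_of_int k'"] by (auto simp: ramp_def unit_lo_def unit_hi_def)
    have big: "ramp G unit_lo unit_hi N k' 0 s = 1" if "real_of_int k' + 2 \<le> s" for k'
      using that s G_high[of "s - real_of_int k'"] by (auto simp: ramp_def unit_lo_def unit_hi_def)
    have "hat G unit_lo unit_hi N k 0 s = 0"
      using far small[of k] small[of "k + 1"] big[of k] big[of "k + 1"] by (auto simp: hat_def)
    with r1 show ?thesis by simp
  qed
  then have "cell_edge N \<epsilon> a i y = 0"
    unfolding edge_weight_def s_def k_def by (intro prod_zero bexI[of _ j]) simp_all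
  with assms(1) show False by simp
qed

text \<open>
  The left-hand side is the integral of a weighted mean of values of \<open>\<psi>\<close> at lattice points, and the points that
  carry weight at \<open>y\<close> are within \<open>O(\<epsilon> n)\<close> of \<open>y\<close> as soon as the box, of size \<open>\<epsilon> n * N n\<close>, contains \<open>y\<close> well
  inside. Hence the integrands are uniformly bounded and converge to \<open>\<psi>\<close> pointwise.
\<close>

lemma lattice_approximation_tendsto:
  fixes \<psi> :: "real ^ 'n \<Rightarrow> real"
  assumes \<mu>: "finite_signed_measure \<mu> m"
    and \<psi>: "continuous_on UNIV \<psi>" "\<And>y. \<bar>\<psi> y\<bar> \<le> K"
    and \<epsilon>: "\<And>n. \<epsilon> n > 0" "\<epsilon> \<longlonglongrightarrow> 0" and N: "filterlim (\<lambda>n. \<epsilon> n * real (N n)) at_top sequentially"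
  shows "(\<lambda>n. \<Sum>a\<in>grid_box (N n). signed_integral \<mu> (cell_edge (N n) (\<epsilon> n) a i)
      * ((\<psi> (\<epsilon> n *\<^sub>R lattice_vec (a - axis i 1)) + \<psi> (\<epsilon> n *\<^sub>R lattice_vec a)) / 2)) \<longlonglongrightarrow> signed_integral \<mu> \<psi>"
proof -
  interpret \<mu>: finite_signed_measure \<mu> m by fact
  define \<Psi> where "\<Psi> n a = (\<psi> (\<epsilon> n *\<^sub>R lattice_vec (a - axis i 1)) + \<psi> (\<epsilon> n *\<^sub>R lattice_vec a)) / 2" for n a
  define \<Theta> where "\<Theta> n y = (\<Sum>a\<in>grid_box (N n). \<Psi> n a * cell_edge (N n) (\<epsilon> n) a i y)" for n y
  have K: "K \<ge> 0" using \<psi>(2)[of 0] by linarith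
  have \<Psi>: "\<bar>\<Psi> n a\<bar> \<le> K" for n a
    using \<psi>(2)[of "\<epsilon> n *\<^sub>R lattice_vec (a - axis i 1)"] \<psi>(2)[of "\<epsilon> n *\<^sub>R lattice_vec a"] unfolding \<Psi>_def by (simp add: abs_le_iff)
  have cell1: "\<bar>cell_edge M e a i y\<bar> \<le> 1" for M e a y
  proof (cases "a \<in> grid_box M")
    case True
    then have "cell_edge M e a i y \<le> (\<Sum>a\<in>grid_box M. cell_edge M e a i y)"
      using finite_grid_box by (intro member_le_sum cell_edge_nonneg) auto
    then show ?thesis using sum_cell_edge_le_1[of M e i y] cell_edge_nonneg[of M e a i y] by linarith
  qed (simp add: cell_edge_outside)
  have bound: "\<bar>\<Theta> n y\<bar> \<le> K" for n y
  proof -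
    have "\<bar>\<Theta> n y\<bar> \<le> (\<Sum>a\<in>grid_box (N n). \<bar>\<Psi> n a * cell_edge (N n) (\<epsilon> n) a i y\<bar>)"
      unfolding \<Theta>_def by (rule sum_abs)
    also have "\<dots> \<le> (\<Sum>a\<in>grid_box (N n). K * cell_edge (N n) (\<epsilon> n) a i y)"
      using \<Psi> cell_edge_nonneg K by (intro sum_mono) (auto simp: abs_mult intro!: mult_mono)
    also have "\<dots> \<le> K * 1"
      unfolding sum_distrib_left[symmetric] using K sum_cell_edge_le_1 by (intro mult_left_mono) auto
    finally show ?thesis by simp
  qed
  have meas: "\<Theta> n \<in> borel_measurable borel" for n
    unfolding \<Theta>_def[abs_def] by (intro borel_measurable_sum borel_measurable_times borel_measurable_const cell_edge_measurable)
  have lim: "(\<lambda>n. \<Theta> n y) \<longlonglongrightarrow> \<psi> y" for y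
  proof (rule LIMSEQ_I)
    fix e :: real assume e: "e > 0"
    have "isCont \<psi> y" using \<psi>(1) by (simp add: continuous_on_eq_continuous_at)
    then obtain \<delta> where \<delta>: "\<delta> > 0" "\<And>z. norm (z - y) < \<delta> \<Longrightarrow> \<bar>\<psi> z - \<psi> y\<bar> < e / 2"
      using e unfolding continuous_at_eps_delta by (metis half_gt_zero dist_norm dist_real_def)
    have "\<forall>\<^sub>F n in sequentially. \<epsilon> n * (3 * real CARD('n) + 1) < \<delta>"
    proof -
      have "(\<lambda>n. \<epsilon> n * (3 * real CARD('n) + 1)) \<longlonglongrightarrow> 0 * (3 * real CARD('n) + 1)"
        by (intro tendsto_intros \<epsilon>)
      then show ?thesis using \<delta>(1) by (intro order_tendstoD(2)) auto
    qed
    moreover have "\<forall>\<^sub>F n in sequentially. \<epsilon> n < 1" using \<epsilon>(2) by (rule order_tendstoD(2)) simp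
    moreover have "\<forall>\<^sub>F n in sequentially. norm y + 4 \<le> \<epsilon> n * real (N n)"
      using N by (simp add: filterlim_at_top)
    ultimately have "\<forall>\<^sub>F n in sequentially. norm (\<Theta> n y - \<psi> y) < e"
    proof eventually_elim
      case (elim n)
      have big: "\<bar>y $ j / \<epsilon> n\<bar> \<le> real (N n) - 4" for j
      proof -
        have "\<bar>y $ j\<bar> + 4 * \<epsilon> n \<le> norm y + 4" using component_le_norm_cart[of y j] elim(2) by simp
        then have "\<bar>y $ j\<bar> + 4 * \<epsilon> n \<le> \<epsilon> n * real (N n)" using elim(3) by linarith
        then show ?thesis using \<epsilon>(1)[of n] by (simp add: field_simps)
      qed
      have one: "(\<Sum>a\<in>grid_box (N n). cell_edge (N n) (\<epsilon> n) a i y) = 1"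
        using big[of i] by (intro sum_cell_edge_eq_1) linarith
      have close: "\<bar>\<Psi> n a - \<psi> y\<bar> \<le> e / 2" if a: "cell_edge (N n) (\<epsilon> n) a i y \<noteq> 0" for a
      proof -
        have "norm (lattice_vec a - (1 / \<epsilon> n) *\<^sub>R y) \<le> (\<Sum>j\<in>UNIV. \<bar>(lattice_vec a - (1 / \<epsilon> n) *\<^sub>R y) $ j\<bar>)"
          by (rule norm_le_l1_cart)
        also have "\<dots> \<le> (\<Sum>j\<in>(UNIV :: 'n set). 3)"
          using cell_edge_local[OF a big] by (intro sum_mono) (simp add: lattice_vec_def abs_minus_commute)
        finally have 1: "norm (lattice_vec a - (1 / \<epsilon> n) *\<^sub>R y) \<le> 3 * real CARD('n)" by simp
        have "norm (lattice_vec (a - axis i 1) - lattice_vec a) \<le> 1"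
          using norm_lattice_vec_le[of "a - axis i 1" a] adjacent_axis[of a i] by (simp add: adjacent_def)
        then have 2: "norm (lattice_vec (a - axis i 1) - (1 / \<epsilon> n) *\<^sub>R y) \<le> 3 * real CARD('n) + 1"
          using 1 norm_triangle_ineq[of "lattice_vec (a - axis i 1) - lattice_vec a" "lattice_vec a - (1 / \<epsilon> n) *\<^sub>R y"] by simp
        have scale: "norm (\<epsilon> n *\<^sub>R v - y) = \<epsilon> n * norm (v - (1 / \<epsilon> n) *\<^sub>R y)" for v
        proof -
          have "\<epsilon> n *\<^sub>R v - y = \<epsilon> n *\<^sub>R (v - (1 / \<epsilon> n) *\<^sub>R y)" using \<epsilon>(1)[of n] by (simp add: scaleR_diff_right)
          then show ?thesis using \<epsilon>(1)[of n] by simp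
        qed
        have "norm (\<epsilon> n *\<^sub>R lattice_vec (a - axis i 1) - y) < \<delta>" "norm (\<epsilon> n *\<^sub>R lattice_vec a - y) < \<delta>"
          unfolding scale using 1 2 elim(1) \<epsilon>(1)[of n]
          by (meson add_increasing2 less_eq_real_def mult_left_mono order_le_less_trans zero_le_one order_trans)+
        note \<delta>(2)[OF this(1)] \<delta>(2)[OF this(2)]
        moreover have "\<bar>(u + v) / 2 - p\<bar> \<le> e / 2" if "\<bar>u - p\<bar> < e / 2" "\<bar>v - p\<bar> < e / 2" for u v p :: real
          using that unfolding abs_le_iff abs_less_iff by (auto simp: field_simps)
        ultimately show ?thesis unfolding \<Psi>_def by blast
      qed
      have "\<Theta> n y - \<psi> y = (\<Sum>a\<in>grid_box (N n). (\<Psi> n a - \<psi> y) * cell_edge (N n) (\<epsilon> n) a i y)"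
        unfolding left_diff_distrib sum_subtractf sum_distrib_left[symmetric] one \<Theta>_def by simp
      then have "norm (\<Theta> n y - \<psi> y) \<le> (\<Sum>a\<in>grid_box (N n). \<bar>(\<Psi> n a - \<psi> y) * cell_edge (N n) (\<epsilon> n) a i y\<bar>)"
        by (simp add: sum_abs)
      also have "\<dots> \<le> (\<Sum>a\<in>grid_box (N n). (e / 2) * cell_edge (N n) (\<epsilon> n) a i y)"
      proof (rule sum_mono)
        fix a
        show "\<bar>(\<Psi> n a - \<psi> y) * cell_edge (N n) (\<epsilon> n) a i y\<bar> \<le> (e / 2) * cell_edge (N n) (\<epsilon> n) a i y"
          using close[of a] cell_edge_nonneg[of "N n" "\<epsilon> n" a i y]
          by (cases "cell_edge (N n) (\<epsilon> n) a i y = 0") (auto simp: abs_mult intro!: mult_right_mono)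
      qed
      also have "\<dots> = e / 2" unfolding sum_distrib_left[symmetric] one by simp
      finally show ?case using e by linarith
    qed
    then show "\<exists>no. \<forall>n\<ge>no. norm (\<Theta> n y - \<psi> y) < e" by (simp add: eventually_sequentially)
  qed
  have "(\<lambda>n. signed_integral \<mu> (\<Theta> n)) \<longlonglongrightarrow> signed_integral \<mu> \<psi>"
    by (rule \<mu>.signed_integral_tendsto[where K = K]) (auto intro: meas lim bound borel_measurable_continuous_onI \<psi>)
  moreover have "signed_integral \<mu> (\<Theta> n) = (\<Sum>a\<in>grid_box (N n). \<Psi> n a * signed_integral \<mu> (cell_edge (N n) (\<epsilon> n) a i))" for n
    unfolding \<Theta>_def[abs_def] by (rule \<mu>.signed_integral_sum[where K = "\<lambda>_. 1"]) (auto intro: cell_edge_measurable cell1)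
  ultimately show ?thesis unfolding \<Psi>_def by (simp only: mult.commute)
qed

end

section \<open>The maximal inequality for the heat semigroup\<close>

lemma edge_current_axis: "edge_current \<phi> (a - axis i 1) a = ((\<phi> (a - axis i 1) + \<phi> a) / 2) *\<^sub>R axis i 1"
proof -
  have "lattice_vec a - lattice_vec (a - axis i 1) = axis i 1"
    by (simp add: lattice_vec_def vec_eq_iff axis_def)
  then show ?thesis by (simp add: edge_current_def)
qed

lemma abs_heat_kernel_le:
  fixes z :: "'a::euclidean_space"
  assumes "t > 0"
  shows "\<bar>heat_kernel t z\<bar> \<le> (4 * pi * t) powr (- real DIM('a) / 2)"
  using assms by (auto simp: heat_kernel_def abs_mult mult_left_le)

theorem corollary4:
  fixes \<alpha> C' :: real
  assumes "real CARD('n::finite) - 1 \<le> \<alpha>" and "\<alpha> < real CARD('n)" and "C' > 0"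
  shows "\<exists>C>0. \<forall>(\<nu> :: (real ^ 'n) measure) (F :: (real ^ 'n) set \<Rightarrow> real ^ 'n).
    radon_measure \<nu> \<longrightarrow>
    (\<forall>x r. r > 0 \<longrightarrow> emeasure \<nu> (ball x r) \<le> ennreal (C' * r powr (real CARD('n) - \<alpha>))) \<longrightarrow>
    F \<in> finite_radon_vector_measures \<longrightarrow>
    divergence_free F \<longrightarrow>
    (\<integral>\<^sup>+ x. (SUP t\<in>{0<..}. ennreal (t powr (\<alpha> / 2) * norm (heat_semigroup t F x))) \<partial>\<nu>)
      \<le> ennreal C * total_variation F UNIV"
proof -
  obtain G \<sigma> where "smooth_step G \<sigma>" using ex_smooth_step by blast
  then interpret smooth_step G \<sigma> .
  define A where "A = C' * (4 * gauss_const TYPE('n) + 522)"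
  have A: "A > 0" unfolding A_def using assms(3) by (intro mult_pos_pos) (auto simp: gauss_const_def intro!: add_nonneg_pos)
  define C where "C = 4 * A * real CARD('n)"
  have C: "C > 0" using A by (simp add: C_def)
  show ?thesis
  proof (intro exI[of _ C] conjI C allI impI)
    fix \<nu> :: "(real ^ 'n) measure" and F :: "(real ^ 'n) set \<Rightarrow> real ^ 'n"
    assume \<nu>: "radon_measure \<nu>"
      and growth: "\<forall>x r. r > 0 \<longrightarrow> emeasure \<nu> (ball x r) \<le> ennreal (C' * r powr (real CARD('n) - \<alpha>))"
      and F: "F \<in> finite_radon_vector_measures" and div: "divergence_free F"
    interpret bg: ball_growth \<nu> \<alpha> "real CARD('n) - \<alpha>" C'
      using \<nu> growth assms by unfold_locales (auto simp: radon_measure_def)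
    have atom_const: "bg.atom_const = A" by (simp add: bg.atom_const_def A_def)
    define T where "T = enn2real (total_variation F UNIV)"
    have T: "total_variation F UNIV = ennreal T" "T \<ge> 0" and bvm: "borel_vector_measure F"
      using F by (auto simp: T_def finite_radon_vector_measures_def)
    have fsm: "finite_signed_measure (\<lambda>B. F B \<bullet> axis i 1) T" for i
      by (rule component_bound_total_variation[OF bvm T], rule eq_refl, rule norm_Basis) (simp add: axis_in_Basis_iff)
    define \<epsilon> :: "nat \<Rightarrow> real" where "\<epsilon> n = inverse (real (Suc n))" for n
    (* The mesh tends to zero while the box, of size \<epsilon> n * N n = n + 1, exhausts the space. *)
    define N :: "nat \<Rightarrow> nat" where "N n = (Suc n)\<^sup>2" for n
    have \<epsilon>: "\<epsilon> n > 0" for n by (simp add: \<epsilon>_def)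
    have \<epsilon>0: "\<epsilon> \<longlonglongrightarrow> 0" unfolding \<epsilon>_def[abs_def] by (rule LIMSEQ_inverse_real_of_nat)
    have N: "filterlim (\<lambda>n. \<epsilon> n * real (N n)) at_top sequentially"
    proof -
      have "\<epsilon> n * real (N n) = real (Suc n)" for n
      proof -
        have "real (N n) = real (Suc n) * real (Suc n)" by (simp only: N_def power2_eq_square of_nat_mult)
        then show ?thesis by (simp add: \<epsilon>_def mult.assoc[symmetric] del: of_nat_Suc)
      qed
      then show ?thesis using filterlim_compose[OF filterlim_real_sequentially filterlim_Suc] by simp
    qed
    define f where "f n = (\<lambda>(a, i). signed_integral (\<lambda>B. F B \<bullet> axis i 1) (cell_edge (N n) (\<epsilon> n) a i))" for n
    define E :: "nat \<Rightarrow> ((int ^ 'n) \<times> 'n) set" where "E n = grid_box (N n) \<times> UNIV" for n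
    have finE: "finite (E n)" for n by (simp add: E_def finite_grid_box)
    define U where "U n t x = (\<Sum>(a, i)\<in>E n. f n (a, i) *\<^sub>R edge_current (lattice_heat (\<epsilon> n) t x) (a - axis i 1) a)" for n t x
    have f_out: "f n (a, i) = 0" if "a \<notin> grid_box (N n)" for n a i
    proof -
      have "cell_edge (N n) (\<epsilon> n) a i = (\<lambda>_. 0)" using that by (intro ext cell_edge_outside)
      then show ?thesis by (simp add: f_def signed_integral_def)
    qed
    have conserved: "(\<Sum>(a, i)\<in>E n. f n (a, i) * (of_bool (a - axis i 1 = x) - of_bool (a = x))) = 0" for n x
    proof -
      have pick: "(\<Sum>a\<in>grid_box (N n). f n (a, i) * of_bool (a = b)) = f n (b, i)" for i b
      proof -
        have "(\<Sum>a\<in>grid_box (N n). f n (a, i) * of_bool (a = b)) = (\<Sum>a\<in>grid_box (N n). if a = b then f n (b, i) else 0)"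
          by (intro sum.cong) auto
        then show ?thesis using f_out[of b n i] by (auto simp: finite_grid_box)
      qed
      have "(\<Sum>(a, i)\<in>E n. f n (a, i) * (of_bool (a - axis i 1 = x) - of_bool (a = x)))
        = (\<Sum>i\<in>UNIV. \<Sum>a\<in>grid_box (N n). f n (a, i) * of_bool (a = x + axis i 1) - f n (a, i) * of_bool (a = x))"
        unfolding E_def sum.cartesian_product[symmetric]
        by (subst sum.swap) (simp add: right_diff_distrib diff_eq_eq)
      also have "\<dots> = (\<Sum>i\<in>UNIV. f n (x + axis i 1, i) - f n (x, i))"
        unfolding sum_subtractf pick ..
      also have "\<dots> = - (\<Sum>i\<in>UNIV. f n (x, i) - f n (x + axis i 1, i))" by (simp add: sum_subtractf)
      also have "\<dots> = 0" using lattice_flux_conserved[OF bvm T div \<epsilon>, of "N n" n x] by (simp add: f_def)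
      finally show ?thesis .
    qed
    have mass: "(\<Sum>e\<in>E n. \<bar>f n e\<bar>) \<le> real CARD('n) * (2 * T)" for n
    proof -
      have "(\<Sum>e\<in>E n. \<bar>f n e\<bar>) = (\<Sum>i\<in>UNIV. \<Sum>a\<in>grid_box (N n). \<bar>f n (a, i)\<bar>)"
        unfolding E_def by (subst sum.swap) (simp add: sum.cartesian_product)
      also have "\<dots> \<le> (\<Sum>i\<in>(UNIV :: 'n set). 2 * T)"
        unfolding f_def prod.case
        by (intro sum_mono finite_signed_measure.sum_abs_signed_integral_le[OF fsm] cell_edge_measurable
            cell_edge_nonneg sum_cell_edge_le_1 finite_grid_box)
      finally show ?thesis by simp
    qed
    have bound: "(\<integral>\<^sup>+ x. heat_sup \<alpha> ((\<epsilon> n)\<^sup>2) (U n) x \<partial>\<nu>) \<le> ennreal (C * T)" for n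
    proof -
      have "(\<integral>\<^sup>+ x. heat_sup \<alpha> ((\<epsilon> n)\<^sup>2) (U n) x \<partial>\<nu>) \<le> ennreal (2 * A * (\<Sum>e\<in>E n. \<bar>f n e\<bar>))"
        unfolding U_def[abs_def] atom_const[symmetric] by (rule bg.signed_flow_bound[OF \<epsilon> finE conserved])
      also have "\<dots> \<le> ennreal (2 * A * (real CARD('n) * (2 * T)))"
        using A mass by (intro ennreal_leI mult_left_mono) auto
      finally show ?thesis by (simp add: C_def mult_ac)
    qed
    have meas: "heat_sup \<alpha> ((\<epsilon> n)\<^sup>2) (U n) \<in> borel_measurable \<nu>" for n
      unfolding bg.measurable_\<nu>
    proof (rule heat_sup_measurable)
      fix t assume "(\<epsilon> n)\<^sup>2 \<le> t"
      then have "t > 0" using \<epsilon>[of n] by (meson less_le_trans zero_less_power)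
      then show "continuous_on UNIV (U n t)"
        unfolding U_def[abs_def] case_prod_unfold edge_current_def by (intro continuous_intros) auto
    qed
    have lim: "(\<lambda>n. U n t x) \<longlonglongrightarrow> heat_semigroup t F x" if t: "t > 0" for t x
    proof -
      have U: "U n t x = (\<Sum>i\<in>UNIV. (\<Sum>a\<in>grid_box (N n). signed_integral (\<lambda>B. F B \<bullet> axis i 1) (cell_edge (N n) (\<epsilon> n) a i)
         * ((heat_kernel t (x - \<epsilon> n *\<^sub>R lattice_vec (a - axis i 1)) + heat_kernel t (x - \<epsilon> n *\<^sub>R lattice_vec a)) / 2)) *\<^sub>R axis i 1)" for n
        unfolding U_def E_def sum.cartesian_product[symmetric] edge_current_axis f_def lattice_heat_def
        by (subst sum.swap) (simp add: scaleR_sum_left)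
      show ?thesis
        unfolding U heat_semigroup_def vector_integral_def sum_Basis_vec
      proof (intro tendsto_sum tendsto_scaleR tendsto_const)
        fix i :: 'n
        have "continuous_on UNIV (\<lambda>y. heat_kernel t (x - y))"
          by (rule continuous_on_compose2[OF continuous_heat_kernel[OF t]]) (auto intro!: continuous_intros)
        from lattice_approximation_tendsto[OF fsm[of i] this abs_heat_kernel_le[OF t] \<epsilon> \<epsilon>0 N, of i]
        show "(\<lambda>n. \<Sum>a\<in>grid_box (N n). signed_integral (\<lambda>B. F B \<bullet> axis i 1) (cell_edge (N n) (\<epsilon> n) a i)
         * ((heat_kernel t (x - \<epsilon> n *\<^sub>R lattice_vec (a - axis i 1)) + heat_kernel t (x - \<epsilon> n *\<^sub>R lattice_vec a)) / 2))
          \<longlonglongrightarrow> signed_integral (\<lambda>B. F B \<bullet> axis i 1) (\<lambda>y. heat_kernel t (x - y))" .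
      qed
    qed
    have "(SUP t\<in>{0<..}. ennreal (t powr (\<alpha> / 2) * norm (heat_semigroup t F x)))
        \<le> liminf (\<lambda>n. heat_sup \<alpha> ((\<epsilon> n)\<^sup>2) (U n) x)" for x
    proof (rule SUP_least)
      fix t :: real assume "t \<in> {0<..}"
      then have t: "t > 0" by simp
      have "(\<lambda>n. ennreal (t powr (\<alpha> / 2) * norm (U n t x))) \<longlonglongrightarrow> ennreal (t powr (\<alpha> / 2) * norm (heat_semigroup t F x))"
        by (intro tendsto_ennrealI tendsto_intros lim t)
      then have "ennreal (t powr (\<alpha> / 2) * norm (heat_semigroup t F x)) = liminf (\<lambda>n. ennreal (t powr (\<alpha> / 2) * norm (U n t x)))"
        by (intro lim_imp_Liminf[symmetric]) auto
      also have "\<dots> \<le> liminf (\<lambda>n. heat_sup \<alpha> ((\<epsilon> n)\<^sup>2) (U n) x)"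
        (* A fixed time t is eventually among the admissible times. *)
      proof (rule Liminf_mono)
        have "(\<lambda>n. (\<epsilon> n)\<^sup>2) \<longlonglongrightarrow> 0\<^sup>2" by (intro tendsto_intros \<epsilon>0)
        then have "\<forall>\<^sub>F n in sequentially. (\<epsilon> n)\<^sup>2 < t" using t by (intro order_tendstoD(2)) auto
        then show "\<forall>\<^sub>F n in sequentially. ennreal (t powr (\<alpha> / 2) * norm (U n t x)) \<le> heat_sup \<alpha> ((\<epsilon> n)\<^sup>2) (U n) x"
          unfolding heat_sup_def by eventually_elim (auto intro: SUP_upper)
      qed
      finally show "ennreal (t powr (\<alpha> / 2) * norm (heat_semigroup t F x)) \<le> liminf (\<lambda>n. heat_sup \<alpha> ((\<epsilon> n)\<^sup>2) (U n) x)" .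
    qed
    then have "(\<integral>\<^sup>+ x. (SUP t\<in>{0<..}. ennreal (t powr (\<alpha> / 2) * norm (heat_semigroup t F x))) \<partial>\<nu>)
      \<le> (\<integral>\<^sup>+ x. liminf (\<lambda>n. heat_sup \<alpha> ((\<epsilon> n)\<^sup>2) (U n) x) \<partial>\<nu>)"
      by (rule nn_integral_mono)
    also have "\<dots> \<le> liminf (\<lambda>n. \<integral>\<^sup>+ x. heat_sup \<alpha> ((\<epsilon> n)\<^sup>2) (U n) x \<partial>\<nu>)"
      by (rule nn_integral_liminf[OF meas])
    also have "\<dots> \<le> liminf (\<lambda>_ :: nat. ennreal (C * T))"
      by (intro Liminf_mono always_eventually allI bound)
    also have "\<dots> = ennreal (C * T)" by (simp add: Liminf_const)
    also have "\<dots> = ennreal C * total_variation F UNIV"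
      using C T by (simp add: ennreal_mult)
    finally show "(\<integral>\<^sup>+ x. (SUP t\<in>{0<..}. ennreal (t powr (\<alpha> / 2) * norm (heat_semigroup t F x))) \<partial>\<nu>)
      \<le> ennreal C * total_variation F UNIV" .
  qed
qed

end
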